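(* Let $R$ be a $\varphi$-ring over $\mathbb{Z}_p$ and let $R[[H_1,\ell]]$ be the completed skew group ring attached to $(H_0,\ell,\varphi,\iota)$. The functors $$\mathbb{D}:=R\otimes_{R[[H_1,\ell]],\ell_R}\cdot\ \colon\ \mathfrak{M}(R[[H_1,\ell]],\varphi)\to\mathfrak{M}(R,\varphi)$$ and $$\mathbb{M}:=R[[H_1,\ell]]\otimes_{R,\iota_R}\cdot\ \colon\ \mathfrak{M}(R,\varphi)\to\mathfrak{M}(R[[H_1,\ell]],\varphi)$$ are quasi-inverse equivalences of categories.
   Context: $p$ is a prime. A $\varphi$-ring over $\mathbb{Z}_p$ is a commutative ring $R$ with $1$, together with an injective group homomorphism $\chi\colon\mathbb{Z}_p\hookrightarrow R^\times$ (from the additive group) and an injective ring homomorphism $\varphi\colon R\to R$ with $\varphi(\chi(x))=\chi(px)$ for all $x\in\mathbb{Z}_p$ and $R=\bigoplus_{i=0}^{p-1}\chi(i)\varphi(R)$. Group data: $H_0$ is a pro-$p$ group of finite rank without elements of order $p$; $\ell\colon H_0\to\mathbb{Z}_p$ is a continuous surjective homomorphism; $H_1=\ker\ell$. One assumes: (A) there is given an injective group endomorphism $\varphi\colon H_0\to H_0$ with $\varphi(H_0)$ of finite index and $\ell(\varphi(h))=p\,\ell(h)$; (B) $\bigcap_{n\ge1}\varphi^n(H_0)=\{1\}$ and the $\varphi^n(H_0)$ form a system of neighbourhoods of $1$ in $H_0$; (C) there is a fixed (continuous) group homomorphism $\iota\colon\mathbb{Z}_p\to H_0$ with $\ell\circ\iota=\mathrm{id}$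 and $\iota(px)=\varphi(\iota(x))$. For $k\ge1$, $H_k\lhd H_0$ is the normal subgroup of $H_0$ generated by $\varphi^{k-1}(H_1)$; one has $\varphi(H_k)\subseteq H_{k+1}\subseteq H_k\subseteq H_1$, and $H_1/H_k$ is finite. Skew group rings: $R[H_1/H_k,\ell]:=\bigoplus_{h\in H_1/H_k}Rh$ as a left $R$-module. Choose $c_k\ge1$ such that $\iota(p^{c_k}\mathbb{Z}_p)$ acts trivially by conjugation on $H_1/H_k$. Each $r_2\in R$ is uniquely $r_2=\sum_{i=0}^{p^{c_k}-1}\chi(i)\varphi^{c_k}(r_{i,2})$, and the (biadditive) multiplication is $(r_1h_1)(r_2h_2):=\sum_{i=0}^{p^{c_k}-1}r_1\chi(i)\varphi^{c_k}(r_{i,2})\big(\iota(i)^{-1}h_1\iota(i)h_2\big)$. This is a ring, and $\varphi(rh):=\varphi(r)\varphi(h)$ defines a ring endomorphism. Put $R[[H_1,\ell]]:=\varprojlim_kR[H_1/H_k,\ell]$ with the induced $\varphi$. The ring homomorphism $\ell_R\colon R[[H_1,\ell]]\to R$ is induced by $H_1\to 1$, and $\iota_R\colon R\to R[[H_1,\ell]]$ is the natural inclusion; $\ell_R\circ\iota_R=\mathrm{id}_R$. For $S=R$ or $S=R[[H_1,\ell]]$, a $\varphi$-module over $S$ is a free (left) $S$-module $D$ of finite rank with a $\varphi$-semilinear additive map $\varphi\colon D\to D$ such that $S\otimes_{S,\varphi}D\to D$, $r\otimes d\mapsto r\varphi(d)$, is an isomorphism. $\mathfrak{M}(S,\varphi)$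 is the category of $\varphi$-modules over $S$, with morphisms the $S$-linear maps commuting with $\varphi$. *)

theory Defs
  imports "HOL-Analysis.Analysis" "HOL-Algebra.Free_Abelian_Groups" "HOL-Algebra.Module"
    "HOL-Algebra.Multiplicative_Group"
begin

section \<open>The \<open>p\<close>-adic integers\<close>

text \<open>The inverse limit of the rings \<open>\<int>/p\<^sup>n\<close>: the \<open>n\<close>-th entry of \<open>x\<close> is the representative of
  \<open>x\<close> modulo \<open>p\<^sup>n\<close> in \<open>{0..<p\<^sup>n}\<close>.\<close>

definition Zp :: "nat \<Rightarrow> (nat \<Rightarrow> int) ring" where
  "Zp p = \<lparr>carrier = {x. \<forall>n. x n \<in> {0..<int p ^ n} \<and> x (Suc n) mod int p ^ n = x n},
           mult = (\<lambda>x y n. (x n * y n) mod int p ^ n),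
           one = (\<lambda>n. 1 mod int p ^ n),
           zero = (\<lambda>n. 0),
           add = (\<lambda>x y n. (x n + y n) mod int p ^ n)\<rparr>"

definition Zp_of_int :: "nat \<Rightarrow> int \<Rightarrow> (nat \<Rightarrow> int)" where
  "Zp_of_int p a = (\<lambda>n. a mod int p ^ n)"

definition Zp_topology :: "nat \<Rightarrow> (nat \<Rightarrow> int) topology" where
  "Zp_topology p =
     subtopology (product_topology (\<lambda>_. discrete_topology UNIV) UNIV) (carrier (Zp p))"


section \<open>Pro-\<open>p\<close> groups of finite rank\<close>

locale topological_group = group G for G :: "('g, 'm) monoid_scheme" (structure) +
  fixes T :: "'g topology"
  assumes topspace_eq: "topspace T = carrier G"
    and continuous_mult: "continuous_map (prod_topology T T) T (\<lambda>(x, y). x \<otimes> y)"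
    and continuous_inv: "continuous_map T T (\<lambda>x. inv x)"

locale pro_p_group = topological_group G T
  for p :: nat and G :: "('g, 'm) monoid_scheme" (structure) and T :: "'g topology" +
  assumes compact: "compact_space T"
    and Hausdorff: "Hausdorff_space T"
    and open_subgroups_base: "neighbourhood_base_at \<one> (\<lambda>U. openin T U \<and> subgroup U G) T"
    and open_normal_index:
      "\<And>U. U \<lhd> G \<Longrightarrow> openin T U \<Longrightarrow> finite (rcosets U) \<and> (\<exists>n. card (rcosets U) = p ^ n)"

text \<open>Finite (Pruefer) rank: there is a uniform bound for the minimal number of topological
  generators of the closed subgroups.\<close>

definition finite_rank :: "('g, 'm) monoid_scheme \<Rightarrow> 'g topology \<Rightarrow> bool" where
  "finite_rank G T \<longleftrightarrow>
     (\<exists>r. \<forall>U. subgroup U G \<and> closedin T U \<longrightarrow>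
        (\<exists>X\<subseteq>U. finite X \<and> card X \<le> r \<and> T closure_of (generate G X) = U))"

definition normal_closure :: "('g, 'm) monoid_scheme \<Rightarrow> 'g set \<Rightarrow> 'g set" where
  "normal_closure G X = \<Inter> {N. N \<lhd> G \<and> X \<subseteq> N}"


section \<open>\<open>\<phi>\<close>-rings\<close>

record 'r frob_ring = "'r ring" +
  frob :: "'r \<Rightarrow> 'r"

record 'r phi_ring = "'r frob_ring" +
  chi :: "(nat \<Rightarrow> int) \<Rightarrow> 'r"

text \<open>The last assumption is \<open>R = \<Oplus>\<^bsub>i<p\<^esub> \<chi>(i)\<phi>(R)\<close> as an internal direct sum.\<close>

locale phi_ring = cring R for p :: nat and R :: "('r, 'm) phi_ring_scheme" (structure) +
  assumes chi_hom: "chi R \<in> hom (add_monoid (Zp p)) (units_of R)"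
    and chi_inj: "inj_on (chi R) (carrier (Zp p))"
    and frob_hom: "frob R \<in> ring_hom R R"
    and frob_inj: "inj_on (frob R) (carrier R)"
    and frob_chi: "\<And>x. x \<in> carrier (Zp p) \<Longrightarrow>
           frob R (chi R x) = chi R (Zp_of_int p (int p) \<otimes>\<^bsub>Zp p\<^esub> x)"
    and direct_sum: "\<And>r. r \<in> carrier R \<Longrightarrow>
           \<exists>!x. x \<in> (\<Pi>\<^sub>E i\<in>{..<p}. (\<lambda>s. chi R (Zp_of_int p (int i)) \<otimes> frob R s) ` carrier R) \<and>
                r = (\<Oplus>i\<in>{..<p}. x i)"


section \<open>The group data\<close>

text \<open>The group \<open>H\<^sub>0\<close> with its topology, \<open>\<ell>\<close> (\<open>ell\<close>), \<open>\<phi>\<close> (\<open>gfrob\<close>) and \<open>\<iota>\<close> (\<open>iota\<close>).\<close>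

record 'h phi_group = "'h monoid" +
  gtop :: "'h topology"
  ell :: "'h \<Rightarrow> (nat \<Rightarrow> int)"
  gfrob :: "'h \<Rightarrow> 'h"
  iota :: "(nat \<Rightarrow> int) \<Rightarrow> 'h"

locale phi_group = pro_p_group p H "gtop H"
  for p :: nat and H :: "('h, 'm) phi_group_scheme" (structure) +
  assumes rank: "finite_rank H (gtop H)"
    and no_order_p: "\<And>h. h \<in> carrier H \<Longrightarrow> group.ord H h \<noteq> p"
    and ell_hom: "ell H \<in> hom H (add_monoid (Zp p))"
    and ell_continuous: "continuous_map (gtop H) (Zp_topology p) (ell H)"
    and ell_surj: "ell H ` carrier H = carrier (Zp p)"
    and gfrob_hom: "gfrob H \<in> hom H H"
    and gfrob_inj: "inj_on (gfrob H) (carrier H)"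
    and gfrob_index: "finite (rcosets (gfrob H ` carrier H))"
    and ell_gfrob: "\<And>h. h \<in> carrier H \<Longrightarrow>
           ell H (gfrob H h) = Zp_of_int p (int p) \<otimes>\<^bsub>Zp p\<^esub> ell H h"
    and gfrob_Inter: "(\<Inter>n\<in>{1..}. (gfrob H ^^ n) ` carrier H) = {\<one>}"
    and gfrob_nhd: "\<And>n. n \<ge> 1 \<Longrightarrow>
           \<exists>U. openin (gtop H) U \<and> \<one> \<in> U \<and> U \<subseteq> (gfrob H ^^ n) ` carrier H"
    and gfrob_base: "\<And>U. openin (gtop H) U \<Longrightarrow> \<one> \<in> U \<Longrightarrow>
           \<exists>n\<ge>1. (gfrob H ^^ n) ` carrier H \<subseteq> U"
    and iota_hom: "iota H \<in> hom (add_monoid (Zp p)) H"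
    and iota_continuous: "continuous_map (Zp_topology p) (gtop H) (iota H)"
    and ell_iota: "\<And>x. x \<in> carrier (Zp p) \<Longrightarrow> ell H (iota H x) = x"
    and iota_frob: "\<And>x. x \<in> carrier (Zp p) \<Longrightarrow>
           iota H (Zp_of_int p (int p) \<otimes>\<^bsub>Zp p\<^esub> x) = gfrob H (iota H x)"

definition H1 :: "nat \<Rightarrow> ('h, 'm) phi_group_scheme \<Rightarrow> 'h set" where
  "H1 p H = kernel H (add_monoid (Zp p)) (ell H)"

text \<open>\<open>Hk p H k\<close> is \<open>H\<^sub>k\<close> for \<open>k \<ge> 1\<close>; the value at \<open>k = 0\<close> is meaningless (it is not \<open>H\<^sub>0\<close>) and is
  never used.\<close>

definition Hk :: "nat \<Rightarrow> ('h, 'm) phi_group_scheme \<Rightarrow> nat \<Rightarrow> 'h set" where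
  "Hk p H k = normal_closure H ((gfrob H ^^ (k - 1)) ` H1 p H)"

definition Qk :: "nat \<Rightarrow> ('h, 'm) phi_group_scheme \<Rightarrow> nat \<Rightarrow> 'h set monoid" where
  "Qk p H k = (H\<lparr>carrier := H1 p H\<rparr>) Mod (Hk p H k)"

definition iota_conj ::
    "('h, 'm) phi_group_scheme \<Rightarrow> (nat \<Rightarrow> int) \<Rightarrow> 'h set \<Rightarrow> 'h set" where
  "iota_conj H x C = (inv\<^bsub>H\<^esub> iota H x <#\<^bsub>H\<^esub> C) #>\<^bsub>H\<^esub> iota H x"

text \<open>The choice of the exponents \<open>c\<^sub>k \<ge> 1\<close> (\<open>k \<ge> 1\<close>) is an arbitrary function \<open>c\<close> subject to the
  following condition.\<close>

definition conj_exponents :: "nat \<Rightarrow> ('h, 'm) phi_group_scheme \<Rightarrow> (nat \<Rightarrow> nat) \<Rightarrow> bool" where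
  "conj_exponents p H c \<longleftrightarrow>
     (\<forall>k\<ge>1. c k \<ge> 1 \<and>
        (\<forall>x\<in>carrier (Zp p). \<forall>q\<in>carrier (Qk p H k).
           iota_conj H (Zp_of_int p (int p ^ c k) \<otimes>\<^bsub>Zp p\<^esub> x) q = q))"


section \<open>Skew group rings\<close>

text \<open>The coefficients \<open>r\<^sub>i\<close> in \<open>r = (\<Sum>i<p\<^sup>c. \<chi>(i) \<phi>\<^sup>c(r\<^sub>i))\<close>.\<close>

definition coords :: "nat \<Rightarrow> ('r, 'm) phi_ring_scheme \<Rightarrow> nat \<Rightarrow> 'r \<Rightarrow> nat \<Rightarrow> 'r" where
  "coords p R c r = (THE s. s \<in> {..<p ^ c} \<rightarrow>\<^sub>E carrier R \<and>
     r = (\<Oplus>\<^bsub>R\<^esub>i\<in>{..<p ^ c}. chi R (Zp_of_int p (int i)) \<otimes>\<^bsub>R\<^esub> (frob R ^^ c) (s i)))"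

definition coeff_supp :: "('r, 'm) ring_scheme \<Rightarrow> 'q set \<Rightarrow> ('q \<Rightarrow> 'r) \<Rightarrow> 'q set" where
  "coeff_supp R Q f = {q \<in> Q. f q \<noteq> \<zero>\<^bsub>R\<^esub>}"

text \<open>The additive map \<open>\<Oplus>\<^bsub>q\<in>Q\<^esub> R q \<rightarrow> \<Oplus>\<^bsub>q\<in>Q'\<^esub> R q\<close> with \<open>r q \<mapsto> \<sigma>(r) \<theta>(q)\<close>.\<close>

definition coeff_map ::
    "('r, 'm) ring_scheme \<Rightarrow> 'q set \<Rightarrow> 'q set \<Rightarrow> ('r \<Rightarrow> 'r) \<Rightarrow> ('q \<Rightarrow> 'q) \<Rightarrow>
     ('q \<Rightarrow> 'r) \<Rightarrow> ('q \<Rightarrow> 'r)" where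
  "coeff_map R Q Q' \<sigma> \<theta> f =
     (\<lambda>q'\<in>Q'. \<Oplus>\<^bsub>R\<^esub>q\<in>{q \<in> coeff_supp R Q f. \<theta> q = q'}. \<sigma> (f q))"

text \<open>\<open>R[H\<^sub>1/H\<^sub>k, \<ell>]\<close>, with \<open>c = c\<^sub>k\<close>. An element \<open>\<Sum>\<^sub>h r\<^sub>h h\<close> is the function \<open>h \<mapsto> r\<^sub>h\<close> on
  \<open>H\<^sub>1/H\<^sub>k\<close>; the product is the biadditive extension of
  \<open>(r\<^sub>1 h\<^sub>1)(r\<^sub>2 h\<^sub>2) = (\<Sum>i<p\<^sup>c. r\<^sub>1 \<chi>(i) \<phi>\<^sup>c(r\<^bsub>i,2\<^esub>) \<iota>(i)\<^sup>-\<^sup>1 h\<^sub>1 \<iota>(i) h\<^sub>2)\<close>.\<close>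

definition skew_group_ring ::
    "nat \<Rightarrow> ('r, 'm) phi_ring_scheme \<Rightarrow> ('h, 'n) phi_group_scheme \<Rightarrow> nat \<Rightarrow> nat \<Rightarrow>
     ('h set \<Rightarrow> 'r) frob_ring" where
  "skew_group_ring p R H k c =
     (let Q = Qk p H k in
      \<lparr>carrier = {f \<in> carrier Q \<rightarrow>\<^sub>E carrier R. finite (coeff_supp R (carrier Q) f)},
       mult = (\<lambda>f g. \<lambda>q\<in>carrier Q.
         finsum R
           (\<lambda>(h, h', i). f h \<otimes>\<^bsub>R\<^esub> chi R (Zp_of_int p (int i)) \<otimes>\<^bsub>R\<^esub>
                        (frob R ^^ c) (coords p R c (g h') i))
           {(h, h', i). h \<in> coeff_supp R (carrier Q) f \<and> h' \<in> coeff_supp R (carrier Q) g \<and> i < p ^ c \<and>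
                        iota_conj H (Zp_of_int p (int i)) h \<otimes>\<^bsub>Q\<^esub> h' = q}),
       one = (\<lambda>q\<in>carrier Q. if q = \<one>\<^bsub>Q\<^esub> then \<one>\<^bsub>R\<^esub> else \<zero>\<^bsub>R\<^esub>),
       zero = (\<lambda>q\<in>carrier Q. \<zero>\<^bsub>R\<^esub>),
       add = (\<lambda>f g. \<lambda>q\<in>carrier Q. f q \<oplus>\<^bsub>R\<^esub> g q),
       frob = coeff_map R (carrier Q) (carrier Q) (frob R)
                (\<lambda>q. Hk p H k <#>\<^bsub>H\<^esub> (gfrob H ` q))\<rparr>)"

text \<open>\<open>R[[H\<^sub>1, \<ell>]]\<close>, the limit over \<open>k \<ge> 1\<close> along the projections \<open>H\<^sub>1/H\<^bsub>k+1\<^esub> \<rightarrow> H\<^sub>1/H\<^sub>k\<close>.\<close>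

definition completed_skew_group_ring ::
    "nat \<Rightarrow> ('r, 'm) phi_ring_scheme \<Rightarrow> ('h, 'n) phi_group_scheme \<Rightarrow> (nat \<Rightarrow> nat) \<Rightarrow>
     (nat \<Rightarrow> 'h set \<Rightarrow> 'r) frob_ring" where
  "completed_skew_group_ring p R H c =
     (let S = (\<lambda>k. skew_group_ring p R H k (c k)) in
      \<lparr>carrier = {x \<in> \<Pi>\<^sub>E k\<in>{1..}. carrier (S k).
         \<forall>k\<ge>1. coeff_map R (carrier (Qk p H (Suc k))) (carrier (Qk p H k)) (\<lambda>r. r)
                  (\<lambda>q. Hk p H k <#>\<^bsub>H\<^esub> q) (x (Suc k)) = x k},
       mult = (\<lambda>x y. \<lambda>k\<in>{1..}. x k \<otimes>\<^bsub>S k\<^esub> y k),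
       one = (\<lambda>k\<in>{1..}. \<one>\<^bsub>S k\<^esub>),
       zero = (\<lambda>k\<in>{1..}. \<zero>\<^bsub>S k\<^esub>),
       add = (\<lambda>x y. \<lambda>k\<in>{1..}. x k \<oplus>\<^bsub>S k\<^esub> y k),
       frob = (\<lambda>x. \<lambda>k\<in>{1..}. frob (S k) (x k))\<rparr>)"

text \<open>As \<open>H\<^sub>1\<close> is itself the term of index 1 of the filtration, the map induced by \<open>H\<^sub>1 \<rightarrow> 1\<close>
  is the sum of the coefficients of the component of index 1.\<close>

definition ell_ring ::
    "nat \<Rightarrow> ('r, 'm) phi_ring_scheme \<Rightarrow> ('h, 'n) phi_group_scheme \<Rightarrow>
     (nat \<Rightarrow> 'h set \<Rightarrow> 'r) \<Rightarrow> 'r" where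
  "ell_ring p R H x = (\<Oplus>\<^bsub>R\<^esub>q\<in>coeff_supp R (carrier (Qk p H 1)) (x 1). x 1 q)"

definition iota_ring ::
    "nat \<Rightarrow> ('r, 'm) phi_ring_scheme \<Rightarrow> ('h, 'n) phi_group_scheme \<Rightarrow>
     'r \<Rightarrow> (nat \<Rightarrow> 'h set \<Rightarrow> 'r)" where
  "iota_ring p R H r =
     (\<lambda>k\<in>{1..}. \<lambda>q\<in>carrier (Qk p H k). if q = \<one>\<^bsub>Qk p H k\<^esub> then r else \<zero>\<^bsub>R\<^esub>)"


section \<open>Left modules and base change\<close>

text \<open>The locale \<open>module\<close> of the library requires a commutative base ring; its record type
  is reused here, the fields \<open>mult\<close> and \<open>one\<close> being irrelevant.\<close>

locale left_module = ring S + M: abelian_group M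
  for S :: "('s, 'a) ring_scheme" and M :: "('s, 'd, 'b) module_scheme" +
  assumes smult_closed:
      "\<lbrakk>s \<in> carrier S; d \<in> carrier M\<rbrakk> \<Longrightarrow> s \<odot>\<^bsub>M\<^esub> d \<in> carrier M"
    and smult_l_distr:
      "\<lbrakk>s \<in> carrier S; t \<in> carrier S; d \<in> carrier M\<rbrakk> \<Longrightarrow>
         (s \<oplus>\<^bsub>S\<^esub> t) \<odot>\<^bsub>M\<^esub> d = (s \<odot>\<^bsub>M\<^esub> d) \<oplus>\<^bsub>M\<^esub> (t \<odot>\<^bsub>M\<^esub> d)"
    and smult_r_distr:
      "\<lbrakk>s \<in> carrier S; d \<in> carrier M; e \<in> carrier M\<rbrakk> \<Longrightarrow>
         s \<odot>\<^bsub>M\<^esub> (d \<oplus>\<^bsub>M\<^esub> e) = (s \<odot>\<^bsub>M\<^esub> d) \<oplus>\<^bsub>M\<^esub> (s \<odot>\<^bsub>M\<^esub> e)"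
    and smult_assoc:
      "\<lbrakk>s \<in> carrier S; t \<in> carrier S; d \<in> carrier M\<rbrakk> \<Longrightarrow>
         (s \<otimes>\<^bsub>S\<^esub> t) \<odot>\<^bsub>M\<^esub> d = s \<odot>\<^bsub>M\<^esub> (t \<odot>\<^bsub>M\<^esub> d)"
    and smult_one: "d \<in> carrier M \<Longrightarrow> \<one>\<^bsub>S\<^esub> \<odot>\<^bsub>M\<^esub> d = d"

definition linear_maps ::
    "('s, 'a) ring_scheme \<Rightarrow> ('s, 'd, 'b) module_scheme \<Rightarrow> ('s, 'e, 'c) module_scheme \<Rightarrow>
     ('d \<Rightarrow> 'e) set" where
  "linear_maps S M N = {f \<in> carrier M \<rightarrow>\<^sub>E carrier N.
     (\<forall>d\<in>carrier M. \<forall>e\<in>carrier M. f (d \<oplus>\<^bsub>M\<^esub> e) = f d \<oplus>\<^bsub>N\<^esub> f e) \<and>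
     (\<forall>s\<in>carrier S. \<forall>d\<in>carrier M. f (s \<odot>\<^bsub>M\<^esub> d) = s \<odot>\<^bsub>N\<^esub> f d)}"

definition free_of_finite_rank ::
    "('s, 'a) ring_scheme \<Rightarrow> ('s, 'd, 'b) module_scheme \<Rightarrow> bool" where
  "free_of_finite_rank S M \<longleftrightarrow>
     (\<exists>B\<subseteq>carrier M. finite B \<and>
        (\<forall>d\<in>carrier M. \<exists>!a. a \<in> B \<rightarrow>\<^sub>E carrier S \<and> d = (\<Oplus>\<^bsub>M\<^esub>b\<in>B. a b \<odot>\<^bsub>M\<^esub> b)))"

text \<open>The base change \<open>B \<otimes>\<^bsub>A,f\<^esub> M\<close> along a map of rings \<open>f : A \<rightarrow> B\<close> is the free abelian
  group on \<open>B \<times> M\<close> modulo the usual relations, \<open>B\<close> being a right \<open>A\<close>-module via \<open>f\<close>.\<close>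

definition tensor_relations ::
    "('a, 'x) ring_scheme \<Rightarrow> ('b, 'y) ring_scheme \<Rightarrow> ('a \<Rightarrow> 'b) \<Rightarrow> ('a, 'd, 'z) module_scheme \<Rightarrow>
     ('b \<times> 'd \<Rightarrow>\<^sub>0 int) set" where
  "tensor_relations A B f M = generate (free_Abelian_group (carrier B \<times> carrier M))
     ({frag_of (b \<oplus>\<^bsub>B\<^esub> b', d) - frag_of (b, d) - frag_of (b', d) | b b' d.
         b \<in> carrier B \<and> b' \<in> carrier B \<and> d \<in> carrier M} \<union>
      {frag_of (b, d \<oplus>\<^bsub>M\<^esub> d') - frag_of (b, d) - frag_of (b, d') | b d d'.
         b \<in> carrier B \<and> d \<in> carrier M \<and> d' \<in> carrier M} \<union>
      {frag_of (b \<otimes>\<^bsub>B\<^esub> f a, d) - frag_of (b, a \<odot>\<^bsub>M\<^esub> d) | a b d.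
         a \<in> carrier A \<and> b \<in> carrier B \<and> d \<in> carrier M})"

text \<open>For a map \<open>\<theta>\<close> on symbols \<open>(b, d)\<close> that respects the relations,
  \<open>tensor_lift A B f M \<theta>\<close> is the map \<open>b \<otimes> d \<mapsto> \<theta>(b, d)\<close> into \<open>B \<otimes>\<^bsub>A,f\<^esub> M\<close>, on classes.\<close>

definition tensor_lift ::
    "('a, 'x) ring_scheme \<Rightarrow> ('b, 'y) ring_scheme \<Rightarrow> ('a \<Rightarrow> 'b) \<Rightarrow> ('a, 'd, 'z) module_scheme \<Rightarrow>
     ('c \<Rightarrow> 'b \<times> 'd) \<Rightarrow> ('c \<Rightarrow>\<^sub>0 int) set \<Rightarrow> ('b \<times> 'd \<Rightarrow>\<^sub>0 int) set" where
  "tensor_lift A B f M \<theta> X =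
     tensor_relations A B f M <#>\<^bsub>free_Abelian_group (carrier B \<times> carrier M)\<^esub>
       (frag_extend (\<lambda>z. frag_of (\<theta> z)) ` X)"

definition base_change ::
    "('a, 'x) ring_scheme \<Rightarrow> ('b, 'y) ring_scheme \<Rightarrow> ('a \<Rightarrow> 'b) \<Rightarrow> ('a, 'd, 'z) module_scheme \<Rightarrow>
     ('b, ('b \<times> 'd \<Rightarrow>\<^sub>0 int) set) module" where
  "base_change A B f M =
     (let T = free_Abelian_group (carrier B \<times> carrier M) Mod tensor_relations A B f M in
      \<lparr>carrier = carrier T, mult = undefined, one = undefined,
       zero = \<one>\<^bsub>T\<^esub>, add = monoid.mult T,
       smult = (\<lambda>b. tensor_lift A B f M (\<lambda>(b', d). (b \<otimes>\<^bsub>B\<^esub> b', d)))\<rparr>)"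

definition base_change_map ::
    "('a, 'x) ring_scheme \<Rightarrow> ('b, 'y) ring_scheme \<Rightarrow> ('a \<Rightarrow> 'b) \<Rightarrow>
     ('a, 'd, 'z) module_scheme \<Rightarrow> ('a, 'e, 'w) module_scheme \<Rightarrow> ('d \<Rightarrow> 'e) \<Rightarrow>
     ('b \<times> 'd \<Rightarrow>\<^sub>0 int) set \<Rightarrow> ('b \<times> 'e \<Rightarrow>\<^sub>0 int) set" where
  "base_change_map A B f M N g =
     (\<lambda>X\<in>carrier (base_change A B f M). tensor_lift A B f N (\<lambda>(b, d). (b, g d)) X)"


section \<open>\<open>\<phi>\<close>-modules\<close>

record ('s, 'd) frob_module = "('s, 'd) module" +
  mfrob :: "'d \<Rightarrow> 'd"

text \<open>The map \<open>S \<otimes>\<^bsub>S,\<phi>\<^esub> D \<rightarrow> D\<close>, \<open>s \<otimes> d \<mapsto> s \<phi>(d)\<close>. A class \<open>X\<close> goes to the common value of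
  \<open>\<Sum> n\<^bsub>(s,d)\<^esub> (s, d) \<mapsto> \<Sum> n\<^bsub>(s,d)\<^esub> s \<phi>(d)\<close> on the elements of \<open>X\<close>.\<close>

definition linearised_frob ::
    "('s, 'a) frob_ring_scheme \<Rightarrow> ('s, 'd, 'b) frob_module_scheme \<Rightarrow>
     ('s \<times> 'd \<Rightarrow>\<^sub>0 int) set \<Rightarrow> 'd" where
  "linearised_frob S D =
     (\<lambda>X\<in>carrier (base_change S S (frob S) D).
        the_elem ((\<lambda>u.
          finsum D (\<lambda>(s, d). [Poly_Mapping.lookup u (s, d)] \<cdot>\<^bsub>D\<^esub> (s \<odot>\<^bsub>D\<^esub> mfrob D d))
                   (Poly_Mapping.keys u)) ` X))"

locale phi_module = left_module S D
  for S :: "('s, 'a) frob_ring_scheme" and D :: "('s, 'd, 'b) frob_module_scheme" +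
  assumes free: "free_of_finite_rank S D"
    and mfrob_closed: "mfrob D \<in> carrier D \<rightarrow> carrier D"
    and mfrob_add: "\<lbrakk>d \<in> carrier D; e \<in> carrier D\<rbrakk> \<Longrightarrow>
           mfrob D (d \<oplus>\<^bsub>D\<^esub> e) = mfrob D d \<oplus>\<^bsub>D\<^esub> mfrob D e"
    and mfrob_semilinear: "\<lbrakk>s \<in> carrier S; d \<in> carrier D\<rbrakk> \<Longrightarrow>
           mfrob D (s \<odot>\<^bsub>D\<^esub> d) = frob S s \<odot>\<^bsub>D\<^esub> mfrob D d"
    and linearised_linear:
      "linearised_frob S D \<in> linear_maps S (base_change S S (frob S) D) D"
    and linearised_bij:
      "bij_betw (linearised_frob S D) (carrier (base_change S S (frob S) D)) (carrier D)"

text \<open>Morphisms of the category of \<open>\<phi>\<close>-modules over \<open>S\<close>: functions, made canonical outside the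
  carrier of the source. Source and target may live on different types.\<close>

definition phi_hom ::
    "('s, 'a) frob_ring_scheme \<Rightarrow> ('s, 'd, 'b) frob_module_scheme \<Rightarrow>
     ('s, 'e, 'c) frob_module_scheme \<Rightarrow> ('d \<Rightarrow> 'e) set" where
  "phi_hom S D E = {f \<in> linear_maps S D E. \<forall>d\<in>carrier D. f (mfrob D d) = mfrob E (f d)}"

definition phi_iso ::
    "('s, 'a) frob_ring_scheme \<Rightarrow> ('s, 'd, 'b) frob_module_scheme \<Rightarrow>
     ('s, 'e, 'c) frob_module_scheme \<Rightarrow> ('d \<Rightarrow> 'e) set" where
  "phi_iso S D E = {f \<in> phi_hom S D E. \<exists>g\<in>phi_hom S E D.
     compose (carrier D) g f = (\<lambda>d\<in>carrier D. d) \<and>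
     compose (carrier E) f g = (\<lambda>e\<in>carrier E. e)}"

text \<open>\<open>B \<otimes>\<^bsub>A,f\<^esub> D\<close> with \<open>\<phi>(b \<otimes> d) = \<phi>(b) \<otimes> \<phi>(d)\<close>.\<close>

definition phi_base_change ::
    "('a, 'x) frob_ring_scheme \<Rightarrow> ('b, 'y) frob_ring_scheme \<Rightarrow> ('a \<Rightarrow> 'b) \<Rightarrow>
     ('a, 'd) frob_module \<Rightarrow> ('b, ('b \<times> 'd \<Rightarrow>\<^sub>0 int) set) frob_module" where
  "phi_base_change A B f D =
     module.extend (base_change A B f D)
       (frob_module.fields
          (tensor_lift A B f D (\<lambda>(b, d). (frob B b, mfrob D d))))"


section \<open>Functors between categories of \<open>\<phi>\<close>-modules\<close>

text \<open>In a functor \<open>(Fo, Fm)\<close>, the map of a morphism \<open>f : D \<rightarrow> E\<close> is \<open>Fm D E f\<close>, as a function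
  does not determine its target. Objects of the source category are the \<open>\<phi>\<close>-modules on a type
  \<open>'d\<close>; as \<open>'d\<close> is arbitrary this covers all \<open>\<phi>\<close>-modules. A tensor product lives on a
  larger type, whence the two types \<open>'d\<close> and \<open>'e\<close>.\<close>

definition phi_functor ::
    "('s, 'a) frob_ring_scheme \<Rightarrow> ('t, 'b) frob_ring_scheme \<Rightarrow>
     (('s, 'd) frob_module \<Rightarrow> ('t, 'e) frob_module) \<Rightarrow>
     (('s, 'd) frob_module \<Rightarrow> ('s, 'd) frob_module \<Rightarrow> ('d \<Rightarrow> 'd) \<Rightarrow> ('e \<Rightarrow> 'e)) \<Rightarrow> bool" where
  "phi_functor S T Fo Fm \<longleftrightarrow>
     (\<forall>D. phi_module S D \<longrightarrow>
        phi_module T (Fo D) \<and>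
        Fm D D (\<lambda>d\<in>carrier D. d) = (\<lambda>e\<in>carrier (Fo D). e)) \<and>
     (\<forall>D E f. phi_module S D \<and> phi_module S E \<and> f \<in> phi_hom S D E \<longrightarrow>
        Fm D E f \<in> phi_hom T (Fo D) (Fo E)) \<and>
     (\<forall>C D E f g. phi_module S C \<and> phi_module S D \<and> phi_module S E \<and>
        f \<in> phi_hom S C D \<and> g \<in> phi_hom S D E \<longrightarrow>
        Fm C E (compose (carrier C) g f) = compose (carrier (Fo C)) (Fm D E g) (Fm C D f))"

text \<open>\<open>\<eta>\<close> is a natural isomorphism between functors \<open>F\<close> and \<open>G\<close> from \<open>\<phi>\<close>-modules over \<open>S\<close> to
  \<open>\<phi>\<close>-modules over \<open>T\<close>; the values of \<open>F\<close> and \<open>G\<close> may live on different types.\<close>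

definition phi_natural_iso ::
    "('s, 'a) frob_ring_scheme \<Rightarrow> ('t, 'b) frob_ring_scheme \<Rightarrow>
     (('s, 'd) frob_module \<Rightarrow> ('t, 'e) frob_module) \<Rightarrow>
     (('s, 'd) frob_module \<Rightarrow> ('s, 'd) frob_module \<Rightarrow> ('d \<Rightarrow> 'd) \<Rightarrow> ('e \<Rightarrow> 'e)) \<Rightarrow>
     (('s, 'd) frob_module \<Rightarrow> ('t, 'c) frob_module) \<Rightarrow>
     (('s, 'd) frob_module \<Rightarrow> ('s, 'd) frob_module \<Rightarrow> ('d \<Rightarrow> 'd) \<Rightarrow> ('c \<Rightarrow> 'c)) \<Rightarrow>
     (('s, 'd) frob_module \<Rightarrow> ('e \<Rightarrow> 'c)) \<Rightarrow> bool" where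
  "phi_natural_iso S T Fo Fm Go Gm \<eta> \<longleftrightarrow>
     (\<forall>D. phi_module S D \<longrightarrow> \<eta> D \<in> phi_iso T (Fo D) (Go D)) \<and>
     (\<forall>D E f. phi_module S D \<and> phi_module S E \<and> f \<in> phi_hom S D E \<longrightarrow>
        compose (carrier (Fo D)) (\<eta> E) (Fm D E f) = compose (carrier (Fo D)) (Gm D E f) (\<eta> D))"

definition DD ::
    "nat \<Rightarrow> ('r, 'm) phi_ring_scheme \<Rightarrow> ('h, 'n) phi_group_scheme \<Rightarrow> (nat \<Rightarrow> nat) \<Rightarrow>
     (nat \<Rightarrow> 'h set \<Rightarrow> 'r, 'd) frob_module \<Rightarrow>
     ('r, ('r \<times> 'd \<Rightarrow>\<^sub>0 int) set) frob_module" where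
  "DD p R H c = phi_base_change (completed_skew_group_ring p R H c) R (ell_ring p R H)"

definition DD_map ::
    "nat \<Rightarrow> ('r, 'm) phi_ring_scheme \<Rightarrow> ('h, 'n) phi_group_scheme \<Rightarrow> (nat \<Rightarrow> nat) \<Rightarrow>
     (nat \<Rightarrow> 'h set \<Rightarrow> 'r, 'd) frob_module \<Rightarrow> (nat \<Rightarrow> 'h set \<Rightarrow> 'r, 'd) frob_module \<Rightarrow>
     ('d \<Rightarrow> 'd) \<Rightarrow> ('r \<times> 'd \<Rightarrow>\<^sub>0 int) set \<Rightarrow> ('r \<times> 'd \<Rightarrow>\<^sub>0 int) set" where
  "DD_map p R H c = base_change_map (completed_skew_group_ring p R H c) R (ell_ring p R H)"

definition MM ::
    "nat \<Rightarrow> ('r, 'm) phi_ring_scheme \<Rightarrow> ('h, 'n) phi_group_scheme \<Rightarrow> (nat \<Rightarrow> nat) \<Rightarrow>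
     ('r, 'd) frob_module \<Rightarrow>
     (nat \<Rightarrow> 'h set \<Rightarrow> 'r, ((nat \<Rightarrow> 'h set \<Rightarrow> 'r) \<times> 'd \<Rightarrow>\<^sub>0 int) set) frob_module" where
  "MM p R H c = phi_base_change R (completed_skew_group_ring p R H c) (iota_ring p R H)"

definition MM_map ::
    "nat \<Rightarrow> ('r, 'm) phi_ring_scheme \<Rightarrow> ('h, 'n) phi_group_scheme \<Rightarrow> (nat \<Rightarrow> nat) \<Rightarrow>
     ('r, 'd) frob_module \<Rightarrow> ('r, 'd) frob_module \<Rightarrow> ('d \<Rightarrow> 'd) \<Rightarrow>
     ((nat \<Rightarrow> 'h set \<Rightarrow> 'r) \<times> 'd \<Rightarrow>\<^sub>0 int) set \<Rightarrow> ((nat \<Rightarrow> 'h set \<Rightarrow> 'r) \<times> 'd \<Rightarrow>\<^sub>0 int) set" where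
  "MM_map p R H c = base_change_map R (completed_skew_group_ring p R H c) (iota_ring p R H)"

end

theory Submission
  imports Defs
begin

text \<open>
  Let \<open>S = R[[H\<^sub>1, \<ell>]]\<close>, and let \<open>J\<^sub>n\<close> be the kernel of the projection \<open>S \<rightarrow> R[H\<^sub>1/H\<^bsub>n+1\<^esub>, \<ell>]\<close>, so that
  \<open>J\<^sub>0 = ker \<ell>\<^sub>R\<close>. The ring \<open>S\<close> is complete and separated for this filtration, and \<open>\<phi>(J\<^sub>n) \<subseteq> J\<^bsub>n+1\<^esub>\<close>,
  because \<open>\<phi>\<close> on \<open>R[H\<^sub>1/H\<^bsub>k+1\<^esub>, \<ell>]\<close> factors through \<open>R[H\<^sub>1/H\<^sub>k, \<ell>]\<close>. If \<open>(e\<^sub>j)\<close> is a basis of a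
  \<open>\<phi>\<close>-module \<open>D\<close>, then so is \<open>(\<phi>(e\<^sub>j))\<close>. Given a linear map \<open>h\<^sub>0 : D \<rightarrow> E\<close> commuting with \<open>\<phi>\<close> modulo
  \<open>J\<^sub>0 E\<close>, the linear maps with \<open>h\<^bsub>n+1\<^esub>(\<phi>(e\<^sub>j)) = \<phi>(h\<^sub>n(e\<^sub>j))\<close> satisfy \<open>h\<^bsub>n+1\<^esub> \<equiv> h\<^sub>n\<close> modulo \<open>J\<^sub>n E\<close>, and
  their limit is the unique morphism of \<open>\<phi>\<close>-modules congruent to \<open>h\<^sub>0\<close> modulo \<open>J\<^sub>0 E\<close>; it is an
  isomorphism when \<open>h\<^sub>0\<close> is bijective. This is applied to the map \<open>e\<^sub>j \<mapsto> 1 \<otimes> (1 \<otimes> e\<^sub>j)\<close> from \<open>D\<close> to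
  \<open>S \<otimes>\<^sub>R (R \<otimes>\<^sub>S D)\<close>; uniqueness gives naturality. The other composite is treated by
  \<open>r \<otimes> (s \<otimes> e) \<mapsto> r \<ell>\<^sub>R(s) e\<close>.

  The ring axioms for the skew group rings are checked on monomials \<open>r h\<close> with \<open>r \<in> \<chi>(i) \<phi>\<^sup>d(R)\<close>: for \<open>d \<ge> c\<close>
  the product formula becomes \<open>(r\<^sub>1 h\<^sub>1)(r\<^sub>2 h\<^sub>2) = r\<^sub>1 r\<^sub>2 (\<iota>(i)\<^sup>-\<^sup>1 h\<^sub>1 \<iota>(i) h\<^sub>2)\<close>, so that the choice of \<open>c\<close>
  is immaterial and rings with different exponents can be compared.
\<close>

section \<open>Additive maps and base change\<close>

text \<open>The two composites are not symmetric. With \<rho> = \<ell>_R and the inclusion \<iota>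
  one has \<rho> \<iota> = id, so that s \<otimes> e \<mapsto> \<rho>(s) e is well defined. But
  \<iota> \<rho> is in general not the identity, and d \<mapsto> 1 \<otimes> (1 \<otimes> d)
  commutes with \<phi> without being linear over S. Prescribing it on a basis gives a linear map
  that commutes with \<phi> only modulo J_0 and depends on the basis; the limit repairs the first
  defect, uniqueness the second. The filtration is raised by \<phi> because the preimage of H_{k+1}
  in H_0 is a normal subgroup containing \<phi>^{k-1}(H_1), hence H_k. An element of \<chi>(i)
  \<phi>^d(R) with d \<ge> c has degree i: moving it to the left past h turns h into \<iota>(i)^{-1}
  h \<iota>(i). Degrees add in products, and \<phi> multiplies them by p on coefficients and group
  elements alike, as \<phi>(\<chi>(i)) = \<chi>(p i) and \<phi>(\<iota>(i)) = \<iota>(p i); this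
  makes \<phi> multiplicative.\<close>

lemma abelian_group_hom_addI:
  assumes "abelian_group G" "abelian_group H"
    and "\<And>x. x \<in> carrier G \<Longrightarrow> h x \<in> carrier H"
    and "\<And>x y. x \<in> carrier G \<Longrightarrow> y \<in> carrier G \<Longrightarrow> h (x \<oplus>\<^bsub>G\<^esub> y) = h x \<oplus>\<^bsub>H\<^esub> h y"
  shows "abelian_group_hom G H h"
  using assms
  by (intro abelian_group_homI group_hom.intro group_hom_axioms.intro)
     (auto intro!: homI abelian_group.a_group)

lemma (in abelian_group_hom) hom_finsum_additive:
  "g \<in> A \<rightarrow> carrier G \<Longrightarrow> h (finsum G g A) = finsum H (\<lambda>i. h (g i)) A"
proof (induction A rule: infinite_finite_induct)
  case (insert a A)
  then have "(\<lambda>i. h (g i)) \<in> A \<rightarrow> carrier H" "h (g a) \<in> carrier H" by (auto simp: Pi_def)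
  with insert show ?case by simp
qed auto

lemma (in abelian_group) a_inv_zero: "\<ominus> \<zero> = \<zero>"
  by (rule minus_equality) auto

lemma ring_hom_additive:
  "ring A \<Longrightarrow> ring B \<Longrightarrow> h \<in> ring_hom A B \<Longrightarrow> abelian_group_hom A B h"
  by (rule abelian_group_hom_addI) (auto simp: ring_hom_def ring.is_abelian_group)

lemma abelian_group_hom_cong:
  assumes "abelian_group_hom G H h" "\<And>x. x \<in> carrier G \<Longrightarrow> g x = h x"
  shows "abelian_group_hom G H g"
proof -
  interpret h: abelian_group_hom G H h by fact
  show ?thesis
    by (rule abelian_group_hom_addI) (auto simp: assms(2) h.G.abelian_group_axioms h.H.abelian_group_axioms)
qed

lemma abelian_group_hom_id: "abelian_group G \<Longrightarrow> abelian_group_hom G G (\<lambda>x. x)"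
  by (rule abelian_group_hom_addI) auto

lemma abelian_group_hom_comp:
  assumes "abelian_group_hom G H h" "abelian_group_hom H K k"
  shows "abelian_group_hom G K (\<lambda>x. k (h x))"
proof -
  interpret h: abelian_group_hom G H h by fact
  interpret k: abelian_group_hom H K k by fact
  show ?thesis
    by (rule abelian_group_hom_addI) (auto simp: h.G.abelian_group_axioms k.H.abelian_group_axioms)
qed

text \<open>The homomorphism from the free abelian group that extends \<open>h\<close>, in the shape
  that occurs inside \<open>linearised_frob\<close>, so that the latter can be recognised as a
  \<open>tensor_hom\<close>.\<close>

definition tensor_eval ::
    "('n, 'k) ring_scheme \<Rightarrow> ('z \<Rightarrow> 'n) \<Rightarrow> ('z \<Rightarrow>\<^sub>0 int) \<Rightarrow> 'n" where
  "tensor_eval N h u = finsum N (\<lambda>z. [Poly_Mapping.lookup u z] \<cdot>\<^bsub>N\<^esub> h z) (Poly_Mapping.keys u)"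

text \<open>Formal sums with different supports are added over a common index set; the extra terms
  have coefficient zero.\<close>

lemma (in abelian_group) tensor_eval_superset:
  assumes h: "h \<in> Z \<rightarrow> carrier G" and "Poly_Mapping.keys u \<subseteq> Y" "Y \<subseteq> Z" "finite Y"
  shows "tensor_eval G h u = finsum G (\<lambda>z. [Poly_Mapping.lookup u z] \<cdot> h z) Y"
  unfolding tensor_eval_def
  using assms
  by (intro add.finprod_mono_neutral_cong_left)
     (auto simp: in_keys_iff add_pow_def Pi_def
       intro!: group.int_pow_closed[OF a_group, simplified])

lemma (in abelian_group) tensor_eval_hom:
  assumes h: "h \<in> Z \<rightarrow> carrier G"
  shows "group_hom (free_Abelian_group Z) (add_monoid G) (tensor_eval G h)"
proof -
  have cl: "[n] \<cdot> h z \<in> carrier G" if "z \<in> Z" for z and n :: int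
    using h that by (auto simp: add_pow_def intro!: group.int_pow_closed[OF a_group, simplified])
  have add: "tensor_eval G h (u + v) = tensor_eval G h u \<oplus> tensor_eval G h v"
    if u: "Poly_Mapping.keys u \<subseteq> Z" and v: "Poly_Mapping.keys v \<subseteq> Z" for u v
  proof -
    define Y where "Y = Poly_Mapping.keys u \<union> Poly_Mapping.keys v"
    have Y: "finite Y" "Y \<subseteq> Z" using u v by (auto simp: Y_def)
    have "tensor_eval G h (u + v) = finsum G (\<lambda>z. [Poly_Mapping.lookup (u + v) z] \<cdot> h z) Y"
      by (rule tensor_eval_superset[OF h]) (use Y keys_add[of u v] in \<open>auto simp: Y_def\<close>)
    also have "\<dots> = finsum G (\<lambda>z. [Poly_Mapping.lookup u z] \<cdot> h z \<oplus> [Poly_Mapping.lookup v z] \<cdot> h z) Y"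
      using Y h by (intro finsum_cong') (auto simp: lookup_add cl subset_iff Pi_def add_pow_def
          group.int_pow_mult[OF a_group, simplified] group.int_pow_closed[OF a_group, simplified])
    also have "\<dots> = finsum G (\<lambda>z. [Poly_Mapping.lookup u z] \<cdot> h z) Y \<oplus>
        finsum G (\<lambda>z. [Poly_Mapping.lookup v z] \<cdot> h z) Y"
      using Y by (intro finsum_addf) (auto simp: cl)
    also have "\<dots> = tensor_eval G h u \<oplus> tensor_eval G h v"
      using tensor_eval_superset[OF h, of u Y] tensor_eval_superset[OF h, of v Y] Y
      by (simp add: Y_def)
    finally show ?thesis .
  qed
  have "tensor_eval G h u \<in> carrier G" if "Poly_Mapping.keys u \<subseteq> Z" for u
    unfolding tensor_eval_def using that by (intro finsum_closed) (auto intro!: cl)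
  then show ?thesis
    using add by (intro group_hom.intro group_hom_axioms.intro homI a_group) auto
qed

lemma (in abelian_group) tensor_eval_frag_of:
  "h z \<in> carrier G \<Longrightarrow> tensor_eval G h (frag_of z) = h z"
  by (simp add: tensor_eval_def add.finprod_insert add_pow_def
      group.int_pow_1[OF a_group, simplified])

text \<open>The condition under which the additive extension of a map on symbols kills
  \<open>tensor_relations\<close>.\<close>

definition balanced ::
    "('a, 'x) ring_scheme \<Rightarrow> ('b, 'y) ring_scheme \<Rightarrow> ('a \<Rightarrow> 'b) \<Rightarrow> ('a, 'd, 'z) module_scheme \<Rightarrow>
     ('n, 'k) ring_scheme \<Rightarrow> ('b \<times> 'd \<Rightarrow> 'n) \<Rightarrow> bool" where
  "balanced A B f M N h \<longleftrightarrow>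
     (\<forall>b\<in>carrier B. \<forall>d\<in>carrier M. h (b, d) \<in> carrier N) \<and>
     (\<forall>b\<in>carrier B. \<forall>b'\<in>carrier B. \<forall>d\<in>carrier M. h (b \<oplus>\<^bsub>B\<^esub> b', d) = h (b, d) \<oplus>\<^bsub>N\<^esub> h (b', d)) \<and>
     (\<forall>b\<in>carrier B. \<forall>d\<in>carrier M. \<forall>d'\<in>carrier M. h (b, d \<oplus>\<^bsub>M\<^esub> d') = h (b, d) \<oplus>\<^bsub>N\<^esub> h (b, d')) \<and>
     (\<forall>a\<in>carrier A. \<forall>b\<in>carrier B. \<forall>d\<in>carrier M. h (b \<otimes>\<^bsub>B\<^esub> f a, d) = h (b, a \<odot>\<^bsub>M\<^esub> d))"

definition tens ::
    "('a, 'x) ring_scheme \<Rightarrow> ('b, 'y) ring_scheme \<Rightarrow> ('a \<Rightarrow> 'b) \<Rightarrow> ('a, 'd, 'z) module_scheme \<Rightarrow>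
     'b \<Rightarrow> 'd \<Rightarrow> ('b \<times> 'd \<Rightarrow>\<^sub>0 int) set" where
  "tens A B f M b d =
     tensor_relations A B f M #>\<^bsub>free_Abelian_group (carrier B \<times> carrier M)\<^esub> frag_of (b, d)"

text \<open>The map that \<open>h\<close> induces on classes. \<open>the_elem\<close> yields the
  common value of \<open>tensor_eval\<close> on a coset; \<open>tensor_eval_cls\<close> shows that
  there is one when \<open>h\<close> is balanced.\<close>

definition tensor_hom ::
    "('n, 'k) ring_scheme \<Rightarrow> ('z \<Rightarrow> 'n) \<Rightarrow> ('z \<Rightarrow>\<^sub>0 int) set \<Rightarrow> 'n" where
  "tensor_hom N h X = the_elem (tensor_eval N h ` X)"

section \<open>The universal property of the base change\<close>

locale tensor_setting = left_module A M + B: ring B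
  for A :: "('a, 'x) ring_scheme" and B :: "('b, 'y) ring_scheme" and f :: "'a \<Rightarrow> 'b"
    and M :: "('a, 'd, 'z) module_scheme" +
  assumes f_hom: "f \<in> ring_hom A B"
begin

lemma f_closed [simp]: "a \<in> carrier A \<Longrightarrow> f a \<in> carrier B"
  using f_hom by (auto simp: ring_hom_def)

abbreviation "F \<equiv> free_Abelian_group (carrier B \<times> carrier M)"
abbreviation "K \<equiv> tensor_relations A B f M"
abbreviation "T \<equiv> base_change A B f M"
abbreviation cls where "cls u \<equiv> K #>\<^bsub>F\<^esub> u"

definition Rels where
  "Rels = {frag_of (b \<oplus>\<^bsub>B\<^esub> b', d) - frag_of (b, d) - frag_of (b', d) | b b' d.
         b \<in> carrier B \<and> b' \<in> carrier B \<and> d \<in> carrier M} \<union>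
      {frag_of (b, d \<oplus>\<^bsub>M\<^esub> d') - frag_of (b, d) - frag_of (b, d') | b d d'.
         b \<in> carrier B \<and> d \<in> carrier M \<and> d' \<in> carrier M} \<union>
      {frag_of (b \<otimes>\<^bsub>B\<^esub> f a, d) - frag_of (b, a \<odot>\<^bsub>M\<^esub> d) | a b d.
         a \<in> carrier A \<and> b \<in> carrier B \<and> d \<in> carrier M}"

lemma relations_eq: "K = generate F Rels"
  by (simp add: tensor_relations_def Rels_def)

lemma Rels_subset: "Rels \<subseteq> carrier F"
proof -
  have *: "frag_of z - frag_of z' \<in> carrier F" if "z \<in> carrier B \<times> carrier M" "z' \<in> carrier B \<times> carrier M" for z z'
    using keys_diff[of "frag_of z" "frag_of z'"] that by auto
  have **: "frag_of z - frag_of z' - frag_of z'' \<in> carrier F"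
    if "z \<in> carrier B \<times> carrier M" "z' \<in> carrier B \<times> carrier M" "z'' \<in> carrier B \<times> carrier M" for z z' z''
    using keys_diff[of "frag_of z - frag_of z'" "frag_of z''"] that keys_diff[of "frag_of z" "frag_of z'"]
    by auto
  show ?thesis
    unfolding Rels_def by (auto intro!: * ** simp: smult_closed simp del: carrier_free_Abelian_group_iff)
qed

lemma K_subgroup: "subgroup K F"
  unfolding relations_eq using Rels_subset by (intro group.generate_is_subgroup) auto

lemma K_normal: "K \<lhd> F"
  by (rule comm_group.subgroup_imp_normal[OF abelian_free_Abelian_group K_subgroup])

lemma carrier_T: "carrier T = {cls u | u. u \<in> carrier F}"
  by (auto simp: base_change_def FactGroup_def RCOSETS_def Let_def)

lemma cls_in_T: "u \<in> carrier F \<Longrightarrow> cls u \<in> carrier T"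
  by (auto simp: carrier_T)

lemma add_cls: "u \<in> carrier F \<Longrightarrow> v \<in> carrier F \<Longrightarrow> cls u \<oplus>\<^bsub>T\<^esub> cls v = cls (u + v)"
  using normal.rcos_sum[OF K_normal] by (simp add: base_change_def FactGroup_def Let_def)

lemma zero_T: "\<zero>\<^bsub>T\<^esub> = cls 0"
  using group.coset_mult_one[OF group_free_Abelian_group, of K] subgroup.subset[OF K_subgroup]
  by (simp add: base_change_def FactGroup_def Let_def)

lemma add_monoid_T: "carrier (add_monoid T) = carrier (F Mod K)" "monoid.mult (add_monoid T) = monoid.mult (F Mod K)"
  "one (add_monoid T) = one (F Mod K)"
  by (simp_all add: base_change_def Let_def)

lemma T_abelian_group: "abelian_group T"
proof -
  have c: "comm_group (F Mod K)"
    by (rule comm_group.abelian_FactGroup[OF abelian_free_Abelian_group K_subgroup])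
  interpret Q: comm_group "F Mod K" by fact
  show ?thesis
  proof (rule abelian_groupI)
    fix x assume "x \<in> carrier T"
    then have "x \<in> carrier (F Mod K)" using add_monoid_T by simp
    then show "\<exists>y\<in>carrier T. y \<oplus>\<^bsub>T\<^esub> x = \<zero>\<^bsub>T\<^esub>"
      using Q.l_inv_ex[of x] add_monoid_T by simp
  qed (use add_monoid_T Q.m_closed Q.one_closed Q.m_assoc Q.m_comm Q.l_one in simp_all)
qed

sublocale T: abelian_group T by (rule T_abelian_group)

lemma cls_eq:
  assumes "u \<in> carrier F" "v \<in> carrier F" "u - v \<in> K"
  shows "cls u = cls v"
proof -
  have "u \<in> cls v"
    using assms by (auto simp: r_coset_def intro!: bexI[of _ "u - v"])
  then show ?thesis
    using group.repr_independence[OF group_free_Abelian_group _ _ K_subgroup] assms(2) by metis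
qed

lemma cls_minus: "u \<in> carrier F \<Longrightarrow> cls (- u) = \<ominus>\<^bsub>T\<^esub> cls u"
  by (rule T.minus_equality[symmetric]) (auto simp: add_cls zero_T cls_in_T[simplified])

abbreviation "tn \<equiv> tens A B f M"

lemma tens_closed [simp]: "b \<in> carrier B \<Longrightarrow> d \<in> carrier M \<Longrightarrow> tn b d \<in> carrier T"
  unfolding tens_def by (rule cls_in_T) auto

lemma tens_balanced: "balanced A B f M T (\<lambda>(b, d). tn b d)"
proof -
  have K: "x \<in> Rels \<Longrightarrow> x \<in> K" for x unfolding relations_eq by (rule generate.incl)
  have **: "cls (frag_of z) = cls (frag_of z') \<oplus>\<^bsub>T\<^esub> cls (frag_of z'')"
    if "z \<in> carrier B \<times> carrier M" "z' \<in> carrier B \<times> carrier M" "z'' \<in> carrier B \<times> carrier M"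
      and "frag_of z - frag_of z' - frag_of z'' \<in> Rels" for z z' z''
  proof -
    have "Poly_Mapping.keys (frag_of z' + frag_of z'') \<subseteq> carrier B \<times> carrier M"
      using keys_add[of "frag_of z'" "frag_of z''"] that by auto
    then have "cls (frag_of z) = cls (frag_of z' + frag_of z'')"
      using that by (intro cls_eq K) (auto simp: diff_diff_eq)
    then show ?thesis using that by (subst add_cls) auto
  qed
  show ?thesis
    unfolding balanced_def tens_def prod.case
  proof (intro conjI ballI)
    fix b b' d assume "b \<in> carrier B" "b' \<in> carrier B" "d \<in> carrier M"
    then show "cls (frag_of (b \<oplus>\<^bsub>B\<^esub> b', d)) = cls (frag_of (b, d)) \<oplus>\<^bsub>T\<^esub> cls (frag_of (b', d))"
      by (intro **) (auto simp: Rels_def)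
  next
    fix b d d' assume "b \<in> carrier B" "d \<in> carrier M" "d' \<in> carrier M"
    then show "cls (frag_of (b, d \<oplus>\<^bsub>M\<^esub> d')) = cls (frag_of (b, d)) \<oplus>\<^bsub>T\<^esub> cls (frag_of (b, d'))"
      by (intro **) (auto simp: Rels_def)
  next
    fix a b d assume "a \<in> carrier A" "b \<in> carrier B" "d \<in> carrier M"
    then show "cls (frag_of (b \<otimes>\<^bsub>B\<^esub> f a, d)) = cls (frag_of (b, a \<odot>\<^bsub>M\<^esub> d))"
      by (intro cls_eq K) (auto simp: Rels_def smult_closed)
  qed (auto intro!: cls_in_T)
qed

lemma
  assumes "b \<in> carrier B" "d \<in> carrier M"
  shows tens_add_l: "b' \<in> carrier B \<Longrightarrow> tn (b \<oplus>\<^bsub>B\<^esub> b') d = tn b d \<oplus>\<^bsub>T\<^esub> tn b' d"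
    and tens_add_r: "d' \<in> carrier M \<Longrightarrow> tn b (d \<oplus>\<^bsub>M\<^esub> d') = tn b d \<oplus>\<^bsub>T\<^esub> tn b d'"
    and tens_smult: "a \<in> carrier A \<Longrightarrow> tn b (a \<odot>\<^bsub>M\<^esub> d) = tn (b \<otimes>\<^bsub>B\<^esub> f a) d"
  using tens_balanced assms unfolding balanced_def by auto

lemma tens_hom_l: "d \<in> carrier M \<Longrightarrow> abelian_group_hom B T (\<lambda>b. tn b d)"
  by (rule abelian_group_hom_addI) (auto simp: tens_add_l B.abelian_group_axioms T_abelian_group)

lemma tens_hom_r: "b \<in> carrier B \<Longrightarrow> abelian_group_hom M T (tn b)"
  by (rule abelian_group_hom_addI) (auto simp: tens_add_r M.abelian_group_axioms T_abelian_group)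

lemma tensor_induct [consumes 1, case_names zero tens add]:
  assumes X: "X \<in> carrier T" and 0: "P \<zero>\<^bsub>T\<^esub>"
    and t: "\<And>b d. b \<in> carrier B \<Longrightarrow> d \<in> carrier M \<Longrightarrow> P (tn b d)"
    and a: "\<And>x y. x \<in> carrier T \<Longrightarrow> y \<in> carrier T \<Longrightarrow> P x \<Longrightarrow> P y \<Longrightarrow> P (x \<oplus>\<^bsub>T\<^esub> y)"
  shows "P X"
proof -
  obtain u where u: "u \<in> carrier F" "X = cls u" using X by (auto simp: carrier_T)
  then have "Poly_Mapping.keys u \<subseteq> carrier B \<times> carrier M" by simp
  \<comment> \<open>Formal sums are generated under differences, while \<open>P\<close> is only
    stable under sums; hence \<open>u\<close> and \<open>- u\<close> are treated together. A negated
    symbol is again a symbol, as -(b \<otimes> d) = (-b) \<otimes> d.\<close>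
  then have "P (cls u) \<and> P (cls (- u))"
  proof (induction u rule: free_Abelian_group_induct[consumes 1])
    case 1 then show ?case using 0 by (simp add: zero_T)
  next
    case (2 x y)
    then have c: "cls x \<in> carrier T" "cls (- x) \<in> carrier T" "cls y \<in> carrier T" "cls (- y) \<in> carrier T"
      by (auto intro!: cls_in_T)
    have e: "cls (x - y) = cls x \<oplus>\<^bsub>T\<^esub> cls (- y)" "cls (- (x - y)) = cls y \<oplus>\<^bsub>T\<^esub> cls (- x)"
      using 2 by (subst add_cls; simp)+
    show ?case unfolding e using 2 c a by blast
  next
    case (3 z)
    then obtain b d where z: "z = (b, d)" "b \<in> carrier B" "d \<in> carrier M" by auto
    have "cls (- frag_of z) = \<ominus>\<^bsub>T\<^esub> tn b d" using z by (subst cls_minus) (auto simp: tens_def)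
    also have "\<dots> = tn (\<ominus>\<^bsub>B\<^esub> b) d"
      using abelian_group_hom.hom_a_inv[OF tens_hom_l, of d b] z by simp
    finally have "cls (- frag_of z) = tn (\<ominus>\<^bsub>B\<^esub> b) d" .
    moreover have "cls (frag_of z) = tn b d" using z by (simp add: tens_def)
    ultimately show ?case using t z by simp
  qed
  then show ?thesis using u by simp
qed

text \<open>The device behind nearly every identity on a base change below: both sides are additive,
  so that pure tensors suffice.\<close>

lemma hom_eq_on_tensor:
  assumes "abelian_group_hom T N g" "abelian_group_hom T N h"
    and "\<And>b d. b \<in> carrier B \<Longrightarrow> d \<in> carrier M \<Longrightarrow> g (tn b d) = h (tn b d)"
    and "X \<in> carrier T"
  shows "g X = h X"
proof -
  interpret g: abelian_group_hom T N g by fact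
  interpret h: abelian_group_hom T N h by fact
  show ?thesis using assms(4) by (induction rule: tensor_induct) (auto simp: assms(3))
qed

text \<open>The kernel of the additive extension contains the generating relations, hence the
  subgroup they generate, so the extension is constant on cosets.\<close>

lemma tensor_eval_cls:
  assumes "abelian_group N" "balanced A B f M N h" "u \<in> carrier F"
  shows "tensor_eval N h ` cls u = {tensor_eval N h u}"
proof -
  interpret N: abelian_group N by fact
  have hc: "h \<in> carrier B \<times> carrier M \<rightarrow> carrier N" using assms(2) by (auto simp: balanced_def)
  interpret e: group_hom F "add_monoid N" "tensor_eval N h" by (rule N.tensor_eval_hom[OF hc])
  have fr: "tensor_eval N h (frag_of z) = h z" if "z \<in> carrier B \<times> carrier M" for z
    using hc that by (intro N.tensor_eval_frag_of) auto
  have df: "tensor_eval N h (u - v) = tensor_eval N h u \<ominus>\<^bsub>N\<^esub> tensor_eval N h v"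
    if "u \<in> carrier F" "v \<in> carrier F" for u v
  proof -
    have "tensor_eval N h (u \<otimes>\<^bsub>F\<^esub> inv\<^bsub>F\<^esub> v) = tensor_eval N h u \<oplus>\<^bsub>N\<^esub> inv\<^bsub>add_monoid N\<^esub> (tensor_eval N h v)"
      using e.hom_mult[OF that(1) group.inv_closed[OF group_free_Abelian_group that(2)]] e.hom_inv[OF that(2)]
      by simp
    then show ?thesis using that by (simp add: a_minus_def a_inv_def)
  qed
  have "Rels \<subseteq> kernel F (add_monoid N) (tensor_eval N h)"
  proof
    fix x assume x: "x \<in> Rels"
    then have xF: "x \<in> carrier F" using Rels_subset by blast
    have c: "frag_of z - frag_of z' \<in> carrier F" if "z \<in> carrier B \<times> carrier M" "z' \<in> carrier B \<times> carrier M" for z z'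
      using keys_diff[of "frag_of z" "frag_of z'"] that by auto
    have "tensor_eval N h x = \<zero>\<^bsub>N\<^esub>"
    proof -
      have 1: "tensor_eval N h (frag_of z - frag_of z' - frag_of z'') = \<zero>\<^bsub>N\<^esub>"
        if "z \<in> carrier B \<times> carrier M" "z' \<in> carrier B \<times> carrier M" "z'' \<in> carrier B \<times> carrier M"
          "h z = h z' \<oplus>\<^bsub>N\<^esub> h z''" for z z' z''
      proof -
        have "h z' \<in> carrier N" "h z'' \<in> carrier N" using that hc by auto
        then have "h z' \<oplus>\<^bsub>N\<^esub> h z'' \<ominus>\<^bsub>N\<^esub> h z' \<ominus>\<^bsub>N\<^esub> h z'' = \<zero>\<^bsub>N\<^esub>"
          by (simp add: a_minus_def N.a_ac N.r_neg1 N.r_neg2 N.r_neg)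
        then show ?thesis
          using that c by (simp add: df fr)
      qed
      have 2: "tensor_eval N h (frag_of z - frag_of z') = \<zero>\<^bsub>N\<^esub>"
        if "z \<in> carrier B \<times> carrier M" "z' \<in> carrier B \<times> carrier M" "h z = h z'" for z z'
      proof -
        have "h z' \<in> carrier N" using that hc by auto
        then show ?thesis using that by (simp add: df fr a_minus_def N.r_neg)
      qed
      show ?thesis
        using x assms(2) unfolding Rels_def balanced_def
        by (auto intro!: 1 2 simp: smult_closed)
    qed
    then show "x \<in> kernel F (add_monoid N) (tensor_eval N h)" using xF by (simp add: kernel_def)
  qed
  then have KK: "K \<subseteq> kernel F (add_monoid N) (tensor_eval N h)"
    unfolding relations_eq
    by (intro group.generate_subgroup_incl) (auto intro: e.subgroup_kernel)
  have "tensor_eval N h x = tensor_eval N h u" if x: "x \<in> cls u" for x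
  proof -
    obtain k where k: "k \<in> K" "x = k \<otimes>\<^bsub>F\<^esub> u" using x by (auto simp: r_coset_def)
    then have "k \<in> carrier F" "tensor_eval N h k = \<zero>\<^bsub>N\<^esub>" using KK by (auto simp: kernel_def)
    then have "tensor_eval N h x = \<zero>\<^bsub>N\<^esub> \<oplus>\<^bsub>N\<^esub> tensor_eval N h u"
      unfolding k(2) using assms(3) by (subst e.hom_mult) auto
    moreover have "tensor_eval N h u \<in> carrier N" using e.hom_closed[OF assms(3)] by simp
    ultimately show ?thesis by simp
  qed
  moreover have "u \<in> cls u" by (rule group.rcos_self[OF group_free_Abelian_group assms(3) K_subgroup])
  ultimately show ?thesis by blast
qed

lemma
  assumes "abelian_group N" "balanced A B f M N h"
  shows tensor_hom_hom: "abelian_group_hom T N (tensor_hom N h)"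
    and tensor_hom_tens: "b \<in> carrier B \<Longrightarrow> d \<in> carrier M \<Longrightarrow> tensor_hom N h (tn b d) = h (b, d)"
    and tensor_hom_cls: "u \<in> carrier F \<Longrightarrow> tensor_hom N h (cls u) = tensor_eval N h u"
proof -
  interpret N: abelian_group N by fact
  have hc: "h \<in> carrier B \<times> carrier M \<rightarrow> carrier N" using assms(2) by (auto simp: balanced_def)
  interpret e: group_hom F "add_monoid N" "tensor_eval N h" by (rule N.tensor_eval_hom[OF hc])
  show c: "tensor_hom N h (cls u) = tensor_eval N h u" if "u \<in> carrier F" for u
    using tensor_eval_cls[OF assms that] by (simp add: tensor_hom_def)
  show "tensor_hom N h (tn b d) = h (b, d)" if "b \<in> carrier B" "d \<in> carrier M"
    unfolding tens_def using that hc by (subst c) (auto intro!: N.tensor_eval_frag_of)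
  show "abelian_group_hom T N (tensor_hom N h)"
  proof (rule abelian_group_hom_addI)
    fix x y assume xy: "x \<in> carrier T" "y \<in> carrier T"
    then obtain u v where u: "u \<in> carrier F" "x = cls u" and v: "v \<in> carrier F" "y = cls v"
      by (auto simp: carrier_T)
    show "tensor_hom N h x \<in> carrier N" using c[OF u(1)] e.hom_closed[OF u(1)] u(2) by simp
    have "u \<otimes>\<^bsub>F\<^esub> v \<in> carrier F" using u v group.subgroup_self subgroup.m_closed group_free_Abelian_group by metis
    then show "tensor_hom N h (x \<oplus>\<^bsub>T\<^esub> y) = tensor_hom N h x \<oplus>\<^bsub>N\<^esub> tensor_hom N h y"
      using e.hom_mult[OF u(1) v(1)] u v c by (simp add: add_cls)
  qed (use assms T_abelian_group in auto)
qed

end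

section \<open>Maps between base changes that are given on symbols\<close>

lemma balanced_closed: "balanced A B f M N h \<Longrightarrow> h \<in> carrier B \<times> carrier M \<rightarrow> carrier N"
  by (auto simp: balanced_def)

text \<open>\<open>tensor_lift\<close> transports a whole class and multiplies by the relations, so
  its value is the union of the classes of the images of all representatives. Balancedness makes
  these classes coincide, which identifies \<open>tensor_lift\<close> with the map given by the
  universal property.\<close>

lemma tensor_lift_eq:
  assumes "tensor_setting A B f M" "tensor_setting A B f N"
    and \<theta>: "\<And>b d. b \<in> carrier B \<Longrightarrow> d \<in> carrier M \<Longrightarrow> \<theta> (b, d) \<in> carrier B \<times> carrier N"
    and bal: "balanced A B f M (base_change A B f N) h"
    and h: "\<And>z. h z = case_prod (tens A B f N) (\<theta> z)"
    and X: "X \<in> carrier (base_change A B f M)"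
  shows "tensor_lift A B f N \<theta> X = tensor_hom (base_change A B f N) h X"
proof -
  interpret M: tensor_setting A B f M by fact
  interpret N: tensor_setting A B f N by fact
  let ?e = "frag_extend (\<lambda>z. frag_of (\<theta> z))"
  interpret E: group_hom M.F "add_monoid N.T" "tensor_eval N.T h"
    by (rule N.T.tensor_eval_hom[OF balanced_closed[OF bal]])
  have fr: "tensor_eval N.T h (frag_of z) = h z" if "z \<in> carrier B \<times> carrier M" for z
    by (rule N.T.tensor_eval_frag_of) (rule funcset_mem[OF balanced_closed[OF bal] that])
  have k: "?e v \<in> carrier N.F" if "v \<in> carrier M.F" for v
  proof -
    have "Poly_Mapping.keys (?e v) \<subseteq> \<theta> ` Poly_Mapping.keys v"
      using keys_frag_extend[of "\<lambda>z. frag_of (\<theta> z)" v] by auto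
    moreover have v: "Poly_Mapping.keys v \<subseteq> carrier B \<times> carrier M" using that by simp
    have "\<theta> ` Poly_Mapping.keys v \<subseteq> carrier B \<times> carrier N"
    proof (rule image_subsetI)
      fix z assume "z \<in> Poly_Mapping.keys v"
      then have "z \<in> carrier B \<times> carrier M" by (rule subsetD[OF v])
      then obtain b d where "z = (b, d)" "b \<in> carrier B" "d \<in> carrier M" by (rule SigmaE)
      then show "\<theta> z \<in> carrier B \<times> carrier N" using \<theta>[of b d] by simp
    qed
    ultimately show ?thesis unfolding carrier_free_Abelian_group_iff by (rule subset_trans)
  qed
  have ev: "N.cls (?e v) = tensor_eval N.T h v" if "v \<in> carrier M.F" for v
  proof -
    have "Poly_Mapping.keys v \<subseteq> carrier B \<times> carrier M" using that by simp
    then show ?thesis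
    proof (induction v rule: free_Abelian_group_induct[consumes 1])
      case 1
      show ?case using E.hom_one by (simp add: N.zero_T)
    next
      case (2 x y)
      then have c: "x \<in> carrier M.F" "y \<in> carrier M.F" by auto
      have "N.cls (?e (x - y)) = N.cls (?e x + - ?e y)" by (simp add: frag_extend_diff)
      also have "\<dots> = N.cls (?e x) \<oplus>\<^bsub>N.T\<^esub> N.cls (- ?e y)"
        using k[OF c(1)] k[OF c(2)] by (subst N.add_cls) auto
      also have "N.cls (- ?e y) = \<ominus>\<^bsub>N.T\<^esub> N.cls (?e y)"
        using k[OF c(2)] by (rule N.cls_minus)
      also have "N.cls (?e x) \<oplus>\<^bsub>N.T\<^esub> \<ominus>\<^bsub>N.T\<^esub> N.cls (?e y) = tensor_eval N.T h (x \<otimes>\<^bsub>M.F\<^esub> inv\<^bsub>M.F\<^esub> y)"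
        using E.hom_mult[OF c(1) group.inv_closed[OF group_free_Abelian_group c(2)]] E.hom_inv[OF c(2)] 2
        by (simp add: a_inv_def)
      finally show ?case using c by simp
    next
      case (3 z)
      then show ?case using fr[of z] h[of z] by (cases "\<theta> z") (simp add: tens_def)
    qed
  qed
  obtain u where u: "u \<in> carrier M.F" "X = M.cls u" using X by (auto simp: M.carrier_T)
  have "N.cls (?e v) = tensor_eval N.T h u" if "v \<in> M.cls u" for v
  proof -
    have "v \<in> carrier M.F"
      using that u(1) subgroup.subset[OF M.K_subgroup] monoid.r_coset_subset_G[OF group.is_monoid[OF group_free_Abelian_group]] by blast
    then show ?thesis
      using ev M.tensor_eval_cls[OF N.T_abelian_group bal u(1)] that by auto
  qed
  moreover have "u \<in> M.cls u" by (rule group.rcos_self[OF group_free_Abelian_group u(1) M.K_subgroup])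
  ultimately have "(\<Union>v\<in>M.cls u. N.cls (?e v)) = tensor_eval N.T h u" by auto
  moreover have "tensor_lift A B f N \<theta> X = (\<Union>v\<in>M.cls u. N.cls (?e v))"
    unfolding tensor_lift_def u(2) by (auto simp: set_mult_def r_coset_def)
  ultimately show ?thesis
    using M.tensor_hom_cls[OF N.T_abelian_group bal u(1)] u(2) by simp
qed

text \<open>The form used for the three lifts that occur: scalar multiplication (\<tau> the
  identity), base change of a morphism (\<sigma> the identity), and \<phi> \<otimes> \<phi>. As
  \<sigma> and \<tau> are additive, only the relation that moves a scalar across the tensor sign is
  left to check.\<close>

lemma
  assumes M: "tensor_setting A B f M" and N: "tensor_setting A B f N"
    and s: "abelian_group_hom B B \<sigma>" and t: "abelian_group_hom M N \<tau>"
    and bal: "\<And>a b d. a \<in> carrier A \<Longrightarrow> b \<in> carrier B \<Longrightarrow> d \<in> carrier M \<Longrightarrow>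
      tens A B f N (\<sigma> (b \<otimes>\<^bsub>B\<^esub> f a)) (\<tau> d) = tens A B f N (\<sigma> b) (\<tau> (a \<odot>\<^bsub>M\<^esub> d))"
  shows tensor_lift_hom:
      "abelian_group_hom (base_change A B f M) (base_change A B f N)
         (tensor_lift A B f N (\<lambda>(b, d). (\<sigma> b, \<tau> d)))"
    and tensor_lift_tens:
      "\<And>b d. b \<in> carrier B \<Longrightarrow> d \<in> carrier M \<Longrightarrow>
         tensor_lift A B f N (\<lambda>(b, d). (\<sigma> b, \<tau> d)) (tens A B f M b d) = tens A B f N (\<sigma> b) (\<tau> d)"
proof -
  interpret M: tensor_setting A B f M by fact
  interpret N: tensor_setting A B f N by fact
  interpret s: abelian_group_hom B B \<sigma> by fact
  interpret t: abelian_group_hom M N \<tau> by fact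
  let ?\<theta> = "\<lambda>(b, d). (\<sigma> b, \<tau> d)"
  define h where "h = (\<lambda>(b, d). tens A B f N (\<sigma> b) (\<tau> d))"
  have b: "balanced A B f M N.T h"
    unfolding balanced_def h_def by (auto simp: N.tens_add_l N.tens_add_r bal)
  have e: "tensor_lift A B f N ?\<theta> X = tensor_hom N.T h X" if "X \<in> carrier M.T" for X
    by (rule tensor_lift_eq[OF M N _ b _ that]) (auto simp: h_def)
  show "abelian_group_hom M.T N.T (tensor_lift A B f N ?\<theta>)"
    by (rule abelian_group_hom_cong[OF M.tensor_hom_hom[OF N.T_abelian_group b] e])
  show "tensor_lift A B f N ?\<theta> (tens A B f M b d) = tens A B f N (\<sigma> b) (\<tau> d)"
    if "b \<in> carrier B" "d \<in> carrier M" for b d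
    using M.tensor_hom_tens[OF N.T_abelian_group b that] that by (subst e) (auto simp: h_def)
qed

lemma (in ring) l_mult_hom: "b \<in> carrier R \<Longrightarrow> abelian_group_hom R R (\<lambda>x. b \<otimes> x)"
  by (rule abelian_group_hom_addI) (auto simp: r_distr abelian_group_axioms)

section \<open>The module structure on the base change\<close>

context tensor_setting
begin

lemma setting: "tensor_setting A B f M" by (rule tensor_setting_axioms)

lemma smult_T: "b \<odot>\<^bsub>T\<^esub> X = tensor_lift A B f M (\<lambda>(b', d). (b \<otimes>\<^bsub>B\<^esub> b', d)) X"
  by (simp add: base_change_def Let_def)

lemma smult_T_aux:
  assumes "b \<in> carrier B"
  shows "abelian_group_hom T T (\<lambda>X. b \<odot>\<^bsub>T\<^esub> X)"
    and "b' \<in> carrier B \<Longrightarrow> d \<in> carrier M \<Longrightarrow> b \<odot>\<^bsub>T\<^esub> tn b' d = tn (b \<otimes>\<^bsub>B\<^esub> b') d"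
proof -
  \<comment> \<open>Left multiplication by \<open>b\<close> commutes with the right action of
    \<open>A\<close> on \<open>B\<close> by associativity, so no commutativity of \<open>B\<close>
    enters.\<close>
  have *: "tn (b \<otimes>\<^bsub>B\<^esub> (b' \<otimes>\<^bsub>B\<^esub> f a)) d = tn (b \<otimes>\<^bsub>B\<^esub> b') (a \<odot>\<^bsub>M\<^esub> d)"
    if "a \<in> carrier A" "b' \<in> carrier B" "d \<in> carrier M" for a b' d
    using that assms by (simp add: tens_smult B.m_assoc)
  note l = setting setting B.l_mult_hom[OF assms] abelian_group_hom_id[OF M.abelian_group_axioms]
  show "abelian_group_hom T T (\<lambda>X. b \<odot>\<^bsub>T\<^esub> X)"
    unfolding smult_T by (rule tensor_lift_hom[OF l]) (rule *)
  show "b \<odot>\<^bsub>T\<^esub> tn b' d = tn (b \<otimes>\<^bsub>B\<^esub> b') d" if "b' \<in> carrier B" "d \<in> carrier M"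
    unfolding smult_T by (rule tensor_lift_tens[OF l _ that]) (rule *)
qed

lemma smult_tens [simp]:
  "b \<in> carrier B \<Longrightarrow> b' \<in> carrier B \<Longrightarrow> d \<in> carrier M \<Longrightarrow> b \<odot>\<^bsub>T\<^esub> tn b' d = tn (b \<otimes>\<^bsub>B\<^esub> b') d"
  by (rule smult_T_aux)

lemma T_module: "left_module B T"
proof -
  have h: "abelian_group_hom T T (\<lambda>X. b \<odot>\<^bsub>T\<^esub> X)" if "b \<in> carrier B" for b
    using that by (rule smult_T_aux)
  have cl: "b \<odot>\<^bsub>T\<^esub> X \<in> carrier T" if "b \<in> carrier B" "X \<in> carrier T" for b X
    using abelian_group_hom.hom_closed[OF h] that by auto
  show ?thesis
  proof (intro left_module.intro left_module_axioms.intro B.ring_axioms T_abelian_group)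
    fix s d e assume "s \<in> carrier B" "d \<in> carrier T" "e \<in> carrier T"
    then show "s \<odot>\<^bsub>T\<^esub> (d \<oplus>\<^bsub>T\<^esub> e) = s \<odot>\<^bsub>T\<^esub> d \<oplus>\<^bsub>T\<^esub> s \<odot>\<^bsub>T\<^esub> e"
      using abelian_group_hom.hom_add[OF h] by auto
  next
    fix s t d assume st: "s \<in> carrier B" "t \<in> carrier B" and d: "d \<in> carrier T"
    have st_hom: "abelian_group_hom T T (\<lambda>X. s \<odot>\<^bsub>T\<^esub> X \<oplus>\<^bsub>T\<^esub> t \<odot>\<^bsub>T\<^esub> X)"
      using st abelian_group_hom.hom_add[OF h]
      by (intro abelian_group_hom_addI T_abelian_group) (auto simp: cl T.a_ac)
    show "(s \<oplus>\<^bsub>B\<^esub> t) \<odot>\<^bsub>T\<^esub> d = s \<odot>\<^bsub>T\<^esub> d \<oplus>\<^bsub>T\<^esub> t \<odot>\<^bsub>T\<^esub> d"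
      by (rule hom_eq_on_tensor[OF h st_hom _ d]) (use st in \<open>auto simp: B.l_distr tens_add_l\<close>)
    show "(s \<otimes>\<^bsub>B\<^esub> t) \<odot>\<^bsub>T\<^esub> d = s \<odot>\<^bsub>T\<^esub> (t \<odot>\<^bsub>T\<^esub> d)"
      by (rule hom_eq_on_tensor[OF h abelian_group_hom_comp[OF h h] _ d])
        (use st in \<open>auto simp: B.m_assoc\<close>)
  next
    fix d assume d: "d \<in> carrier T"
    show "\<one>\<^bsub>B\<^esub> \<odot>\<^bsub>T\<^esub> d = d"
      by (rule hom_eq_on_tensor[OF h abelian_group_hom_id[OF T_abelian_group] _ d]) auto
  qed (rule cl)
qed

sublocale T: left_module B T by (rule T_module)

end

section \<open>Bases and linear maps\<close>

definition lincomb :: "('s, 'd, 'b) module_scheme \<Rightarrow> 'i set \<Rightarrow> ('i \<Rightarrow> 's) \<Rightarrow> ('i \<Rightarrow> 'd) \<Rightarrow> 'd" where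
  "lincomb M I a e = finsum M (\<lambda>i. a i \<odot>\<^bsub>M\<^esub> e i) I"

text \<open>Bases as families, unlike in \<open>free_of_finite_rank\<close>: the families 1
  \<otimes> e_i and \<phi>(e_i) keep the index set of e, and they need not be shown to be
  injective.\<close>

definition indexed_basis ::
    "('s, 'a) ring_scheme \<Rightarrow> ('s, 'd, 'b) module_scheme \<Rightarrow> 'i set \<Rightarrow> ('i \<Rightarrow> 'd) \<Rightarrow> bool" where
  "indexed_basis S M I e \<longleftrightarrow> finite I \<and> e \<in> I \<rightarrow> carrier M \<and>
     (\<forall>d\<in>carrier M. \<exists>!a. a \<in> I \<rightarrow>\<^sub>E carrier S \<and> d = lincomb M I a e)"

context left_module
begin

lemma smult_hom_r: "s \<in> carrier S \<Longrightarrow> abelian_group_hom M M (\<lambda>d. s \<odot>\<^bsub>M\<^esub> d)"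
  by (rule abelian_group_hom_addI) (auto simp: smult_r_distr smult_closed M.abelian_group_axioms)

lemma smult_hom_l: "d \<in> carrier M \<Longrightarrow> abelian_group_hom S M (\<lambda>s. s \<odot>\<^bsub>M\<^esub> d)"
  by (rule abelian_group_hom_addI) (auto simp: smult_l_distr smult_closed M.abelian_group_axioms abelian_group_axioms)

lemma smult_zero_l: "d \<in> carrier M \<Longrightarrow> \<zero>\<^bsub>S\<^esub> \<odot>\<^bsub>M\<^esub> d = \<zero>\<^bsub>M\<^esub>"
  by (rule abelian_group_hom.hom_zero[OF smult_hom_l])

lemma smult_minus_l: "s \<in> carrier S \<Longrightarrow> d \<in> carrier M \<Longrightarrow> (\<ominus>\<^bsub>S\<^esub> s) \<odot>\<^bsub>M\<^esub> d = \<ominus>\<^bsub>M\<^esub> (s \<odot>\<^bsub>M\<^esub> d)"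
  by (rule abelian_group_hom.hom_a_inv[OF smult_hom_l])

lemma lincomb_closed: "a \<in> I \<rightarrow> carrier S \<Longrightarrow> e \<in> I \<rightarrow> carrier M \<Longrightarrow> lincomb M I a e \<in> carrier M"
  unfolding lincomb_def by (intro M.finsum_closed) (auto simp: smult_closed Pi_iff)

lemma lincomb_cong:
  assumes "a \<in> I \<rightarrow> carrier S" "e \<in> I \<rightarrow> carrier M"
    and "\<And>i. i \<in> I \<Longrightarrow> a i = a' i" "\<And>i. i \<in> I \<Longrightarrow> e i = e' i"
  shows "lincomb M I a e = lincomb M I a' e'"
proof -
  have "(\<lambda>i. a' i \<odot>\<^bsub>M\<^esub> e' i) \<in> I \<rightarrow> carrier M"
    using assms by (auto simp: Pi_iff intro!: smult_closed)
  then show ?thesis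
    unfolding lincomb_def using assms by (intro M.finsum_cong') auto
qed

lemma lincomb_add:
  assumes "a \<in> I \<rightarrow> carrier S" "b \<in> I \<rightarrow> carrier S" "e \<in> I \<rightarrow> carrier M"
  shows "lincomb M I (\<lambda>i. a i \<oplus>\<^bsub>S\<^esub> b i) e = lincomb M I a e \<oplus>\<^bsub>M\<^esub> lincomb M I b e"
proof -
  have "lincomb M I (\<lambda>i. a i \<oplus>\<^bsub>S\<^esub> b i) e = finsum M (\<lambda>i. a i \<odot>\<^bsub>M\<^esub> e i \<oplus>\<^bsub>M\<^esub> b i \<odot>\<^bsub>M\<^esub> e i) I"
    unfolding lincomb_def using assms
    by (intro M.finsum_cong') (auto simp: Pi_iff smult_l_distr smult_closed)
  also have "\<dots> = lincomb M I a e \<oplus>\<^bsub>M\<^esub> lincomb M I b e"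
    unfolding lincomb_def using assms by (intro M.finsum_addf) (auto simp: Pi_iff smult_closed)
  finally show ?thesis .
qed

lemma lincomb_smult:
  assumes "a \<in> I \<rightarrow> carrier S" "s \<in> carrier S" "e \<in> I \<rightarrow> carrier M"
  shows "s \<odot>\<^bsub>M\<^esub> lincomb M I a e = lincomb M I (\<lambda>i. s \<otimes>\<^bsub>S\<^esub> a i) e"
proof -
  have "s \<odot>\<^bsub>M\<^esub> lincomb M I a e = finsum M (\<lambda>i. s \<odot>\<^bsub>M\<^esub> (a i \<odot>\<^bsub>M\<^esub> e i)) I"
    unfolding lincomb_def using assms
    by (intro abelian_group_hom.hom_finsum_additive[OF smult_hom_r]) (auto simp: Pi_iff smult_closed)
  also have "\<dots> = lincomb M I (\<lambda>i. s \<otimes>\<^bsub>S\<^esub> a i) e"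
    unfolding lincomb_def using assms
    by (intro M.finsum_cong') (auto simp: Pi_iff smult_assoc smult_closed)
  finally show ?thesis .
qed

lemma lincomb_unit:
  assumes "finite I" "j \<in> I" "e \<in> I \<rightarrow> carrier M" "s \<in> carrier S"
  shows "lincomb M I (\<lambda>i. if i = j then s else \<zero>\<^bsub>S\<^esub>) e = s \<odot>\<^bsub>M\<^esub> e j"
proof -
  have "lincomb M I (\<lambda>i. if i = j then s else \<zero>\<^bsub>S\<^esub>) e =
      finsum M (\<lambda>i. if j = i then s \<odot>\<^bsub>M\<^esub> e i else \<zero>\<^bsub>M\<^esub>) I"
    unfolding lincomb_def using assms
    by (intro M.finsum_cong') (auto simp: Pi_iff smult_zero_l smult_closed)
  also have "\<dots> = s \<odot>\<^bsub>M\<^esub> e j"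
    using assms by (intro M.finsum_singleton) (auto simp: Pi_iff smult_closed)
  finally show ?thesis .
qed

text \<open>Uniqueness of coordinates is reduced to linear independence by subtracting two
  expansions of the same vector, the second one being scaled by -1.\<close>

lemma indexed_basisI:
  assumes "finite I" and e: "e \<in> I \<rightarrow> carrier M"
    and span: "\<And>d. d \<in> carrier M \<Longrightarrow> \<exists>a\<in>I \<rightarrow> carrier S. d = lincomb M I a e"
    and indep: "\<And>a i. a \<in> I \<rightarrow> carrier S \<Longrightarrow> lincomb M I a e = \<zero>\<^bsub>M\<^esub> \<Longrightarrow> i \<in> I \<Longrightarrow> a i = \<zero>\<^bsub>S\<^esub>"
  shows "indexed_basis S M I e"
  unfolding indexed_basis_def
proof (intro conjI ballI assms)
  fix d assume "d \<in> carrier M"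
  then obtain a where a: "a \<in> I \<rightarrow> carrier S" "d = lincomb M I a e" using span by blast
  show "\<exists>!a. a \<in> I \<rightarrow>\<^sub>E carrier S \<and> d = lincomb M I a e"
  proof (intro ex1I conjI)
    show "restrict a I \<in> I \<rightarrow>\<^sub>E carrier S" using a by auto
    show "d = lincomb M I (restrict a I) e" unfolding a(2) using a e by (intro lincomb_cong) auto
  next
    fix b assume b: "b \<in> I \<rightarrow>\<^sub>E carrier S \<and> d = lincomb M I b e"
    then have bI: "b \<in> I \<rightarrow> carrier S" by auto
    have "lincomb M I (\<lambda>i. \<ominus>\<^bsub>S\<^esub> \<one>\<^bsub>S\<^esub> \<otimes>\<^bsub>S\<^esub> b i) e = (\<ominus>\<^bsub>S\<^esub> \<one>\<^bsub>S\<^esub>) \<odot>\<^bsub>M\<^esub> lincomb M I b e"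
      using lincomb_smult[OF bI _ e] by simp
    also have "\<dots> = \<ominus>\<^bsub>M\<^esub> d"
      using b lincomb_closed[OF bI e] by (simp add: smult_minus_l smult_one)
    finally have m: "lincomb M I (\<lambda>i. \<ominus>\<^bsub>S\<^esub> \<one>\<^bsub>S\<^esub> \<otimes>\<^bsub>S\<^esub> b i) e = \<ominus>\<^bsub>M\<^esub> d" .
    have "lincomb M I (\<lambda>i. a i \<oplus>\<^bsub>S\<^esub> \<ominus>\<^bsub>S\<^esub> \<one>\<^bsub>S\<^esub> \<otimes>\<^bsub>S\<^esub> b i) e = d \<oplus>\<^bsub>M\<^esub> \<ominus>\<^bsub>M\<^esub> d"
      using lincomb_add[OF a(1) _ e, of "\<lambda>i. \<ominus>\<^bsub>S\<^esub> \<one>\<^bsub>S\<^esub> \<otimes>\<^bsub>S\<^esub> b i"] m a(2) bI by (auto simp: Pi_iff)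
    then have z: "lincomb M I (\<lambda>i. a i \<oplus>\<^bsub>S\<^esub> \<ominus>\<^bsub>S\<^esub> \<one>\<^bsub>S\<^esub> \<otimes>\<^bsub>S\<^esub> b i) e = \<zero>\<^bsub>M\<^esub>"
      using \<open>d \<in> carrier M\<close> by (simp add: M.r_neg)
    have "a i = b i" if "i \<in> I" for i
    proof -
      have c: "a i \<in> carrier S" "b i \<in> carrier S" using that a bI by auto
      have "a i \<oplus>\<^bsub>S\<^esub> \<ominus>\<^bsub>S\<^esub> \<one>\<^bsub>S\<^esub> \<otimes>\<^bsub>S\<^esub> b i = \<zero>\<^bsub>S\<^esub>"
        using indep[OF _ z that] a(1) bI by (auto simp: Pi_iff)
      then have "a i \<oplus>\<^bsub>S\<^esub> \<ominus>\<^bsub>S\<^esub> b i = \<zero>\<^bsub>S\<^esub>" using c by (simp add: l_minus)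
      then show ?thesis using c by (metis a_inv_closed minus_equality minus_minus)
    qed
    then show "b = restrict a I" using b by (auto simp: PiE_def extensional_def fun_eq_iff)
  qed
qed

end

section \<open>Coordinates, and linear maps out of a free module\<close>

definition coord where
  "coord S M I e d = (THE a. a \<in> I \<rightarrow>\<^sub>E carrier S \<and> d = lincomb M I a e)"

locale based_module = left_module S M
  for S :: "('s, 'a) ring_scheme" and M :: "('s, 'd, 'b) module_scheme" +
  fixes I :: "'i set" and e :: "'i \<Rightarrow> 'd"
  assumes basis: "indexed_basis S M I e"
begin

lemma finite_I: "finite I" and e_Pi: "e \<in> I \<rightarrow> carrier M"
  using basis by (auto simp: indexed_basis_def)

lemma e_closed [simp]: "i \<in> I \<Longrightarrow> e i \<in> carrier M"
  using e_Pi by auto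

abbreviation "co \<equiv> coord S M I e"

lemma coord_props:
  assumes "d \<in> carrier M"
  shows "co d \<in> I \<rightarrow>\<^sub>E carrier S \<and> d = lincomb M I (co d) e"
proof -
  have "\<exists>!a. a \<in> I \<rightarrow>\<^sub>E carrier S \<and> d = lincomb M I a e"
    using basis assms by (auto simp: indexed_basis_def)
  from theI'[OF this] show ?thesis unfolding coord_def .
qed

lemma coord_Pi: "d \<in> carrier M \<Longrightarrow> co d \<in> I \<rightarrow> carrier S"
  using coord_props by auto

lemma coord_closed [simp]: "d \<in> carrier M \<Longrightarrow> i \<in> I \<Longrightarrow> co d i \<in> carrier S"
  using coord_props by auto

lemma lincomb_coord: "d \<in> carrier M \<Longrightarrow> lincomb M I (co d) e = d"
  using coord_props by auto

lemma coord_lincomb: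
  assumes "a \<in> I \<rightarrow> carrier S" "i \<in> I"
  shows "co (lincomb M I a e) i = a i"
proof -
  let ?d = "lincomb M I a e"
  have d: "?d \<in> carrier M" by (rule lincomb_closed[OF assms(1) e_Pi])
  have "?d = lincomb M I (restrict a I) e" using assms e_Pi by (intro lincomb_cong) auto
  moreover have "restrict a I \<in> I \<rightarrow>\<^sub>E carrier S" using assms by auto
  ultimately have "co ?d = restrict a I"
    using basis d coord_props[OF d] unfolding indexed_basis_def by blast
  then show ?thesis using assms by simp
qed

lemma coord_eqI:
  "a \<in> I \<rightarrow> carrier S \<Longrightarrow> d = lincomb M I a e \<Longrightarrow> i \<in> I \<Longrightarrow> co d i = a i"
  using coord_lincomb by simp

lemma coord_add: "x \<in> carrier M \<Longrightarrow> y \<in> carrier M \<Longrightarrow> i \<in> I \<Longrightarrow> co (x \<oplus>\<^bsub>M\<^esub> y) i = co x i \<oplus>\<^bsub>S\<^esub> co y i"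
  by (rule coord_eqI) (auto simp: lincomb_add[OF coord_Pi coord_Pi e_Pi] lincomb_coord)

lemma coord_smult: "s \<in> carrier S \<Longrightarrow> x \<in> carrier M \<Longrightarrow> i \<in> I \<Longrightarrow> co (s \<odot>\<^bsub>M\<^esub> x) i = s \<otimes>\<^bsub>S\<^esub> co x i"
  by (rule coord_eqI) (auto simp: lincomb_smult[OF coord_Pi _ e_Pi, symmetric] lincomb_coord)

lemma coord_basis: "i \<in> I \<Longrightarrow> j \<in> I \<Longrightarrow> co (e j) i = (if i = j then \<one>\<^bsub>S\<^esub> else \<zero>\<^bsub>S\<^esub>)"
  by (rule coord_eqI) (auto simp: lincomb_unit[OF finite_I _ e_Pi] smult_one)

lemma coord_hom: "i \<in> I \<Longrightarrow> abelian_group_hom M S (\<lambda>d. co d i)"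
  by (rule abelian_group_hom_addI) (auto simp: coord_add M.abelian_group_axioms abelian_group_axioms)

lemma eqI_coord:
  assumes "x \<in> carrier M" "y \<in> carrier M" "\<And>i. i \<in> I \<Longrightarrow> co x i = co y i"
  shows "x = y"
proof -
  have "lincomb M I (co x) e = lincomb M I (co y) e"
    using assms coord_Pi e_Pi by (intro lincomb_cong) auto
  then show ?thesis using assms by (simp add: lincomb_coord)
qed

end

locale linear_map = M: left_module S M + N: left_module S N
  for S :: "('s, 'a) ring_scheme" and M :: "('s, 'd, 'b) module_scheme"
    and N :: "('s, 'e, 'c) module_scheme" +
  fixes g assumes linear: "g \<in> linear_maps S M N"
begin

lemma hom: "abelian_group_hom M N g"
  using linear
  by (intro abelian_group_hom_addI) (auto simp: linear_maps_def M.M.abelian_group_axioms N.M.abelian_group_axioms)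

sublocale abelian_group_hom M N g by (rule hom)

lemma hom_smult: "s \<in> carrier S \<Longrightarrow> d \<in> carrier M \<Longrightarrow> g (s \<odot>\<^bsub>M\<^esub> d) = s \<odot>\<^bsub>N\<^esub> g d"
  using linear by (auto simp: linear_maps_def)

lemma hom_lincomb:
  assumes "a \<in> I \<rightarrow> carrier S" "e \<in> I \<rightarrow> carrier M"
  shows "g (lincomb M I a e) = lincomb N I a (\<lambda>i. g (e i))"
proof -
  have "g (lincomb M I a e) = finsum N (\<lambda>i. g (a i \<odot>\<^bsub>M\<^esub> e i)) I"
    unfolding lincomb_def using assms
    by (intro hom_finsum_additive) (auto simp: Pi_iff M.smult_closed)
  also have "\<dots> = lincomb N I a (\<lambda>i. g (e i))"
    unfolding lincomb_def using assms
    by (intro N.M.finsum_cong') (auto simp: Pi_iff hom_smult N.smult_closed)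
  finally show ?thesis .
qed

end

lemma linear_mapsI:
  assumes "g \<in> carrier M \<rightarrow>\<^sub>E carrier N"
    and "\<And>d e. d \<in> carrier M \<Longrightarrow> e \<in> carrier M \<Longrightarrow> g (d \<oplus>\<^bsub>M\<^esub> e) = g d \<oplus>\<^bsub>N\<^esub> g e"
    and "\<And>s d. s \<in> carrier S \<Longrightarrow> d \<in> carrier M \<Longrightarrow> g (s \<odot>\<^bsub>M\<^esub> d) = s \<odot>\<^bsub>N\<^esub> g d"
  shows "g \<in> linear_maps S M N"
  using assms by (auto simp: linear_maps_def)

context based_module
begin

lemma linear_eq_on_basis:
  assumes "left_module S N" "g \<in> linear_maps S M N" "h \<in> linear_maps S M N"
    and "\<And>i. i \<in> I \<Longrightarrow> g (e i) = h (e i)"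
  shows "g = h"
proof
  interpret N: left_module S N by fact
  interpret g: linear_map S M N g by unfold_locales (rule assms)
  interpret h: linear_map S M N h by unfold_locales (rule assms)
  fix x
  show "g x = h x"
  proof (cases "x \<in> carrier M")
    case True
    have "g x = lincomb N I (co x) (\<lambda>i. g (e i))"
      using g.hom_lincomb[OF coord_Pi[OF True] e_Pi] lincomb_coord[OF True] by simp
    also have "\<dots> = lincomb N I (co x) (\<lambda>i. h (e i))"
      using True coord_Pi by (intro N.lincomb_cong) (auto simp: assms)
    also have "\<dots> = h x"
      using h.hom_lincomb[OF coord_Pi[OF True] e_Pi] lincomb_coord[OF True] by simp
    finally show ?thesis .
  next
    case False
    then show ?thesis using assms by (auto simp: linear_maps_def PiE_def extensional_def)
  qed
qed

definition lin_ext :: "('s, 'e, 'c) module_scheme \<Rightarrow> ('i \<Rightarrow> 'e) \<Rightarrow> 'd \<Rightarrow> 'e" where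
  "lin_ext N v = (\<lambda>d\<in>carrier M. lincomb N I (co d) v)"

lemma
  assumes "left_module S N" "v \<in> I \<rightarrow> carrier N"
  shows lin_ext_linear: "lin_ext N v \<in> linear_maps S M N"
    and lin_ext_basis: "i \<in> I \<Longrightarrow> lin_ext N v (e i) = v i"
proof -
  interpret N: left_module S N by fact
  show "lin_ext N v \<in> linear_maps S M N"
  proof (rule linear_mapsI)
    show "lin_ext N v \<in> carrier M \<rightarrow>\<^sub>E carrier N"
      by (auto simp: lin_ext_def intro!: N.lincomb_closed coord_Pi assms)
  next
    fix x y assume xy: "x \<in> carrier M" "y \<in> carrier M"
    have "lincomb N I (co (x \<oplus>\<^bsub>M\<^esub> y)) v = lincomb N I (\<lambda>i. co x i \<oplus>\<^bsub>S\<^esub> co y i) v"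
      using xy assms by (intro N.lincomb_cong) (auto simp: coord_add)
    then show "lin_ext N v (x \<oplus>\<^bsub>M\<^esub> y) = lin_ext N v x \<oplus>\<^bsub>N\<^esub> lin_ext N v y"
      using xy N.lincomb_add[OF coord_Pi coord_Pi assms(2)] by (simp add: lin_ext_def)
  next
    fix s x assume xy: "s \<in> carrier S" "x \<in> carrier M"
    have "lincomb N I (co (s \<odot>\<^bsub>M\<^esub> x)) v = lincomb N I (\<lambda>i. s \<otimes>\<^bsub>S\<^esub> co x i) v"
      using xy assms by (intro N.lincomb_cong) (auto simp: coord_smult smult_closed)
    then show "lin_ext N v (s \<odot>\<^bsub>M\<^esub> x) = s \<odot>\<^bsub>N\<^esub> lin_ext N v x"
      using xy N.lincomb_smult[OF coord_Pi _ assms(2)] by (simp add: lin_ext_def smult_closed)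
  qed
  show "lin_ext N v (e i) = v i" if i: "i \<in> I"
  proof -
    have "lincomb N I (co (e i)) v = lincomb N I (\<lambda>j. if j = i then \<one>\<^bsub>S\<^esub> else \<zero>\<^bsub>S\<^esub>) v"
      using i assms by (intro N.lincomb_cong) (auto simp: coord_basis)
    also have "\<dots> = v i"
      using N.lincomb_unit[OF finite_I i assms(2)] N.smult_one[of "v i"] funcset_mem[OF assms(2) i] by simp
    finally show ?thesis using i by (simp add: lin_ext_def)
  qed
qed

text \<open>A linear map sends the combination of the e_i with given coefficients to that of their
  images with the same coefficients. This turns bijectivity of the linearised Frobenius, of the
  counit and of the first approximation to the unit into statements about bases.\<close>

lemma bij_iff_basis:
  assumes "left_module S N" "g \<in> linear_maps S M N"
  shows "bij_betw g (carrier M) (carrier N) \<longleftrightarrow> indexed_basis S N I (\<lambda>i. g (e i))"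
proof -
  interpret N: left_module S N by fact
  interpret g: linear_map S M N g by unfold_locales (rule assms)
  have gc: "g x = lincomb N I (co x) (\<lambda>i. g (e i))" if "x \<in> carrier M" for x
    using g.hom_lincomb[OF coord_Pi[OF that] e_Pi] lincomb_coord[OF that] by simp
  show ?thesis
  proof
    assume b: "bij_betw g (carrier M) (carrier N)"
    show "indexed_basis S N I (\<lambda>i. g (e i))"
    proof (rule N.indexed_basisI[OF finite_I])
      fix d assume "d \<in> carrier N"
      then obtain x where x: "x \<in> carrier M" "d = g x" using b by (auto simp: bij_betw_def)
      then show "\<exists>a\<in>I \<rightarrow> carrier S. d = lincomb N I a (\<lambda>i. g (e i))"
        using gc coord_Pi by blast
    next
      fix a i assume a: "a \<in> I \<rightarrow> carrier S" "lincomb N I a (\<lambda>i. g (e i)) = \<zero>\<^bsub>N\<^esub>" and i: "i \<in> I"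
      then have "g (lincomb M I a e) = g \<zero>\<^bsub>M\<^esub>" using g.hom_lincomb[OF a(1) e_Pi] by simp
      then have "lincomb M I a e = \<zero>\<^bsub>M\<^esub>"
        using b lincomb_closed[OF a(1) e_Pi] by (auto simp: bij_betw_def inj_on_def)
      then show "a i = \<zero>\<^bsub>S\<^esub>"
        using coord_lincomb[OF a(1) i] abelian_group_hom.hom_zero[OF coord_hom[OF i]] by simp
    qed auto
  next
    assume "indexed_basis S N I (\<lambda>i. g (e i))"
    then interpret N: based_module S N I "\<lambda>i. g (e i)" by unfold_locales
    show "bij_betw g (carrier M) (carrier N)"
    proof (rule bij_betw_imageI)
      show "inj_on g (carrier M)"
      proof (rule inj_onI)
        fix x y assume "x \<in> carrier M" "y \<in> carrier M" "g x = g y"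
        then show "x = y"
          using gc N.coord_lincomb[OF coord_Pi] by (intro eqI_coord) metis+
      qed
      show "g ` carrier M = carrier N"
      proof (intro equalityI subsetI)
        fix d assume d: "d \<in> carrier N"
        have "g (lincomb M I (N.co d) e) = d"
          using g.hom_lincomb[OF N.coord_Pi[OF d] e_Pi] N.lincomb_coord[OF d] by simp
        then show "d \<in> g ` carrier M" using lincomb_closed[OF N.coord_Pi[OF d] e_Pi] by force
      qed auto
    qed
  qed
qed

text \<open>When 1 \<noteq> 0, distinct indices give vectors with distinct coordinates, so the
  family can be replaced by its image, which is the subset that \<open>free_of_finite_rank\<close>
  asks for.\<close>

lemma free:
  assumes "\<one>\<^bsub>S\<^esub> \<noteq> \<zero>\<^bsub>S\<^esub>"
  shows "free_of_finite_rank S M"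
proof -
  have inj: "inj_on e I"
  proof (rule inj_onI)
    fix i j assume ij: "i \<in> I" "j \<in> I" "e i = e j"
    then show "i = j" using coord_basis[of i i] coord_basis[of i j] assms by (auto split: if_splits)
  qed
  have re: "finsum M (\<lambda>b. a b \<odot>\<^bsub>M\<^esub> b) (e ` I) = lincomb M I (\<lambda>i. a (e i)) e" if "a \<in> e ` I \<rightarrow> carrier S" for a
    unfolding lincomb_def using that inj by (intro M.finsum_reindex) (auto simp: smult_closed Pi_iff)
  show ?thesis
    unfolding free_of_finite_rank_def
  proof (intro exI[of _ "e ` I"] conjI ballI)
    fix d assume d: "d \<in> carrier M"
    define a where "a = (\<lambda>b\<in>e ` I. co d (inv_into I e b))"
    have ae: "a (e i) = co d i" if "i \<in> I" for i using that inj by (simp add: a_def)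
    have aP: "a \<in> e ` I \<rightarrow>\<^sub>E carrier S" using d inj by (auto simp: a_def)
    show "\<exists>!a. a \<in> e ` I \<rightarrow>\<^sub>E carrier S \<and> d = finsum M (\<lambda>b. a b \<odot>\<^bsub>M\<^esub> b) (e ` I)"
    proof (intro ex1I conjI)
      have "d = lincomb M I (\<lambda>i. a (e i)) e"
        using lincomb_coord[OF d] lincomb_cong[OF coord_Pi[OF d] e_Pi] ae by metis
      also have "\<dots> = finsum M (\<lambda>b. a b \<odot>\<^bsub>M\<^esub> b) (e ` I)" by (rule re[symmetric]) (use aP in auto)
      finally show "d = finsum M (\<lambda>b. a b \<odot>\<^bsub>M\<^esub> b) (e ` I)" .
    next
      fix b assume b: "b \<in> e ` I \<rightarrow>\<^sub>E carrier S \<and> d = finsum M (\<lambda>c. b c \<odot>\<^bsub>M\<^esub> c) (e ` I)"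
      then have "d = lincomb M I (\<lambda>i. b (e i)) e" using re[of b] by auto
      moreover have "(\<lambda>i. b (e i)) \<in> I \<rightarrow> carrier S" using b by auto
      ultimately have "b (e i) = a (e i)" if "i \<in> I" for i
        using coord_eqI[of "\<lambda>i. b (e i)" d i] that ae[OF that] by simp
      then show "b = a" using b aP by (intro extensionalityI[of _ "e ` I"]) (auto simp: PiE_def)
    qed (rule aP)
  qed (use finite_I in auto)
qed

end

lemma free_imp_basis:
  assumes "free_of_finite_rank S M"
  obtains I :: "'d set" and e where "indexed_basis S (M :: ('s, 'd, 'b) module_scheme) I e"
proof -
  obtain B where "B \<subseteq> carrier M" "finite B"
    "\<forall>d\<in>carrier M. \<exists>!a. a \<in> B \<rightarrow>\<^sub>E carrier S \<and> d = (\<Oplus>\<^bsub>M\<^esub>b\<in>B. a b \<odot>\<^bsub>M\<^esub> b)"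
    using assms unfolding free_of_finite_rank_def by blast
  then have "indexed_basis S M B (\<lambda>b. b)" by (auto simp: indexed_basis_def lincomb_def)
  then show thesis by (rule that)
qed

context tensor_setting
begin

text \<open>Spanning is checked on pure tensors. For independence, the additive map b \<otimes> d
  \<mapsto> b f(d_i), with d_i the i-th coordinate of d, sends a combination of the 1 \<otimes> e_j
  to its i-th coefficient.\<close>

lemma tensor_basis:
  assumes "indexed_basis A M I e"
  shows "indexed_basis B T I (\<lambda>i. tn \<one>\<^bsub>B\<^esub> (e i))"
proof -
  interpret M': based_module A M I e by unfold_locales (rule assms)
  let ?e = "\<lambda>i. tn \<one>\<^bsub>B\<^esub> (e i)"
  have eP: "?e \<in> I \<rightarrow> carrier T" by auto
  show ?thesis
  proof (rule T.indexed_basisI[OF M'.finite_I eP])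
    fix X assume "X \<in> carrier T"
    then show "\<exists>a\<in>I \<rightarrow> carrier B. X = lincomb T I a ?e"
    proof (induction rule: tensor_induct)
      case zero
      have "lincomb T I (\<lambda>_. \<zero>\<^bsub>B\<^esub>) ?e = \<zero>\<^bsub>T\<^esub>"
        unfolding lincomb_def by (intro T.add.finprod_one_eqI) (rule T.smult_zero_l, simp)
      then show ?case by (intro bexI[of _ "\<lambda>_. \<zero>\<^bsub>B\<^esub>"]) auto
    next
      case (tens b d)
      have "tn b d = tn b (lincomb M I (M'.co d) e)" using tens by (simp add: M'.lincomb_coord)
      also have "\<dots> = finsum T (\<lambda>i. tn b (M'.co d i \<odot>\<^bsub>M\<^esub> e i)) I"
        unfolding lincomb_def using tens
        by (intro abelian_group_hom.hom_finsum_additive[OF tens_hom_r]) (auto simp: smult_closed)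
      also have "\<dots> = lincomb T I (\<lambda>i. b \<otimes>\<^bsub>B\<^esub> f (M'.co d i)) ?e"
        unfolding lincomb_def using tens
        by (intro T.finsum_cong') (auto simp: tens_smult)
      finally show ?case using tens by (intro bexI[of _ "\<lambda>i. b \<otimes>\<^bsub>B\<^esub> f (M'.co d i)"]) auto
    next
      case (add x y)
      then obtain a b where "a \<in> I \<rightarrow> carrier B" "x = lincomb T I a ?e" "b \<in> I \<rightarrow> carrier B" "y = lincomb T I b ?e"
        by blast
      then show ?case
        using T.lincomb_add[of a I b ?e] eP
        by (intro bexI[of _ "\<lambda>i. a i \<oplus>\<^bsub>B\<^esub> b i"]) auto
    qed
  next
    fix a i assume a: "a \<in> I \<rightarrow> carrier B" "lincomb T I a ?e = \<zero>\<^bsub>T\<^esub>" and i: "i \<in> I"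
    let ?h = "\<lambda>(b, d). b \<otimes>\<^bsub>B\<^esub> f (M'.co d i)"
    have bal: "balanced A B f M B ?h"
      unfolding balanced_def using i f_hom
      by (auto simp: B.l_distr B.r_distr M'.coord_add M'.coord_smult ring_hom_add ring_hom_mult B.m_assoc)
    note B = B.abelian_group_axioms
    interpret h: abelian_group_hom T B "tensor_hom B ?h" by (rule tensor_hom_hom[OF B bal])
    have "\<zero>\<^bsub>B\<^esub> = tensor_hom B ?h (lincomb T I a ?e)" using a by simp
    also have "\<dots> = finsum B (\<lambda>j. tensor_hom B ?h (a j \<odot>\<^bsub>T\<^esub> ?e j)) I"
      unfolding lincomb_def using a eP by (intro h.hom_finsum_additive) (auto simp: T.smult_closed Pi_iff)
    also have "\<dots> = finsum B (\<lambda>j. if i = j then a j else \<zero>\<^bsub>B\<^esub>) I"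
      using a i f_hom
      by (intro B.finsum_cong')
         (auto simp: tensor_hom_tens[OF B bal] M'.coord_basis Pi_iff ring_hom_one ring_hom_zero[OF f_hom ring_axioms B.ring_axioms])
    also have "\<dots> = a i" using a i M'.finite_I by (intro B.finsum_singleton) auto
    finally show "a i = \<zero>\<^bsub>B\<^esub>" by simp
  qed
qed

end

section \<open>Base change of \<open>\<phi>\<close>-modules\<close>

locale frob_ring = ring S for S :: "('s, 'a) frob_ring_scheme" +
  assumes frob_hom: "frob S \<in> ring_hom S S"
begin

lemma frob_closed [simp]: "s \<in> carrier S \<Longrightarrow> frob S s \<in> carrier S"
  using frob_hom by (auto simp: ring_hom_def)

lemma frob_additive: "abelian_group_hom S S (frob S)"
  by (rule abelian_group_hom_addI) (use frob_hom in \<open>auto simp: ring_hom_def abelian_group_axioms\<close>)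

end

text \<open>The structure needed to form S \<otimes>_{S,\<phi>} D, its map to D and base changes
  with their \<phi>. Freeness and bijectivity of the linearised Frobenius are handled separately,
  through bases.\<close>

locale semilinear_module = left_module S D + frob_ring S
  for S :: "('s, 'a) frob_ring_scheme" and D :: "('s, 'd, 'b) frob_module_scheme" +
  assumes mfrob_additive: "abelian_group_hom D D (mfrob D)"
    and mfrob_smult: "\<lbrakk>s \<in> carrier S; d \<in> carrier D\<rbrakk> \<Longrightarrow>
           mfrob D (s \<odot>\<^bsub>D\<^esub> d) = frob S s \<odot>\<^bsub>D\<^esub> mfrob D d"
begin

sublocale mfrob: abelian_group_hom D D "mfrob D" by (rule mfrob_additive)

sublocale tensor: tensor_setting S S "frob S" D
  by unfold_locales (rule frob_hom)

abbreviation "lin_val \<equiv> (\<lambda>(s, d). s \<odot>\<^bsub>D\<^esub> mfrob D d)"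

lemma lin_val_balanced: "balanced S S (frob S) D D lin_val"
  unfolding balanced_def
  by (auto simp: smult_closed smult_l_distr smult_r_distr smult_assoc mfrob_smult)

lemma linearised_frob_eq:
  "linearised_frob S D = (\<lambda>X\<in>carrier tensor.T. tensor_hom D lin_val X)"
proof -
  have "tensor_eval D lin_val = (\<lambda>u. finsum D (\<lambda>(s, d). [Poly_Mapping.lookup u (s, d)] \<cdot>\<^bsub>D\<^esub>
      (s \<odot>\<^bsub>D\<^esub> mfrob D d)) (Poly_Mapping.keys u))"
    unfolding tensor_eval_def
    by (intro ext arg_cong2[where f = "finsum D"] refl) auto
  then show ?thesis unfolding linearised_frob_def tensor_hom_def by simp
qed

lemma linearised_frob_tens:
  "s \<in> carrier S \<Longrightarrow> d \<in> carrier D \<Longrightarrow> linearised_frob S D (tensor.tn s d) = s \<odot>\<^bsub>D\<^esub> mfrob D d"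
  by (simp add: linearised_frob_eq tensor.tensor_hom_tens[OF M.abelian_group_axioms lin_val_balanced])

lemma linearised_frob_linear: "linearised_frob S D \<in> linear_maps S tensor.T D"
proof -
  note th = tensor.tensor_hom_hom[OF M.abelian_group_axioms lin_val_balanced]
  interpret h: abelian_group_hom tensor.T D "tensor_hom D lin_val" by (rule th)
  show ?thesis
  proof (rule linear_mapsI)
    fix s X assume s: "s \<in> carrier S" and X: "X \<in> carrier tensor.T"
    have "tensor_hom D lin_val (s \<odot>\<^bsub>tensor.T\<^esub> X) = s \<odot>\<^bsub>D\<^esub> tensor_hom D lin_val X"
      by (rule tensor.hom_eq_on_tensor[OF abelian_group_hom_comp[OF tensor.T.smult_hom_r[OF s] th]
            abelian_group_hom_comp[OF th smult_hom_r[OF s]] _ X])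
        (use s in \<open>simp add: tensor.tensor_hom_tens[OF M.abelian_group_axioms lin_val_balanced] smult_assoc\<close>)
    then show "linearised_frob S D (s \<odot>\<^bsub>tensor.T\<^esub> X) = s \<odot>\<^bsub>D\<^esub> linearised_frob S D X"
      using s X by (simp add: linearised_frob_eq tensor.T.smult_closed)
  qed (auto simp: linearised_frob_eq)
qed

lemma indexed_basis_cong:
  assumes "\<And>i. i \<in> I \<Longrightarrow> e i = e' i" "indexed_basis S D I e"
  shows "indexed_basis S D I e'"
proof -
  interpret based_module S D I e by unfold_locales (rule assms)
  have eq: "lincomb D I a e = lincomb D I a e'" if "a \<in> I \<rightarrow> carrier S" for a
    using that e_Pi assms(1) by (intro lincomb_cong) auto
  have P: "e' \<in> I \<rightarrow> carrier D" using e_Pi assms(1) by (auto simp: Pi_iff)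
  show ?thesis
  proof (rule indexed_basisI[OF finite_I P])
    show "\<exists>a\<in>I \<rightarrow> carrier S. d = lincomb D I a e'" if "d \<in> carrier D" for d
      using eq[OF coord_Pi[OF that]] lincomb_coord[OF that] coord_Pi[OF that]
      by (intro bexI[of _ "coord S D I e d"]) auto
  next
    fix a i assume "a \<in> I \<rightarrow> carrier S" "lincomb D I a e' = \<zero>\<^bsub>D\<^esub>" "i \<in> I"
    then show "a i = \<zero>\<^bsub>S\<^esub>"
      using eq coord_lincomb abelian_group_hom.hom_zero[OF coord_hom] by metis
  qed
qed

text \<open>The elements 1 \<otimes> e_i form a basis of S \<otimes>_{S,\<phi>} D and go to
  \<phi>(e_i). Hence the last condition on a \<phi>-module says that \<phi> carries a basis to a
  basis.\<close>

lemma linearised_bij_iff: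
  assumes "indexed_basis S D I e"
  shows "bij_betw (linearised_frob S D) (carrier tensor.T) (carrier D) \<longleftrightarrow>
    indexed_basis S D I (\<lambda>i. mfrob D (e i))"
proof -
  interpret T: based_module S tensor.T I "\<lambda>i. tensor.tn \<one>\<^bsub>S\<^esub> (e i)"
    by unfold_locales (rule tensor.tensor_basis[OF assms])
  have c: "e i \<in> carrier D" if "i \<in> I" for i using assms that by (auto simp: indexed_basis_def)
  have "linearised_frob S D (tensor.tn \<one>\<^bsub>S\<^esub> (e i)) = mfrob D (e i)" if "i \<in> I" for i
    using c[OF that] by (simp add: linearised_frob_tens smult_one)
  then show ?thesis
    unfolding T.bij_iff_basis[OF left_module_axioms linearised_frob_linear]
    using indexed_basis_cong[of I "\<lambda>i. linearised_frob S D (tensor.tn \<one>\<^bsub>S\<^esub> (e i))" "\<lambda>i. mfrob D (e i)"]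
      indexed_basis_cong[of I "\<lambda>i. mfrob D (e i)" "\<lambda>i. linearised_frob S D (tensor.tn \<one>\<^bsub>S\<^esub> (e i))"]
    by auto
qed

lemma phi_moduleI:
  assumes "indexed_basis S D I e" "indexed_basis S D I (\<lambda>i. mfrob D (e i))" "\<one>\<^bsub>S\<^esub> \<noteq> \<zero>\<^bsub>S\<^esub>"
  shows "phi_module S D"
proof -
  interpret based_module S D I e by unfold_locales (rule assms)
  show ?thesis
    using free[OF assms(3)] linearised_frob_linear linearised_bij_iff[OF assms(1)] assms(2)
    by unfold_locales (auto simp: mfrob_smult)
qed

end

lemma (in frob_ring) phi_module_semilinear:
  assumes "phi_module S D" shows "semilinear_module S D"
proof -
  interpret phi_module S D by fact
  show ?thesis
    by (intro semilinear_module.intro semilinear_module_axioms.intro left_module_axioms frob_ring_axioms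
        abelian_group_hom_addI M.abelian_group_axioms)
       (use mfrob_closed in \<open>auto simp: mfrob_add mfrob_semilinear\<close>)
qed

text \<open>From here on, freeness of a given \<phi>-module and bijectivity of its linearised
  Frobenius enter only through these two bases.\<close>

lemma (in frob_ring) phi_module_bases:
  assumes "phi_module S (D :: ('s, 'd, 'b) frob_module_scheme)"
  obtains I :: "'d set" and e where "indexed_basis S D I e" "indexed_basis S D I (\<lambda>i. mfrob D (e i))"
proof -
  interpret D: phi_module S D by fact
  interpret semilinear_module S D by (rule phi_module_semilinear[OF assms])
  from free_imp_basis[OF D.free] obtain I :: "'d set" and e where "indexed_basis S D I e" .
  then show thesis using that linearised_bij_iff D.linearised_bij by blast
qed

lemma (in linear_map) linear_inverse:
  assumes b: "bij_betw g (carrier M) (carrier N)"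
  obtains k where "k \<in> linear_maps S N M" "\<And>y. y \<in> carrier N \<Longrightarrow> g (k y) = y"
    "\<And>x. x \<in> carrier M \<Longrightarrow> k (g x) = x"
proof -
  define k where "k = (\<lambda>y\<in>carrier N. inv_into (carrier M) g y)"
  have kc: "k y \<in> carrier M" and gk: "g (k y) = y" if "y \<in> carrier N" for y
    using that b by (auto simp: k_def bij_betw_def inv_into_into f_inv_into_f)
  have kg: "k (g x) = x" if "x \<in> carrier M" for x
    using that b by (auto simp: k_def bij_betw_def inv_into_f_f)
  have kI: "k y = x" if "x \<in> carrier M" "y = g x" for x y using that kg by simp
  have "k \<in> linear_maps S N M"
  proof (rule linear_mapsI)
    show "k \<in> carrier N \<rightarrow>\<^sub>E carrier M" using kc by (auto simp: k_def)
    show "k (d \<oplus>\<^bsub>N\<^esub> e) = k d \<oplus>\<^bsub>M\<^esub> k e" if "d \<in> carrier N" "e \<in> carrier N" for d e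
      using that by (intro kI) (auto simp: kc gk)
    show "k (s \<odot>\<^bsub>N\<^esub> d) = s \<odot>\<^bsub>M\<^esub> k d" if "s \<in> carrier S" "d \<in> carrier N" for s d
      using that by (intro kI) (auto simp: kc gk hom_smult M.smult_closed)
  qed
  then show thesis using that gk kg by blast
qed

lemma phi_isoI:
  assumes D: "left_module S D" and E: "left_module S E" and f: "f \<in> phi_hom S D E"
    and mf: "mfrob D \<in> carrier D \<rightarrow> carrier D"
    and b: "bij_betw f (carrier D) (carrier E)"
  shows "f \<in> phi_iso S D E"
proof -
  interpret D: left_module S D by fact
  interpret E: left_module S E by fact
  interpret f: linear_map S D E f by unfold_locales (use f in \<open>simp add: phi_hom_def\<close>)
  obtain g where g: "g \<in> linear_maps S E D" and fg: "\<And>y. y \<in> carrier E \<Longrightarrow> f (g y) = y"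
    and gf: "\<And>x. x \<in> carrier D \<Longrightarrow> g (f x) = x"
    using f.linear_inverse[OF b] by blast
  have gc: "g y \<in> carrier D" if "y \<in> carrier E" for y
    using g that by (auto simp: linear_maps_def)
  have "g (mfrob E y) = mfrob D (g y)" if y: "y \<in> carrier E" for y
  proof -
    have "f (mfrob D (g y)) = mfrob E y" using f gc[OF y] fg[OF y] by (simp add: phi_hom_def)
    then show ?thesis using gf[of "mfrob D (g y)"] mf gc[OF y] by auto
  qed
  then have "g \<in> phi_hom S E D" using g by (simp add: phi_hom_def)
  moreover have "compose (carrier D) g f = (\<lambda>d\<in>carrier D. d)" "compose (carrier E) f g = (\<lambda>e\<in>carrier E. e)"
    by (auto simp: compose_def gf fg)
  ultimately show ?thesis using f by (auto simp: phi_iso_def)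
qed

lemma module_extend_simps [simp]:
  "carrier (module.extend M x) = carrier M"
  "zero (module.extend M x) = zero M"
  "add (module.extend M x) = add M"
  "smult (module.extend M x) = smult M"
  by (simp_all add: module.defs)

text \<open>\<open>phi_base_change\<close> adds a field to the record \<open>base_change\<close>.
  The two additive monoids are records of different types with the same operations, so the algebraic
  predicates are transferred by unfolding them down to these operations.\<close>

lemma module_extend_add_monoid:
  "comm_group (add_monoid (module.extend M x)) \<longleftrightarrow> comm_group (add_monoid M)"
  "Group.comm_monoid (add_monoid (module.extend M x)) \<longleftrightarrow> Group.comm_monoid (add_monoid M)"
  "group (add_monoid (module.extend M x)) \<longleftrightarrow> group (add_monoid M)"
  by (simp_all add: comm_group_def Group.comm_monoid_def comm_monoid_axioms_def group_def
      group_axioms_def Group.monoid_def Units_def)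

lemma module_extend_abelian_group: "abelian_group (module.extend M x) \<longleftrightarrow> abelian_group M"
  unfolding abelian_group_def abelian_group_axioms_def abelian_monoid_def module_extend_add_monoid ..

lemma module_extend_left_module: "left_module S (module.extend M x) \<longleftrightarrow> left_module S M"
  unfolding left_module_def left_module_axioms_def module_extend_abelian_group by simp

lemma module_extend_lincomb: "lincomb (module.extend M x) = lincomb M"
  by (simp add: lincomb_def finsum_def finprod_def fun_eq_iff)

lemma module_extend_basis: "indexed_basis S (module.extend M x) I e \<longleftrightarrow> indexed_basis S M I e"
  unfolding indexed_basis_def module_extend_lincomb by simp

lemma module_extend_hom_iff:
  "abelian_group_hom (module.extend M x) (module.extend N y) h \<longleftrightarrow> abelian_group_hom M N h"
  unfolding abelian_group_hom_def abelian_group_hom_axioms_def module_extend_abelian_group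
    group_hom_def module_extend_add_monoid
  by (simp add: group_hom_axioms_def hom_def)

section \<open>Base change along a ring homomorphism that commutes with \<phi>\<close>

locale frob_ring_hom = A: frob_ring A + B: frob_ring B
  for A :: "('a, 'x) frob_ring_scheme" and B :: "('b, 'y) frob_ring_scheme" and f :: "'a \<Rightarrow> 'b" +
  assumes f_hom: "f \<in> ring_hom A B"
    and f_frob: "a \<in> carrier A \<Longrightarrow> f (frob A a) = frob B (f a)"
    and nontrivial: "\<one>\<^bsub>B\<^esub> \<noteq> \<zero>\<^bsub>B\<^esub>"
begin

abbreviation "BC \<equiv> phi_base_change A B f"

lemma BC_simps [simp]:
  "carrier (BC D) = carrier (base_change A B f D)"
  "zero (BC D) = zero (base_change A B f D)"
  "add (BC D) = add (base_change A B f D)"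
  "smult (BC D) = smult (base_change A B f D)"
  by (simp_all add: phi_base_change_def)

lemma BC_extend: "\<exists>x. BC D = module.extend (base_change A B f D) x"
  unfolding phi_base_change_def by blast

lemma mfrob_BC: "mfrob (BC D) = tensor_lift A B f D (\<lambda>(b, d). (frob B b, mfrob D d))"
  by (simp add: phi_base_change_def module.defs frob_module.defs)

lemma setting: "left_module A D \<Longrightarrow> tensor_setting A B f D"
  by (intro tensor_setting.intro tensor_setting_axioms.intro B.ring_axioms f_hom)

lemma BC_left_module:
  assumes "left_module A D" shows "left_module B (BC D)"
  using tensor_setting.T_module[OF setting[OF assms]] BC_extend[of D] module_extend_left_module by metis

lemma BC_hom_iff:
  "abelian_group_hom (BC D) (BC E) h \<longleftrightarrow> abelian_group_hom (base_change A B f D) (base_change A B f E) h"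
  using BC_extend[of D] BC_extend[of E] module_extend_hom_iff by metis

lemma BC_basis_iff: "indexed_basis B (BC D) I e \<longleftrightarrow> indexed_basis B (base_change A B f D) I e"
  using BC_extend[of D] module_extend_basis by metis

text \<open>That f commutes with \<phi> is what lets \<phi> \<otimes> \<phi> respect the relation b
  f(a) \<otimes> d = b \<otimes> a d.\<close>

lemma
  assumes "semilinear_module A D"
  shows mfrob_BC_hom: "abelian_group_hom (base_change A B f D) (base_change A B f D) (mfrob (BC D))"
    and mfrob_BC_tens: "b \<in> carrier B \<Longrightarrow> d \<in> carrier D \<Longrightarrow>
      mfrob (BC D) (tens A B f D b d) = tens A B f D (frob B b) (mfrob D d)"
proof -
  interpret D: semilinear_module A D by fact
  interpret T: tensor_setting A B f D by (rule setting[OF D.left_module_axioms])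
  have *: "T.tn (frob B (b \<otimes>\<^bsub>B\<^esub> f a)) (mfrob D d) = T.tn (frob B b) (mfrob D (a \<odot>\<^bsub>D\<^esub> d))"
    if "a \<in> carrier A" "b \<in> carrier B" "d \<in> carrier D" for a b d
    using that by (simp add: D.mfrob_smult T.tens_smult f_frob ring_hom_mult[OF B.frob_hom])
  note l = T.setting T.setting B.frob_additive D.mfrob_additive
  show "abelian_group_hom T.T T.T (mfrob (BC D))"
    unfolding mfrob_BC by (rule tensor_lift_hom[OF l]) (rule *)
  show "mfrob (BC D) (T.tn b d) = T.tn (frob B b) (mfrob D d)" if "b \<in> carrier B" "d \<in> carrier D"
    unfolding mfrob_BC by (rule tensor_lift_tens[OF l _ that]) (rule *)
qed

lemma BC_semilinear:
  assumes "semilinear_module A D" shows "semilinear_module B (BC D)"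
proof -
  interpret D: semilinear_module A D by fact
  interpret T: tensor_setting A B f D by (rule setting[OF D.left_module_axioms])
  show ?thesis
  proof (intro semilinear_module.intro semilinear_module_axioms.intro B.frob_ring_axioms
      BC_left_module D.left_module_axioms)
    show "abelian_group_hom (BC D) (BC D) (mfrob (BC D))"
      unfolding BC_hom_iff by (rule mfrob_BC_hom[OF assms])
    fix s X assume s: "s \<in> carrier B" and "X \<in> carrier (BC D)"
    then have X: "X \<in> carrier T.T" by simp
    have fs: "frob B s \<in> carrier B" using s by simp
    have "mfrob (BC D) (s \<odot>\<^bsub>T.T\<^esub> X) = frob B s \<odot>\<^bsub>T.T\<^esub> mfrob (BC D) X"
      by (rule T.hom_eq_on_tensor[OF abelian_group_hom_comp[OF T.T.smult_hom_r[OF s] mfrob_BC_hom[OF assms]]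
            abelian_group_hom_comp[OF mfrob_BC_hom[OF assms] T.T.smult_hom_r[OF fs]] _ X])
        (use s in \<open>simp add: mfrob_BC_tens[OF assms] ring_hom_mult[OF B.frob_hom]\<close>)
    then show "mfrob (BC D) (s \<odot>\<^bsub>BC D\<^esub> X) = frob B s \<odot>\<^bsub>BC D\<^esub> mfrob (BC D) X" by simp
  qed
qed

text \<open>\<open>tensor_basis\<close> is applied twice: to the basis e and to the basis \<phi>(e).
  The second application gives the elements 1 \<otimes> \<phi>(e_i) = \<phi>(1 \<otimes>
  e_i).\<close>

lemma BC_phi_module:
  assumes "phi_module A D" shows "phi_module B (BC D)"
proof -
  interpret D: semilinear_module A D by (rule A.phi_module_semilinear[OF assms])
  interpret T: tensor_setting A B f D by (rule setting[OF D.left_module_axioms])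
  interpret BC: semilinear_module B "BC D" by (rule BC_semilinear[OF D.semilinear_module_axioms])
  obtain I :: "'c set" and e where e: "indexed_basis A D I e" "indexed_basis A D I (\<lambda>i. mfrob D (e i))"
    by (rule A.phi_module_bases[OF assms])
  have c: "e i \<in> carrier D" if "i \<in> I" for i using e that by (auto simp: indexed_basis_def)
  show ?thesis
  proof (rule BC.phi_moduleI[OF _ _ nontrivial])
    show "indexed_basis B (BC D) I (\<lambda>i. T.tn \<one>\<^bsub>B\<^esub> (e i))"
      unfolding BC_basis_iff by (rule T.tensor_basis[OF e(1)])
    show "indexed_basis B (BC D) I (\<lambda>i. mfrob (BC D) (T.tn \<one>\<^bsub>B\<^esub> (e i)))"
      by (rule BC.indexed_basis_cong[OF _ BC_basis_iff[THEN iffD2, OF T.tensor_basis[OF e(2)]]])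
        (use c in \<open>simp add: mfrob_BC_tens[OF D.semilinear_module_axioms] ring_hom_one[OF B.frob_hom]\<close>)
  qed
qed

lemma
  assumes D: "left_module A D" and E: "left_module A E" and g: "g \<in> linear_maps A D E"
  shows base_change_map_hom:
      "abelian_group_hom (base_change A B f D) (base_change A B f E) (base_change_map A B f D E g)"
    and base_change_map_tens:
      "b \<in> carrier B \<Longrightarrow> d \<in> carrier D \<Longrightarrow>
         base_change_map A B f D E g (tens A B f D b d) = tens A B f E b (g d)"
    and base_change_map_linear:
      "base_change_map A B f D E g \<in> linear_maps B (base_change A B f D) (base_change A B f E)"
proof -
  interpret g: linear_map A D E g
    by (intro linear_map.intro linear_map_axioms.intro D E g)
  interpret D: tensor_setting A B f D by (rule setting[OF D])
  interpret E: tensor_setting A B f E by (rule setting[OF E])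
  note l = D.setting E.setting abelian_group_hom_id[OF B.abelian_group_axioms] g.hom
  have *: "E.tn (b \<otimes>\<^bsub>B\<^esub> f a) (g d) = E.tn b (g (a \<odot>\<^bsub>D\<^esub> d))"
    if "a \<in> carrier A" "b \<in> carrier B" "d \<in> carrier D" for a b d
    using that by (simp add: g.hom_smult E.tens_smult)
  have h: "abelian_group_hom D.T E.T (tensor_lift A B f E (\<lambda>(b, d). (b, g d)))"
    by (rule tensor_lift_hom[OF l]) (rule *)
  show hom: "abelian_group_hom D.T E.T (base_change_map A B f D E g)"
    by (rule abelian_group_hom_cong[OF h]) (simp add: base_change_map_def)
  show t: "base_change_map A B f D E g (D.tn b d) = E.tn b (g d)" if "b \<in> carrier B" "d \<in> carrier D" for b d
    using tensor_lift_tens[OF l * that] that by (simp add: base_change_map_def)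
  show "base_change_map A B f D E g \<in> linear_maps B D.T E.T"
  proof (rule linear_mapsI)
    show "base_change_map A B f D E g \<in> carrier D.T \<rightarrow>\<^sub>E carrier E.T"
      using abelian_group_hom.hom_closed[OF hom] by (auto simp: base_change_map_def)
    show "base_change_map A B f D E g (s \<odot>\<^bsub>D.T\<^esub> X) = s \<odot>\<^bsub>E.T\<^esub> base_change_map A B f D E g X"
      if s: "s \<in> carrier B" and X: "X \<in> carrier D.T" for s X
      by (rule D.hom_eq_on_tensor[OF abelian_group_hom_comp[OF D.T.smult_hom_r[OF s] hom]
            abelian_group_hom_comp[OF hom E.T.smult_hom_r[OF s]] _ X])
        (use s in \<open>simp add: t\<close>)
  qed (rule abelian_group_hom.hom_add[OF hom])
qed

lemma base_change_map_phi_hom: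
  assumes "semilinear_module A D" "semilinear_module A E" "g \<in> phi_hom A D E"
  shows "base_change_map A B f D E g \<in> phi_hom B (BC D) (BC E)"
proof -
  interpret D: semilinear_module A D by fact
  interpret E: semilinear_module A E by fact
  have g: "g \<in> linear_maps A D E" and gf: "\<And>d. d \<in> carrier D \<Longrightarrow> g (mfrob D d) = mfrob E (g d)"
    using assms by (auto simp: phi_hom_def)
  interpret g: linear_map A D E g
    by unfold_locales (rule g)
  interpret T: tensor_setting A B f D by (rule setting[OF D.left_module_axioms])
  note m = D.left_module_axioms E.left_module_axioms g
  have "base_change_map A B f D E g (mfrob (BC D) X) = mfrob (BC E) (base_change_map A B f D E g X)"
    if X: "X \<in> carrier T.T" for X
    by (rule T.hom_eq_on_tensor[OF abelian_group_hom_comp[OF mfrob_BC_hom[OF assms(1)] base_change_map_hom[OF m]]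
          abelian_group_hom_comp[OF base_change_map_hom[OF m] mfrob_BC_hom[OF assms(2)]] _ X])
       (simp add: mfrob_BC_tens assms(1,2) base_change_map_tens[OF m] gf)
  then show ?thesis
    using base_change_map_linear[OF m] by (auto simp: phi_hom_def linear_maps_def)
qed

lemma base_change_functor: "phi_functor A B BC (base_change_map A B f)"
  unfolding phi_functor_def
proof (intro conjI allI impI)
  fix D :: "('a, 'd) frob_module" assume D: "phi_module A D"
  show "phi_module B (BC D)" by (rule BC_phi_module[OF D])
  interpret D: semilinear_module A D by (rule A.phi_module_semilinear[OF D])
  interpret T: tensor_setting A B f D by (rule setting[OF D.left_module_axioms])
  have i: "(\<lambda>d\<in>carrier D. d) \<in> linear_maps A D D" by (rule linear_mapsI) (auto simp: D.smult_closed)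
  note m = D.left_module_axioms D.left_module_axioms i
  have "base_change_map A B f D D (\<lambda>d\<in>carrier D. d) X = X" if X: "X \<in> carrier T.T" for X
    by (rule T.hom_eq_on_tensor[OF base_change_map_hom[OF m] abelian_group_hom_id[OF T.T_abelian_group] _ X])
      (simp add: base_change_map_tens[OF m])
  then show "base_change_map A B f D D (\<lambda>d\<in>carrier D. d) = (\<lambda>e\<in>carrier (BC D). e)"
    by (auto simp: base_change_map_def fun_eq_iff)
next
  fix D E :: "('a, 'd) frob_module" and g
  assume "phi_module A D \<and> phi_module A E \<and> g \<in> phi_hom A D E"
  then show "base_change_map A B f D E g \<in> phi_hom B (BC D) (BC E)"
    using A.phi_module_semilinear base_change_map_phi_hom by blast
next
  fix C D E :: "('a, 'd) frob_module" and g h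
  assume *: "phi_module A C \<and> phi_module A D \<and> phi_module A E \<and> g \<in> phi_hom A C D \<and> h \<in> phi_hom A D E"
  interpret C: semilinear_module A C by (rule A.phi_module_semilinear) (use * in simp)
  interpret D: semilinear_module A D by (rule A.phi_module_semilinear) (use * in simp)
  interpret E: semilinear_module A E by (rule A.phi_module_semilinear) (use * in simp)
  interpret T: tensor_setting A B f C by (rule setting[OF C.left_module_axioms])
  interpret g: linear_map A C D g by unfold_locales (use * in \<open>simp add: phi_hom_def\<close>)
  interpret h: linear_map A D E h by unfold_locales (use * in \<open>simp add: phi_hom_def\<close>)
  have gh: "compose (carrier C) h g \<in> linear_maps A C E"
    by (rule linear_mapsI) (auto simp: compose_def C.smult_closed g.hom_smult h.hom_smult)
  note m = C.left_module_axioms E.left_module_axioms gh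
  note mg = C.left_module_axioms D.left_module_axioms g.linear
  note mh = D.left_module_axioms E.left_module_axioms h.linear
  have "base_change_map A B f C E (compose (carrier C) h g) X =
      base_change_map A B f D E h (base_change_map A B f C D g X)" if X: "X \<in> carrier T.T" for X
    by (rule T.hom_eq_on_tensor[OF base_change_map_hom[OF m]
          abelian_group_hom_comp[OF base_change_map_hom[OF mg] base_change_map_hom[OF mh]] _ X])
      (simp add: base_change_map_tens[OF m] base_change_map_tens[OF mg] base_change_map_tens[OF mh] compose_eq)
  then show "base_change_map A B f C E (compose (carrier C) h g) =
      compose (carrier (BC C)) (base_change_map A B f D E h) (base_change_map A B f C D g)"
    by (auto simp: base_change_map_def[of A B f C E] compose_def fun_eq_iff)
qed

end

lemma module_extend_hom_left_iff:
  "abelian_group_hom (module.extend M x) N h \<longleftrightarrow> abelian_group_hom M N h"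
  unfolding abelian_group_hom_def abelian_group_hom_axioms_def module_extend_abelian_group
    group_hom_def module_extend_add_monoid
  by (simp add: group_hom_axioms_def hom_def)

lemma module_extend_hom_right_iff:
  "abelian_group_hom M (module.extend N y) h \<longleftrightarrow> abelian_group_hom M N h"
  unfolding abelian_group_hom_def abelian_group_hom_axioms_def module_extend_abelian_group
    group_hom_def module_extend_add_monoid
  by (simp add: group_hom_axioms_def hom_def)

context frob_ring_hom
begin

lemma BC_hom_left_iff: "abelian_group_hom (BC D) N h \<longleftrightarrow> abelian_group_hom (base_change A B f D) N h"
  using BC_extend[of D] module_extend_hom_left_iff by metis

lemma BC_hom_right_iff: "abelian_group_hom N (BC D) h \<longleftrightarrow> abelian_group_hom N (base_change A B f D) h"
  using BC_extend[of D] module_extend_hom_right_iff by metis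

end

lemma phi_hom_id: "left_module S D \<Longrightarrow> mfrob D \<in> carrier D \<rightarrow> carrier D \<Longrightarrow> (\<lambda>d\<in>carrier D. d) \<in> phi_hom S D D"
  unfolding phi_hom_def linear_maps_def
  by (auto simp: left_module.smult_closed abelian_group.axioms
      intro!: left_module.smult_closed abelian_monoid.a_closed[OF abelian_group.axioms(1)] left_module.axioms)

lemma phi_hom_compose:
  assumes "left_module S C" "mfrob C \<in> carrier C \<rightarrow> carrier C"
    and f: "f \<in> phi_hom S C D" and g: "g \<in> phi_hom S D E"
  shows "compose (carrier C) g f \<in> phi_hom S C E"
proof -
  interpret C: left_module S C by fact
  have "f c \<in> carrier D" if "c \<in> carrier C" for c
    using f that by (auto simp: phi_hom_def linear_maps_def)
  moreover have "g d \<in> carrier E" if "d \<in> carrier D" for d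
    using g that by (auto simp: phi_hom_def linear_maps_def)
  ultimately show ?thesis
    using f g assms(2) C.smult_closed
    by (auto simp: phi_hom_def linear_maps_def compose_def)
qed

section \<open>The counit R \<otimes>_S (S \<otimes>_R E) \<rightarrow> E attached to a retraction
  \<rho> of \<iota>\<close>

locale frob_retraction = i: frob_ring_hom R S \<iota> + l: frob_ring_hom S R \<rho>
  for R :: "('r, 'x) frob_ring_scheme" and S :: "('s, 'y) frob_ring_scheme" and \<iota> :: "'r \<Rightarrow> 's"
    and \<rho> :: "'s \<Rightarrow> 'r" +
  assumes retraction: "r \<in> carrier R \<Longrightarrow> \<rho> (\<iota> r) = r"
begin

lemma \<iota>_closed [simp]: "r \<in> carrier R \<Longrightarrow> \<iota> r \<in> carrier S"
  using i.f_hom by (auto simp: ring_hom_def)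

lemma \<rho>_closed [simp]: "s \<in> carrier S \<Longrightarrow> \<rho> s \<in> carrier R"
  using l.f_hom by (auto simp: ring_hom_def)

abbreviation "M1 \<equiv> \<lambda>E. base_change R S \<iota> E"
abbreviation "M2 \<equiv> \<lambda>E. base_change S R \<rho> (i.BC E)"

text \<open>The inner layer S \<otimes>_R E \<rightarrow> E of the counit. It is balanced over R
  because \<rho> \<iota> = id, and it must be known to be semilinear along \<rho> before the outer
  layer can be seen to be balanced over S.\<close>

definition counit1 where "counit1 E = tensor_hom E (\<lambda>(s, e). \<rho> s \<odot>\<^bsub>E\<^esub> e)"

definition counit where
  "counit E = (\<lambda>X\<in>carrier (M2 E). tensor_hom E (\<lambda>(r, y). r \<odot>\<^bsub>E\<^esub> counit1 E y) X)"

lemma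
  assumes "semilinear_module R E"
  shows counit1_hom: "abelian_group_hom (M1 E) E (counit1 E)"
    and counit1_tens: "s \<in> carrier S \<Longrightarrow> e \<in> carrier E \<Longrightarrow> counit1 E (tens R S \<iota> E s e) = \<rho> s \<odot>\<^bsub>E\<^esub> e"
    and counit1_smult: "s \<in> carrier S \<Longrightarrow> X \<in> carrier (M1 E) \<Longrightarrow>
      counit1 E (s \<odot>\<^bsub>M1 E\<^esub> X) = \<rho> s \<odot>\<^bsub>E\<^esub> counit1 E X"
    and counit1_frob: "X \<in> carrier (M1 E) \<Longrightarrow> counit1 E (mfrob (i.BC E) X) = mfrob E (counit1 E X)"
proof -
  interpret E: semilinear_module R E by fact
  interpret T: tensor_setting R S \<iota> E by (rule i.setting[OF E.left_module_axioms])
  have b: "balanced R S \<iota> E E (\<lambda>(s, e). \<rho> s \<odot>\<^bsub>E\<^esub> e)"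
    unfolding balanced_def using l.f_hom
    by (auto simp: E.smult_closed E.smult_l_distr E.smult_r_distr E.smult_assoc ring_hom_add ring_hom_mult retraction)
  show h: "abelian_group_hom (M1 E) E (counit1 E)"
    unfolding counit1_def by (rule T.tensor_hom_hom[OF E.M.abelian_group_axioms b])
  show t: "counit1 E (T.tn s e) = \<rho> s \<odot>\<^bsub>E\<^esub> e" if "s \<in> carrier S" "e \<in> carrier E" for s e
    unfolding counit1_def using T.tensor_hom_tens[OF E.M.abelian_group_axioms b that] by simp
  show "counit1 E (s \<odot>\<^bsub>M1 E\<^esub> X) = \<rho> s \<odot>\<^bsub>E\<^esub> counit1 E X" if s: "s \<in> carrier S" and X: "X \<in> carrier (M1 E)"
    by (rule T.hom_eq_on_tensor[OF abelian_group_hom_comp[OF T.T.smult_hom_r[OF s] h]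
          abelian_group_hom_comp[OF h E.smult_hom_r[OF \<rho>_closed[OF s]]] _ X])
      (use s in \<open>simp add: t E.smult_assoc ring_hom_mult[OF l.f_hom]\<close>)
  show "counit1 E (mfrob (i.BC E) X) = mfrob E (counit1 E X)" if X: "X \<in> carrier (M1 E)"
    by (rule T.hom_eq_on_tensor[OF abelian_group_hom_comp[OF i.mfrob_BC_hom[OF assms] h]
          abelian_group_hom_comp[OF h E.mfrob_additive] _ X])
      (simp add: t i.mfrob_BC_tens[OF assms] E.mfrob_smult l.f_frob)
qed

lemma
  assumes "semilinear_module R E"
  shows counit_hom: "abelian_group_hom (M2 E) E (counit E)"
    and counit_tens: "r \<in> carrier R \<Longrightarrow> X \<in> carrier (M1 E) \<Longrightarrow>
       counit E (tens S R \<rho> (i.BC E) r X) = r \<odot>\<^bsub>E\<^esub> counit1 E X"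
    and counit_phi_hom: "counit E \<in> phi_hom R (l.BC (i.BC E)) E"
proof -
  interpret E: semilinear_module R E by fact
  interpret ME: semilinear_module S "i.BC E" by (rule i.BC_semilinear[OF assms])
  interpret T: tensor_setting S R \<rho> "i.BC E" by (rule l.setting[OF ME.left_module_axioms])
  interpret c: abelian_group_hom "M1 E" E "counit1 E" by (rule counit1_hom[OF assms])
  let ?h = "\<lambda>(r, y). r \<odot>\<^bsub>E\<^esub> counit1 E y"
  have b: "balanced S R \<rho> (i.BC E) E ?h"
    unfolding balanced_def using counit1_smult[OF assms]
    by (auto simp: E.smult_closed E.smult_l_distr E.smult_r_distr E.smult_assoc)
  note th = T.tensor_hom_hom[OF E.M.abelian_group_axioms b]
  show h: "abelian_group_hom (M2 E) E (counit E)"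
    by (rule abelian_group_hom_cong[OF th]) (simp add: counit_def)
  show t: "counit E (T.tn r X) = r \<odot>\<^bsub>E\<^esub> counit1 E X" if "r \<in> carrier R" "X \<in> carrier (M1 E)" for r X
    using that T.tensor_hom_tens[OF E.M.abelian_group_axioms b, of r X] T.tens_closed[of r X]
    by (simp add: counit_def)
  have s: "counit E (r \<odot>\<^bsub>M2 E\<^esub> X) = r \<odot>\<^bsub>E\<^esub> counit E X" if r: "r \<in> carrier R" and X: "X \<in> carrier (M2 E)" for r X
    by (rule T.hom_eq_on_tensor[OF abelian_group_hom_comp[OF T.T.smult_hom_r[OF r] h]
          abelian_group_hom_comp[OF h E.smult_hom_r[OF r]] _ X])
      (use r in \<open>simp add: t E.smult_assoc\<close>)
  have f: "counit E (mfrob (l.BC (i.BC E)) X) = mfrob E (counit E X)" if X: "X \<in> carrier (M2 E)" for X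
    by (rule T.hom_eq_on_tensor[OF abelian_group_hom_comp[OF l.mfrob_BC_hom[OF ME.semilinear_module_axioms] h]
          abelian_group_hom_comp[OF h E.mfrob_additive] _ X])
      (use ME.mfrob.hom_closed in \<open>simp add: t l.mfrob_BC_tens[OF ME.semilinear_module_axioms]
        E.mfrob_smult counit1_frob[OF assms]\<close>)
  show "counit E \<in> phi_hom R (l.BC (i.BC E)) E"
    unfolding phi_hom_def using abelian_group_hom.hom_closed[OF h] abelian_group_hom.hom_add[OF h] s f
    by (auto simp: counit_def linear_maps_def)
qed

text \<open>The basis 1 \<otimes> (1 \<otimes> e_i) is sent to the basis e_i, since \<rho>(1) =
  1.\<close>

lemma counit_phi_iso:
  fixes E :: "('r, 'e) frob_module"
  assumes "phi_module R E"
  shows "counit E \<in> phi_iso R (l.BC (i.BC E)) E"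
proof -
  interpret E: semilinear_module R E by (rule i.A.phi_module_semilinear[OF assms])
  note s = E.semilinear_module_axioms
  interpret ME: semilinear_module S "i.BC E" by (rule i.BC_semilinear[OF s])
  interpret LE: semilinear_module R "l.BC (i.BC E)" by (rule l.BC_semilinear[OF ME.semilinear_module_axioms])
  interpret T1: tensor_setting R S \<iota> E by (rule i.setting[OF E.left_module_axioms])
  interpret T2: tensor_setting S R \<rho> "i.BC E" by (rule l.setting[OF ME.left_module_axioms])
  obtain I :: "'e set" and e where e: "indexed_basis R E I e" and "indexed_basis R E I (\<lambda>i. mfrob E (e i))"
    by (rule i.A.phi_module_bases[OF assms])
  have c: "e i \<in> carrier E" if "i \<in> I" for i using e that by (auto simp: indexed_basis_def)
  have "indexed_basis S (i.BC E) I (\<lambda>i. T1.tn \<one>\<^bsub>S\<^esub> (e i))"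
    unfolding i.BC_basis_iff by (rule T1.tensor_basis[OF e])
  then have b: "indexed_basis R (l.BC (i.BC E)) I (\<lambda>i. T2.tn \<one>\<^bsub>R\<^esub> (T1.tn \<one>\<^bsub>S\<^esub> (e i)))"
    unfolding l.BC_basis_iff by (rule T2.tensor_basis)
  interpret LB: based_module R "l.BC (i.BC E)" I "\<lambda>i. T2.tn \<one>\<^bsub>R\<^esub> (T1.tn \<one>\<^bsub>S\<^esub> (e i))"
    by unfold_locales (rule b)
  have "counit E (T2.tn \<one>\<^bsub>R\<^esub> (T1.tn \<one>\<^bsub>S\<^esub> (e i))) = e i" if "i \<in> I" for i
    using c[OF that] by (simp add: counit_tens[OF s] counit1_tens[OF s] ring_hom_one[OF l.f_hom] E.smult_one)
  then have "indexed_basis R E I (\<lambda>i. counit E (T2.tn \<one>\<^bsub>R\<^esub> (T1.tn \<one>\<^bsub>S\<^esub> (e i))))"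
    using E.indexed_basis_cong[OF _ e] by simp
  then have "bij_betw (counit E) (carrier (l.BC (i.BC E))) (carrier E)"
    using LB.bij_iff_basis[OF E.left_module_axioms, of "counit E"] counit_phi_hom[OF s]
    by (simp add: phi_hom_def)
  then show ?thesis
    by (intro phi_isoI LE.left_module_axioms E.left_module_axioms counit_phi_hom[OF s])
      (use LE.mfrob.hom_closed in auto)
qed

lemma counit_natural_iso:
  "phi_natural_iso R R (\<lambda>E. l.BC (i.BC E))
     (\<lambda>D E g. base_change_map S R \<rho> (i.BC D) (i.BC E) (base_change_map R S \<iota> D E g))
     (\<lambda>E. E) (\<lambda>D E g. g) counit"
  unfolding phi_natural_iso_def
proof (intro conjI allI impI)
  fix E :: "('r, 'e) frob_module" assume "phi_module R E"
  then show "counit E \<in> phi_iso R (l.BC (i.BC E)) E" by (rule counit_phi_iso)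
next
  fix D E :: "('r, 'e) frob_module" and g
  assume *: "phi_module R D \<and> phi_module R E \<and> g \<in> phi_hom R D E"
  interpret D: semilinear_module R D by (rule i.A.phi_module_semilinear) (use * in simp)
  interpret E: semilinear_module R E by (rule i.A.phi_module_semilinear) (use * in simp)
  interpret g: linear_map R D E g by unfold_locales (use * in \<open>simp add: phi_hom_def\<close>)
  note sD = D.semilinear_module_axioms and sE = E.semilinear_module_axioms
  interpret MD: semilinear_module S "i.BC D" by (rule i.BC_semilinear[OF sD])
  interpret ME: semilinear_module S "i.BC E" by (rule i.BC_semilinear[OF sE])
  interpret T1: tensor_setting R S \<iota> D by (rule i.setting[OF D.left_module_axioms])
  interpret T2: tensor_setting S R \<rho> "i.BC D" by (rule l.setting[OF MD.left_module_axioms])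
  let ?m = "base_change_map R S \<iota> D E g"
  let ?d = "base_change_map S R \<rho> (i.BC D) (i.BC E) ?m"
  note lin = D.left_module_axioms E.left_module_axioms g.linear
  have "?m \<in> phi_hom S (i.BC D) (i.BC E)"
    using * by (intro i.base_change_map_phi_hom sD sE) simp
  then have ml: "?m \<in> linear_maps S (i.BC D) (i.BC E)" by (simp add: phi_hom_def)
  note lin' = MD.left_module_axioms ME.left_module_axioms ml
  have 1: "counit1 E (?m X) = g (counit1 D X)" if X: "X \<in> carrier (M1 D)" for X
    by (rule T1.hom_eq_on_tensor[OF abelian_group_hom_comp[OF i.base_change_map_hom[OF lin] counit1_hom[OF sE]]
          abelian_group_hom_comp[OF counit1_hom[OF sD] g.hom] _ X])
      (simp add: i.base_change_map_tens[OF lin] counit1_tens[OF sD] counit1_tens[OF sE] g.hom_smult)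
  have m_closed: "?m X \<in> carrier (M1 E)" if "X \<in> carrier (M1 D)" for X
    by (rule abelian_group_hom.hom_closed[OF i.base_change_map_hom[OF lin] that])
  have "counit E (?d X) = g (counit D X)" if X: "X \<in> carrier (M2 D)" for X
    by (rule T2.hom_eq_on_tensor[OF abelian_group_hom_comp[OF l.base_change_map_hom[OF lin'] counit_hom[OF sE]]
          abelian_group_hom_comp[OF counit_hom[OF sD] g.hom] _ X])
      (simp add: l.base_change_map_tens[OF lin'] counit_tens[OF sD] counit_tens[OF sE] m_closed 1 g.hom_smult
        abelian_group_hom.hom_closed[OF counit1_hom[OF sD]])
  then show "compose (carrier (l.BC (i.BC D))) (counit E) ?d = compose (carrier (l.BC (i.BC D))) g (counit D)"
    by (simp add: compose_def cong: restrict_cong)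
qed

end

section \<open>Lifting morphisms through a complete filtration\<close>

text \<open>The additive span J M of the products a d with a in J. That it is a submodule is shown
  in \<open>jspan_minus\<close> and \<open>jspan_smult\<close> for an ideal J.\<close>

inductive_set jspan :: "('s, 'd, 'b) module_scheme \<Rightarrow> 's set \<Rightarrow> 'd set" for M J where
  jspan_zero: "\<zero>\<^bsub>M\<^esub> \<in> jspan M J"
| jspan_gen: "a \<in> J \<Longrightarrow> d \<in> carrier M \<Longrightarrow> a \<odot>\<^bsub>M\<^esub> d \<in> jspan M J"
| jspan_add: "x \<in> jspan M J \<Longrightarrow> y \<in> jspan M J \<Longrightarrow> x \<oplus>\<^bsub>M\<^esub> y \<in> jspan M J"

context left_module
begin

context
  fixes J assumes J: "ideal J S"
begin

lemma J_closed: "a \<in> J \<Longrightarrow> a \<in> carrier S"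
  using ideal.Icarr[OF J] .

lemma jspan_closed: "x \<in> jspan M J \<Longrightarrow> x \<in> carrier M"
  by (induction rule: jspan.induct) (auto simp: smult_closed J_closed)

lemma jspan_minus: "x \<in> jspan M J \<Longrightarrow> \<ominus>\<^bsub>M\<^esub> x \<in> jspan M J"
proof (induction rule: jspan.induct)
  case (jspan_gen a d)
  then have "\<ominus>\<^bsub>S\<^esub> a \<in> J" using additive_subgroup.a_inv_closed[OF ideal.axioms(1)[OF J]] by blast
  then show ?case
    using jspan_gen jspan.jspan_gen[of "\<ominus>\<^bsub>S\<^esub> a" J d M] by (simp add: smult_minus_l J_closed)
qed (auto simp: M.minus_add M.a_inv_zero jspan_closed intro: jspan.intros)

lemma jspan_smult: "x \<in> jspan M J \<Longrightarrow> s \<in> carrier S \<Longrightarrow> s \<odot>\<^bsub>M\<^esub> x \<in> jspan M J"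
proof (induction rule: jspan.induct)
  case jspan_zero
  then show ?case using abelian_group_hom.hom_zero[OF smult_hom_r] by (simp add: jspan.jspan_zero)
next
  case (jspan_gen a d)
  then show ?case
    using jspan.jspan_gen[OF ideal.I_l_closed[OF J jspan_gen(1,3)], of d M]
    by (simp add: smult_assoc J_closed)
qed (auto simp: smult_r_distr jspan_closed intro: jspan.jspan_add)

lemma jspan_sym:
  assumes "x \<in> carrier M" "y \<in> carrier M" "x \<ominus>\<^bsub>M\<^esub> y \<in> jspan M J"
  shows "y \<ominus>\<^bsub>M\<^esub> x \<in> jspan M J"
proof -
  have "\<ominus>\<^bsub>M\<^esub> (x \<ominus>\<^bsub>M\<^esub> y) = y \<ominus>\<^bsub>M\<^esub> x"
    using assms by (simp add: a_minus_def M.minus_add M.a_comm)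
  then show ?thesis using jspan_minus[OF assms(3)] by simp
qed

lemma jspan_trans:
  assumes "x \<in> carrier M" "y \<in> carrier M" "z \<in> carrier M"
    and "x \<ominus>\<^bsub>M\<^esub> y \<in> jspan M J" "y \<ominus>\<^bsub>M\<^esub> z \<in> jspan M J"
  shows "x \<ominus>\<^bsub>M\<^esub> z \<in> jspan M J"
proof -
  have "(x \<ominus>\<^bsub>M\<^esub> y) \<oplus>\<^bsub>M\<^esub> (y \<ominus>\<^bsub>M\<^esub> z) = x \<ominus>\<^bsub>M\<^esub> z"
    using assms by (simp add: a_minus_def M.a_assoc M.r_neg1)
  then show ?thesis using jspan.jspan_add[OF assms(4,5)] by simp
qed

lemma jspan_finsum_diff:
  assumes "x \<in> I \<rightarrow> carrier M" "y \<in> I \<rightarrow> carrier M"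
    and "\<And>i. i \<in> I \<Longrightarrow> x i \<ominus>\<^bsub>M\<^esub> y i \<in> jspan M J"
  shows "finsum M x I \<ominus>\<^bsub>M\<^esub> finsum M y I \<in> jspan M J"
  using assms
proof (induction I rule: infinite_finite_induct)
  case (insert i I)
  then have c: "x i \<in> carrier M" "y i \<in> carrier M" "x \<in> I \<rightarrow> carrier M" "y \<in> I \<rightarrow> carrier M"
    by auto
  have "(x i \<ominus>\<^bsub>M\<^esub> y i) \<oplus>\<^bsub>M\<^esub> (finsum M x I \<ominus>\<^bsub>M\<^esub> finsum M y I) \<in> jspan M J"
    using insert c by (intro jspan.jspan_add) auto
  moreover have "(x i \<ominus>\<^bsub>M\<^esub> y i) \<oplus>\<^bsub>M\<^esub> (finsum M x I \<ominus>\<^bsub>M\<^esub> finsum M y I) =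
      finsum M x (insert i I) \<ominus>\<^bsub>M\<^esub> finsum M y (insert i I)"
    using insert(1,2) c by (simp add: a_minus_def M.minus_add M.a_ac)
  ultimately show ?case by simp
qed (auto simp: a_minus_def M.r_neg intro: jspan.jspan_zero)

end

lemma jspan_mono: "x \<in> jspan M J \<Longrightarrow> J \<subseteq> J' \<Longrightarrow> x \<in> jspan M J'"
  by (induction rule: jspan.induct) (auto intro: jspan.intros)

end

lemma (in linear_map) jspan_image:
  assumes "ideal J S" "x \<in> jspan M J"
  shows "g x \<in> jspan N J"
  using assms(2)
  by (induction rule: jspan.induct)
     (auto simp: hom_smult ideal.Icarr[OF assms(1)] M.jspan_closed[OF assms(1)] intro: jspan.intros)

lemma (in linear_map) jspan_image_diff:
  assumes "ideal J S" "x \<in> carrier M" "y \<in> carrier M" "x \<ominus>\<^bsub>M\<^esub> y \<in> jspan M J"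
  shows "g x \<ominus>\<^bsub>N\<^esub> g y \<in> jspan N J"
  using jspan_image[OF assms(1,4)] assms(2,3) by (simp add: a_minus_def)

context based_module
begin

text \<open>The coordinates of a d are the products of a with the coordinates of d, so it matters
  that J absorbs factors on the right. Separatedness and completeness of S pass to free modules of
  finite rank through this.\<close>

lemma jspan_iff_coord:
  assumes J: "ideal J S" and x: "x \<in> carrier M"
  shows "x \<in> jspan M J \<longleftrightarrow> (\<forall>i\<in>I. co x i \<in> J)"
proof
  assume "x \<in> jspan M J"
  then show "\<forall>i\<in>I. co x i \<in> J"
  proof (induction rule: jspan.induct)
    case jspan_zero
    then show ?case
      using additive_subgroup.zero_closed[OF ideal.axioms(1)[OF J]]
        abelian_group_hom.hom_zero[OF coord_hom] by auto
  next
    case (jspan_gen a d)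
    then show ?case
      using ideal.I_r_closed[OF J] by (auto simp: coord_smult ideal.Icarr[OF J])
  next
    case (jspan_add x y)
    then show ?case
      using additive_subgroup.a_closed[OF ideal.axioms(1)[OF J]]
      by (auto simp: coord_add jspan_closed[OF J])
  qed
next
  assume *: "\<forall>i\<in>I. co x i \<in> J"
  have "finsum M (\<lambda>i. co x i \<odot>\<^bsub>M\<^esub> e i) I \<ominus>\<^bsub>M\<^esub> finsum M (\<lambda>i. \<zero>\<^bsub>M\<^esub>) I \<in> jspan M J"
    using * x by (intro jspan_finsum_diff[OF J]) (auto simp: smult_closed a_minus_def M.a_inv_zero intro!: jspan_gen)
  then show "x \<in> jspan M J"
    using lincomb_coord[OF x] x by (simp add: lincomb_def a_minus_def M.a_inv_zero)
qed

text \<open>Expand d: the difference is a combination of the differences at the basis vectors, and J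
  N absorbs the coefficients. It is applied chiefly to the basis \<phi>(e_i), where congruences are
  one step better.\<close>

lemma linear_congruent_on_basis:
  assumes "left_module S N" "g \<in> linear_maps S M N" "h \<in> linear_maps S M N" and J: "ideal J S"
    and gh: "\<And>i. i \<in> I \<Longrightarrow> g (e i) \<ominus>\<^bsub>N\<^esub> h (e i) \<in> jspan N J" and d: "d \<in> carrier M"
  shows "g d \<ominus>\<^bsub>N\<^esub> h d \<in> jspan N J"
proof -
  interpret N: left_module S N by fact
  interpret g: linear_map S M N g by unfold_locales (rule assms)
  interpret h: linear_map S M N h by unfold_locales (rule assms)
  have eq: "k d = finsum N (\<lambda>i. co d i \<odot>\<^bsub>N\<^esub> k (e i)) I" if "linear_map S M N k" for k
    using linear_map.hom_lincomb[OF that coord_Pi[OF d] e_Pi] lincomb_coord[OF d]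
    by (simp add: lincomb_def)
  show ?thesis
    unfolding eq[OF g.linear_map_axioms] eq[OF h.linear_map_axioms]
  proof (rule N.jspan_finsum_diff[OF J])
    fix i assume i: "i \<in> I"
    have "co d i \<odot>\<^bsub>N\<^esub> (g (e i) \<ominus>\<^bsub>N\<^esub> h (e i)) \<in> jspan N J"
      using i d by (intro N.jspan_smult[OF J] gh) auto
    moreover have "co d i \<odot>\<^bsub>N\<^esub> (g (e i) \<ominus>\<^bsub>N\<^esub> h (e i)) =
        co d i \<odot>\<^bsub>N\<^esub> g (e i) \<ominus>\<^bsub>N\<^esub> co d i \<odot>\<^bsub>N\<^esub> h (e i)"
      using i d abelian_group_hom.hom_a_inv[OF N.smult_hom_r[of "co d i"]]
      by (simp add: a_minus_def N.smult_r_distr)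
    ultimately show "co d i \<odot>\<^bsub>N\<^esub> g (e i) \<ominus>\<^bsub>N\<^esub> co d i \<odot>\<^bsub>N\<^esub> h (e i) \<in> jspan N J" by simp
  qed (use d in \<open>auto intro!: N.smult_closed\<close>)
qed

end

lemma (in semilinear_module) mfrob_lincomb:
  assumes "a \<in> I \<rightarrow> carrier S" "e \<in> I \<rightarrow> carrier D"
  shows "mfrob D (lincomb D I a e) = lincomb D I (\<lambda>i. frob S (a i)) (\<lambda>i. mfrob D (e i))"
proof -
  have "mfrob D (lincomb D I a e) = finsum D (\<lambda>i. mfrob D (a i \<odot>\<^bsub>D\<^esub> e i)) I"
    unfolding lincomb_def using assms
    by (intro mfrob.hom_finsum_additive) (auto simp: Pi_iff smult_closed)
  also have "\<dots> = lincomb D I (\<lambda>i. frob S (a i)) (\<lambda>i. mfrob D (e i))"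
    unfolding lincomb_def using assms
    by (intro M.finsum_cong') (auto simp: Pi_iff mfrob_smult smult_closed)
  finally show ?thesis .
qed

text \<open>The last two assumptions say that S is the limit of the quotients S/J_n. In
  \<open>J_complete\<close> the limit is as precise as the steps: since the ideals decrease, all
  terms after y_n agree with it modulo J_n.\<close>

locale filtered_frob_ring = frob_ring S for S :: "('s, 'a) frob_ring_scheme" +
  fixes J :: "nat \<Rightarrow> 's set"
  assumes J_ideal: "ideal (J n) S"
    and J_Suc: "J (Suc n) \<subseteq> J n"
    and frob_J: "x \<in> J n \<Longrightarrow> frob S x \<in> J (Suc n)"
    and J_separated: "(\<And>n. x \<in> J n) \<Longrightarrow> x = \<zero>\<^bsub>S\<^esub>"
    and J_complete: "(\<And>n. y n \<in> carrier S) \<Longrightarrow> (\<And>n. y (Suc n) \<ominus>\<^bsub>S\<^esub> y n \<in> J n) \<Longrightarrow>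
       \<exists>l\<in>carrier S. \<forall>n. l \<ominus>\<^bsub>S\<^esub> y n \<in> J n"
begin

text \<open>The contraction that drives the whole argument: \<phi>(a d) = \<phi>(a) \<phi>(d), and
  \<phi>(a) lies one step deeper than a.\<close>

lemma jspan_mfrob:
  assumes "semilinear_module S D" "x \<in> jspan D (J n)"
  shows "mfrob D x \<in> jspan D (J (Suc n))"
proof -
  interpret semilinear_module S D by fact
  show ?thesis
    using assms(2)
    by (induction rule: jspan.induct)
       (auto simp: mfrob_smult ideal.Icarr[OF J_ideal] jspan_closed[OF J_ideal]
         intro!: jspan.intros frob_J)
qed

lemma jspan_mfrob_diff:
  assumes "semilinear_module S D" "x \<in> carrier D" "y \<in> carrier D" "x \<ominus>\<^bsub>D\<^esub> y \<in> jspan D (J n)"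
  shows "mfrob D x \<ominus>\<^bsub>D\<^esub> mfrob D y \<in> jspan D (J (Suc n))"
proof -
  interpret semilinear_module S D by fact
  show ?thesis using jspan_mfrob[OF assms(1,4)] assms(2,3) by (simp add: a_minus_def)
qed

lemma jspan_separated:
  assumes "based_module S D I e" "x \<in> carrier D" "y \<in> carrier D" "\<And>n. x \<ominus>\<^bsub>D\<^esub> y \<in> jspan D (J n)"
  shows "x = y"
proof -
  interpret based_module S D I e by fact
  have c: "x \<ominus>\<^bsub>D\<^esub> y \<in> carrier D" using assms by simp
  have "co (x \<ominus>\<^bsub>D\<^esub> y) i = co \<zero>\<^bsub>D\<^esub> i" if "i \<in> I" for i
    using assms(4) jspan_iff_coord[OF J_ideal c] that abelian_group_hom.hom_zero[OF coord_hom[OF that]]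
    by (auto intro: J_separated)
  then have "x \<ominus>\<^bsub>D\<^esub> y = \<zero>\<^bsub>D\<^esub>" using c by (intro eqI_coord) auto
  then have "x = \<ominus>\<^bsub>D\<^esub> (\<ominus>\<^bsub>D\<^esub> y)"
    using assms by (intro M.minus_equality[symmetric]) (auto simp: a_minus_def)
  then show ?thesis using assms by simp
qed

text \<open>By \<open>jspan_iff_coord\<close> the coordinates form sequences to which
  \<open>J_complete\<close> applies; the limit is assembled from their limits.\<close>

lemma jspan_complete:
  assumes "based_module S D I e" and x: "\<And>n. x n \<in> carrier D"
    and d: "\<And>n. x (Suc n) \<ominus>\<^bsub>D\<^esub> x n \<in> jspan D (J n)"
  shows "\<exists>l\<in>carrier D. \<forall>n. l \<ominus>\<^bsub>D\<^esub> x n \<in> jspan D (J n)"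
proof -
  interpret based_module S D I e by fact
  have diff: "co (u \<ominus>\<^bsub>D\<^esub> v) i = co u i \<ominus>\<^bsub>S\<^esub> co v i" if "u \<in> carrier D" "v \<in> carrier D" "i \<in> I" for u v i
    using that abelian_group_hom.hom_a_inv[OF coord_hom[OF that(3)]] by (simp add: a_minus_def coord_add)
  have "\<exists>l\<in>carrier S. \<forall>n. l \<ominus>\<^bsub>S\<^esub> co (x n) i \<in> J n" if "i \<in> I" for i
    using that x d by (intro J_complete) (auto simp: diff[symmetric] jspan_iff_coord[OF J_ideal])
  then obtain l where l: "\<And>i. i \<in> I \<Longrightarrow> l i \<in> carrier S" "\<And>i n. i \<in> I \<Longrightarrow> l i \<ominus>\<^bsub>S\<^esub> co (x n) i \<in> J n"
    by metis
  have lP: "l \<in> I \<rightarrow> carrier S" using l by auto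
  let ?l = "lincomb D I l e"
  have lc: "?l \<in> carrier D" by (rule lincomb_closed[OF lP e_Pi])
  have "?l \<ominus>\<^bsub>D\<^esub> x n \<in> jspan D (J n)" for n
    using lc x l by (subst jspan_iff_coord[OF J_ideal]) (auto simp: diff coord_lincomb[OF lP])
  then show ?thesis using lc by blast
qed

text \<open>If f and g agree modulo J_n, then \<phi>(f(e_i)) = f(\<phi>(e_i)) and \<phi>(g(e_i)) =
  g(\<phi>(e_i)) agree modulo J_{n+1}. As the \<phi>(e_i) are a basis, f and g agree modulo J_{n+1}
  everywhere; separatedness concludes.\<close>

theorem phi_hom_unique:
  assumes D: "phi_module S D" and E: "phi_module S E" and f: "f \<in> phi_hom S D E" and g: "g \<in> phi_hom S D E"
    and fg: "\<And>d. d \<in> carrier D \<Longrightarrow> f d \<ominus>\<^bsub>E\<^esub> g d \<in> jspan E (J 0)"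
  shows "f = g"
proof -
  interpret D: semilinear_module S D by (rule phi_module_semilinear[OF D])
  interpret E: semilinear_module S E by (rule phi_module_semilinear[OF E])
  obtain I :: "'b set" and e where e: "indexed_basis S D I e" "indexed_basis S D I (\<lambda>i. mfrob D (e i))"
    by (rule phi_module_bases[OF D])
  interpret D1: based_module S D I e by unfold_locales (rule e)
  interpret D2: based_module S D I "\<lambda>i. mfrob D (e i)" by unfold_locales (rule e)
  obtain I' :: "'d set" and b where b: "indexed_basis S E I' b"
    by (rule phi_module_bases[OF E])
  interpret EB: based_module S E I' b by unfold_locales (rule b)
  interpret f: linear_map S D E f by unfold_locales (use f in \<open>simp add: phi_hom_def\<close>)
  interpret g: linear_map S D E g by unfold_locales (use g in \<open>simp add: phi_hom_def\<close>)
  have ff: "f (mfrob D d) = mfrob E (f d)" "g (mfrob D d) = mfrob E (g d)" if "d \<in> carrier D" for d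
    using f g that by (auto simp: phi_hom_def)
  have "\<forall>d\<in>carrier D. f d \<ominus>\<^bsub>E\<^esub> g d \<in> jspan E (J n)" for n
  proof (induction n)
    case (Suc n)
    show ?case
    proof
      fix d assume d: "d \<in> carrier D"
      show "f d \<ominus>\<^bsub>E\<^esub> g d \<in> jspan E (J (Suc n))"
        by (rule D2.linear_congruent_on_basis[OF E.left_module_axioms f.linear g.linear J_ideal _ d])
          (use Suc in \<open>simp add: ff jspan_mfrob_diff[OF E.semilinear_module_axioms]\<close>)
    qed
  qed (use fg in auto)
  then have "f (e i) = g (e i)" if "i \<in> I" for i
    using that by (intro jspan_separated[OF EB.based_module_axioms]) auto
  then show ?thesis
    by (rule D1.linear_eq_on_basis[OF E.left_module_axioms f.linear g.linear])
qed

theorem phi_hom_lift: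
  assumes D: "phi_module S D" and E: "phi_module S E" and h: "h \<in> linear_maps S D E"
    and hf: "\<And>d. d \<in> carrier D \<Longrightarrow> h (mfrob D d) \<ominus>\<^bsub>E\<^esub> mfrob E (h d) \<in> jspan E (J 0)"
  obtains f where "f \<in> phi_hom S D E" "\<And>d. d \<in> carrier D \<Longrightarrow> f d \<ominus>\<^bsub>E\<^esub> h d \<in> jspan E (J 0)"
proof -
  interpret D: semilinear_module S D by (rule phi_module_semilinear[OF D])
  interpret E: semilinear_module S E by (rule phi_module_semilinear[OF E])
  obtain I :: "'b set" and e where e: "indexed_basis S D I e" "indexed_basis S D I (\<lambda>i. mfrob D (e i))"
    by (rule phi_module_bases[OF D])
  interpret D1: based_module S D I e by unfold_locales (rule e)
  interpret D2: based_module S D I "\<lambda>i. mfrob D (e i)" by unfold_locales (rule e)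
  obtain I' :: "'d set" and b where b: "indexed_basis S E I' b"
    by (rule phi_module_bases[OF E])
  interpret EB: based_module S E I' b by unfold_locales (rule b)
  note Em = E.left_module_axioms and Es = E.semilinear_module_axioms
  \<comment> \<open>The morphisms of \<phi>-modules are the linear fixed points of \<open>T\<close>:
    by \<open>T_frob\<close>, \<open>T k\<close> satisfies T k (\<phi>(d)) = \<phi>(k(d)) for every
    d and not only on the basis.\<close>
  define T where "T k = D2.lin_ext E (\<lambda>i. mfrob E (k (e i)))" for k
  have kc: "k d \<in> carrier E" if "k \<in> linear_maps S D E" "d \<in> carrier D" for k d
    using that by (auto simp: linear_maps_def)
  have T_basis_closed: "(\<lambda>i. mfrob E (k (e i))) \<in> I \<rightarrow> carrier E" if "k \<in> linear_maps S D E" for k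
    using kc[OF that] by auto
  have T_lin: "T k \<in> linear_maps S D E" if "k \<in> linear_maps S D E" for k
    unfolding T_def by (rule D2.lin_ext_linear[OF Em T_basis_closed[OF that]])
  have T_frob: "T k (mfrob D d) = mfrob E (k d)" if k: "k \<in> linear_maps S D E" and d: "d \<in> carrier D" for k d
  proof -
    interpret k: linear_map S D E k by unfold_locales (rule k)
    interpret Tk: linear_map S D E "T k" by unfold_locales (rule T_lin[OF k])
    have c: "(\<lambda>i. frob S (D1.co d i)) \<in> I \<rightarrow> carrier S" using d by auto
    have "T k (mfrob D (lincomb D I (D1.co d) e)) =
        lincomb E I (\<lambda>i. frob S (D1.co d i)) (\<lambda>i. T k (mfrob D (e i)))"
      unfolding D.mfrob_lincomb[OF D1.coord_Pi[OF d] D1.e_Pi] by (rule Tk.hom_lincomb[OF c D2.e_Pi])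
    also have "\<dots> = lincomb E I (\<lambda>i. frob S (D1.co d i)) (\<lambda>i. mfrob E (k (e i)))"
      using c kc[OF T_lin[OF k]] by (intro E.lincomb_cong)
        (auto simp: T_def D2.lin_ext_basis[OF Em T_basis_closed[OF k]])
    also have "\<dots> = mfrob E (k (lincomb D I (D1.co d) e))"
      using D1.coord_Pi[OF d] D1.e_Pi kc[OF k]
      by (subst k.hom_lincomb) (auto simp: E.mfrob_lincomb)
    finally show ?thesis using D1.lincomb_coord[OF d] by simp
  qed
  define hs where "hs n = (T ^^ n) h" for n
  have hs_lin: "hs n \<in> linear_maps S D E" for n
    by (induction n) (auto simp: hs_def h T_lin)
  have hs_Suc: "hs (Suc n) = T (hs n)" for n by (simp add: hs_def)
  have step: "\<forall>d\<in>carrier D. hs (Suc n) d \<ominus>\<^bsub>E\<^esub> hs n d \<in> jspan E (J n)" for n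
  proof (induction n)
    case 0
    show ?case
    proof
      fix d assume d: "d \<in> carrier D"
      show "hs (Suc 0) d \<ominus>\<^bsub>E\<^esub> hs 0 d \<in> jspan E (J 0)"
      proof (rule D2.linear_congruent_on_basis[OF Em hs_lin hs_lin J_ideal _ d])
        fix i assume i: "i \<in> I"
        \<comment> \<open>On the basis \<phi>(e_i), the maps \<open>T h\<close> and \<open>h\<close>
          take the two values that the hypothesis compares.\<close>
        have "mfrob E (h (e i)) \<ominus>\<^bsub>E\<^esub> h (mfrob D (e i)) \<in> jspan E (J 0)"
          by (rule E.jspan_sym[OF J_ideal _ _ hf]) (use i kc[OF h] in auto)
        then show "hs (Suc 0) (mfrob D (e i)) \<ominus>\<^bsub>E\<^esub> hs 0 (mfrob D (e i)) \<in> jspan E (J 0)"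
          using i T_frob[OF h] by (simp add: hs_def)
      qed
    qed
  next
    case (Suc n)
    show ?case
    proof
      fix d assume d: "d \<in> carrier D"
      show "hs (Suc (Suc n)) d \<ominus>\<^bsub>E\<^esub> hs (Suc n) d \<in> jspan E (J (Suc n))"
      proof (rule D2.linear_congruent_on_basis[OF Em hs_lin hs_lin J_ideal _ d])
        fix i assume i: "i \<in> I"
        have "mfrob E (hs (Suc n) (e i)) \<ominus>\<^bsub>E\<^esub> mfrob E (hs n (e i)) \<in> jspan E (J (Suc n))"
          using i kc[OF hs_lin] Suc by (intro jspan_mfrob_diff[OF Es]) auto
        then show "hs (Suc (Suc n)) (mfrob D (e i)) \<ominus>\<^bsub>E\<^esub> hs (Suc n) (mfrob D (e i)) \<in> jspan E (J (Suc n))"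
          using i T_frob[OF hs_lin, of "e i" n] T_frob[OF hs_lin, of "e i" "Suc n"]
          by (simp add: hs_Suc[of n] hs_Suc[of "Suc n"])
      qed
    qed
  qed
  have "\<exists>l\<in>carrier E. \<forall>n. l \<ominus>\<^bsub>E\<^esub> hs n (e i) \<in> jspan E (J n)" if "i \<in> I" for i
    using that step kc[OF hs_lin] by (intro jspan_complete[OF EB.based_module_axioms]) auto
  then obtain v where v: "\<And>i. i \<in> I \<Longrightarrow> v i \<in> carrier E"
    "\<And>i n. i \<in> I \<Longrightarrow> v i \<ominus>\<^bsub>E\<^esub> hs n (e i) \<in> jspan E (J n)" by metis
  have vP: "v \<in> I \<rightarrow> carrier E" using v by auto
  define f where "f = D1.lin_ext E v"
  have f_lin: "f \<in> linear_maps S D E" unfolding f_def by (rule D1.lin_ext_linear[OF Em vP])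
  have f_hs: "f d \<ominus>\<^bsub>E\<^esub> hs n d \<in> jspan E (J n)" if d: "d \<in> carrier D" for d n
    by (rule D1.linear_congruent_on_basis[OF Em f_lin hs_lin J_ideal _ d])
      (use v in \<open>simp add: f_def D1.lin_ext_basis[OF Em vP]\<close>)
  \<comment> \<open>Both sides are compared, for every n, with \<phi>(h_n(d)) =
    h_{n+1}(\<phi>(d)).\<close>
  have f_frob: "f (mfrob D d) = mfrob E (f d)" if d: "d \<in> carrier D" for d
  proof (rule jspan_separated[OF EB.based_module_axioms])
    fix n
    have fd: "f d \<in> carrier E" "f (mfrob D d) \<in> carrier E" "hs n d \<in> carrier E"
      using kc[OF f_lin] kc[OF hs_lin] d by auto
    have "f (mfrob D d) \<ominus>\<^bsub>E\<^esub> hs (Suc n) (mfrob D d) \<in> jspan E (J (Suc n))"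
      using d by (intro f_hs) auto
    then have 1: "f (mfrob D d) \<ominus>\<^bsub>E\<^esub> mfrob E (hs n d) \<in> jspan E (J (Suc n))"
      using T_frob[OF hs_lin d, of n] by (simp add: hs_Suc)
    have 2: "mfrob E (hs n d) \<ominus>\<^bsub>E\<^esub> mfrob E (f d) \<in> jspan E (J (Suc n))"
      by (rule jspan_mfrob_diff[OF Es _ _ E.jspan_sym[OF J_ideal _ _ f_hs[OF d]]]) (use fd in auto)
    have "f (mfrob D d) \<ominus>\<^bsub>E\<^esub> mfrob E (f d) \<in> jspan E (J (Suc n))"
      by (rule E.jspan_trans[OF J_ideal _ _ _ 1 2]) (use fd d in auto)
    then show "f (mfrob D d) \<ominus>\<^bsub>E\<^esub> mfrob E (f d) \<in> jspan E (J n)"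
      using J_Suc by (rule E.jspan_mono)
  qed (use kc[OF f_lin] d in auto)
  show thesis
  proof (rule that)
    show "f \<in> phi_hom S D E" using f_lin f_frob by (auto simp: phi_hom_def)
    show "f d \<ominus>\<^bsub>E\<^esub> h d \<in> jspan E (J 0)" if "d \<in> carrier D" for d
      using f_hs[OF that, of 0] by (simp add: hs_def)
  qed
qed

text \<open>The inverse k of h commutes with \<phi> modulo J_0 as well, hence lifts too. Both
  composites of the two lifts are congruent to the identity modulo J_0, so they equal it by
  \<open>phi_hom_unique\<close>.\<close>

theorem phi_iso_lift:
  assumes D: "phi_module S D" and E: "phi_module S E" and h: "h \<in> linear_maps S D E"
    and b: "bij_betw h (carrier D) (carrier E)"
    and hf: "\<And>d. d \<in> carrier D \<Longrightarrow> h (mfrob D d) \<ominus>\<^bsub>E\<^esub> mfrob E (h d) \<in> jspan E (J 0)"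
  obtains f where "f \<in> phi_iso S D E" "\<And>d. d \<in> carrier D \<Longrightarrow> f d \<ominus>\<^bsub>E\<^esub> h d \<in> jspan E (J 0)"
proof -
  interpret D: semilinear_module S D by (rule phi_module_semilinear[OF D])
  interpret E: semilinear_module S E by (rule phi_module_semilinear[OF E])
  interpret h: linear_map S D E h by unfold_locales (rule h)
  obtain f where f: "f \<in> phi_hom S D E" "\<And>d. d \<in> carrier D \<Longrightarrow> f d \<ominus>\<^bsub>E\<^esub> h d \<in> jspan E (J 0)"
    using phi_hom_lift[OF D E h hf] by blast
  obtain k where k: "k \<in> linear_maps S E D" and hk: "\<And>y. y \<in> carrier E \<Longrightarrow> h (k y) = y"
    and kh: "\<And>x. x \<in> carrier D \<Longrightarrow> k (h x) = x"
    using h.linear_inverse[OF b] by blast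
  have kc: "k y \<in> carrier D" if "y \<in> carrier E" for y
    using k that by (auto simp: linear_maps_def)
  interpret k: linear_map S E D k by unfold_locales (rule k)
  have kf: "k (mfrob E y) \<ominus>\<^bsub>D\<^esub> mfrob D (k y) \<in> jspan D (J 0)" if y: "y \<in> carrier E" for y
  proof (rule D.jspan_sym[OF J_ideal])
    \<comment> \<open>This is \<open>hf\<close> at the vector \<open>k y\<close>, carried back by
      the linear map \<open>k\<close>.\<close>
    have "k (h (mfrob D (k y))) \<ominus>\<^bsub>D\<^esub> k (mfrob E (h (k y))) \<in> jspan D (J 0)"
      by (rule k.jspan_image_diff[OF J_ideal _ _ hf]) (use y kc[OF y] in auto)
    then show "mfrob D (k y) \<ominus>\<^bsub>D\<^esub> k (mfrob E y) \<in> jspan D (J 0)"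
      using y kc[OF y] by (simp add: kh hk)
  qed (use y kc[OF y] in auto)
  obtain g where g: "g \<in> phi_hom S E D" "\<And>y. y \<in> carrier E \<Longrightarrow> g y \<ominus>\<^bsub>D\<^esub> k y \<in> jspan D (J 0)"
    using phi_hom_lift[OF E D k kf] by blast
  have fc: "f d \<in> carrier E" if "d \<in> carrier D" for d
    using f that by (auto simp: phi_hom_def linear_maps_def)
  have gc: "g d \<in> carrier D" if "d \<in> carrier E" for d
    using g that by (auto simp: phi_hom_def linear_maps_def)
  have mf: "mfrob D \<in> carrier D \<rightarrow> carrier D" "mfrob E \<in> carrier E \<rightarrow> carrier E" by auto
  have "compose (carrier D) g f = (\<lambda>d\<in>carrier D. d)"
  proof (rule phi_hom_unique[OF D D])
    fix d assume d: "d \<in> carrier D"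
    have "g (f d) \<ominus>\<^bsub>D\<^esub> k (h d) \<in> jspan D (J 0)"
      by (rule D.jspan_trans[OF J_ideal _ _ _ g(2)[OF fc[OF d]]
            k.jspan_image_diff[OF J_ideal fc[OF d] _ f(2)[OF d]]])
        (use fc[OF d] gc[OF fc[OF d]] d in auto)
    then show "compose (carrier D) g f d \<ominus>\<^bsub>D\<^esub> (\<lambda>d\<in>carrier D. d) d \<in> jspan D (J 0)"
      using d by (simp add: compose_eq kh)
  qed (rule phi_hom_compose[OF D.left_module_axioms mf(1) f(1) g(1)] phi_hom_id[OF D.left_module_axioms mf(1)])+
  moreover have "compose (carrier E) f g = (\<lambda>d\<in>carrier E. d)"
  proof (rule phi_hom_unique[OF E E])
    fix d assume d: "d \<in> carrier E"
    have "f (g d) \<ominus>\<^bsub>E\<^esub> h (k d) \<in> jspan E (J 0)"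
      by (rule E.jspan_trans[OF J_ideal _ _ _ f(2)[OF gc[OF d]]
            h.jspan_image_diff[OF J_ideal gc[OF d] _ g(2)[OF d]]])
        (use gc[OF d] fc[OF gc[OF d]] d in auto)
    then show "compose (carrier E) f g d \<ominus>\<^bsub>E\<^esub> (\<lambda>d\<in>carrier E. d) d \<in> jspan E (J 0)"
      using d by (simp add: compose_eq hk)
  qed (rule phi_hom_compose[OF E.left_module_axioms mf(2) g(1) f(1)] phi_hom_id[OF E.left_module_axioms mf(2)])+
  ultimately have "f \<in> phi_iso S D E" using f g by (auto simp: phi_iso_def)
  then show thesis using that f by blast
qed

end

section \<open>The unit D \<rightarrow> S \<otimes>_R (R \<otimes>_S D)\<close>

locale filtered_retraction = frob_retraction R S \<iota> \<rho> + filtered_frob_ring S J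
  for R :: "('r, 'x) frob_ring_scheme" and S :: "('s, 'y) frob_ring_scheme" and \<iota> :: "'r \<Rightarrow> 's"
    and \<rho> :: "'s \<Rightarrow> 'r" and J :: "nat \<Rightarrow> 's set" +
  assumes J_0: "J 0 = {s \<in> carrier S. \<rho> s = \<zero>\<^bsub>R\<^esub>}"
begin

abbreviation "MD \<equiv> \<lambda>D. i.BC (l.BC D)"

abbreviation "MD_map \<equiv> \<lambda>D E g.
  base_change_map R S \<iota> (l.BC D) (l.BC E) (base_change_map S R \<rho> D E g)"

text \<open>\<open>d \<mapsto> 1 \<otimes> (1 \<otimes> d)\<close> is additive and commutes with \<open>\<phi>\<close>, but is \<open>S\<close>-linear only modulo \<open>J\<^sub>0\<close>.\<close>

definition unit0 where
  "unit0 D d = tens R S \<iota> (l.BC D) \<one>\<^bsub>S\<^esub> (tens S R \<rho> D \<one>\<^bsub>R\<^esub> d)"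

text \<open>Moving s out through both tensor signs turns it into \<iota>(\<rho>(s)), and
  \<iota>(\<rho>(s)) - s is killed by \<rho>, so it lies in J_0.\<close>

lemma
  assumes D: "semilinear_module S D"
  shows unit0_hom: "abelian_group_hom D (MD D) (unit0 D)"
    and unit0_frob: "d \<in> carrier D \<Longrightarrow> unit0 D (mfrob D d) = mfrob (MD D) (unit0 D d)"
    and unit0_smult: "s \<in> carrier S \<Longrightarrow> d \<in> carrier D \<Longrightarrow>
      unit0 D (s \<odot>\<^bsub>D\<^esub> d) \<ominus>\<^bsub>MD D\<^esub> s \<odot>\<^bsub>MD D\<^esub> unit0 D d \<in> jspan (MD D) (J 0)"
    and unit0_basis: "indexed_basis S D I e \<Longrightarrow> indexed_basis S (MD D) I (\<lambda>i. unit0 D (e i))"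
proof -
  interpret D: semilinear_module S D by fact
  interpret LD: semilinear_module R "l.BC D" by (rule l.BC_semilinear[OF D])
  interpret MD: semilinear_module S "MD D" by (rule i.BC_semilinear[OF LD.semilinear_module_axioms])
  interpret T1: tensor_setting S R \<rho> D by (rule l.setting[OF D.left_module_axioms])
  interpret T2: tensor_setting R S \<iota> "l.BC D" by (rule i.setting[OF LD.left_module_axioms])
  have "abelian_group_hom (l.BC D) T2.T (T2.tn \<one>\<^bsub>S\<^esub>)" by (rule T2.tens_hom_r) simp
  then have "abelian_group_hom T1.T T2.T (T2.tn \<one>\<^bsub>S\<^esub>)" by (simp only: l.BC_hom_left_iff)
  then have "abelian_group_hom D T2.T (\<lambda>d. T2.tn \<one>\<^bsub>S\<^esub> (T1.tn \<one>\<^bsub>R\<^esub> d))"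
    by (rule abelian_group_hom_comp[OF T1.tens_hom_r[OF i.A.one_closed]])
  then show h: "abelian_group_hom D (MD D) (unit0 D)"
    unfolding i.BC_hom_right_iff by (rule abelian_group_hom_cong) (simp add: unit0_def)
  show "unit0 D (mfrob D d) = mfrob (MD D) (unit0 D d)" if "d \<in> carrier D"
    using that ring_hom_one[OF i.B.frob_hom] ring_hom_one[OF i.A.frob_hom]
    by (simp add: unit0_def i.mfrob_BC_tens[OF LD.semilinear_module_axioms] l.mfrob_BC_tens[OF D])
  show "unit0 D (s \<odot>\<^bsub>D\<^esub> d) \<ominus>\<^bsub>MD D\<^esub> s \<odot>\<^bsub>MD D\<^esub> unit0 D d \<in> jspan (MD D) (J 0)"
    if s: "s \<in> carrier S" and d: "d \<in> carrier D"
  proof -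
    have u: "unit0 D d \<in> carrier (MD D)" using d by (simp add: unit0_def)
    have "T1.tn \<one>\<^bsub>R\<^esub> (s \<odot>\<^bsub>D\<^esub> d) = \<rho> s \<odot>\<^bsub>T1.T\<^esub> T1.tn \<one>\<^bsub>R\<^esub> d"
      using s d by (simp add: T1.tens_smult)
    moreover have "T2.tn \<one>\<^bsub>S\<^esub> (\<rho> s \<odot>\<^bsub>l.BC D\<^esub> T1.tn \<one>\<^bsub>R\<^esub> d) = \<iota> (\<rho> s) \<odot>\<^bsub>T2.T\<^esub> T2.tn \<one>\<^bsub>S\<^esub> (T1.tn \<one>\<^bsub>R\<^esub> d)"
      using s d by (subst T2.tens_smult) auto
    ultimately have "unit0 D (s \<odot>\<^bsub>D\<^esub> d) = \<iota> (\<rho> s) \<odot>\<^bsub>MD D\<^esub> unit0 D d"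
      by (simp add: unit0_def)
    then have "unit0 D (s \<odot>\<^bsub>D\<^esub> d) \<ominus>\<^bsub>MD D\<^esub> s \<odot>\<^bsub>MD D\<^esub> unit0 D d =
        (\<iota> (\<rho> s) \<ominus>\<^bsub>S\<^esub> s) \<odot>\<^bsub>MD D\<^esub> unit0 D d"
      using s u by (simp only: a_minus_def MD.smult_l_distr MD.smult_minus_l \<iota>_closed \<rho>_closed i.B.a_inv_closed)
    moreover have "\<iota> (\<rho> s) \<ominus>\<^bsub>S\<^esub> s \<in> J 0"
    proof -
      interpret r: abelian_group_hom S R \<rho>
        by (rule abelian_group_hom_addI)
          (use l.f_hom in \<open>auto simp: ring_hom_def i.B.abelian_group_axioms i.A.abelian_group_axioms\<close>)
      show ?thesis using s by (simp add: J_0 retraction a_minus_def i.A.r_neg)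
    qed
    ultimately show ?thesis using jspan_gen[OF _ u] by simp
  qed
  show "indexed_basis S (MD D) I (\<lambda>i. unit0 D (e i))" if e: "indexed_basis S D I e"
  proof -
    have "indexed_basis R (l.BC D) I (\<lambda>i. T1.tn \<one>\<^bsub>R\<^esub> (e i))"
      unfolding l.BC_basis_iff by (rule T1.tensor_basis[OF e])
    from T2.tensor_basis[OF this] show ?thesis by (simp only: i.BC_basis_iff unit0_def)
  qed
qed

text \<open>The linear map h with the values of \<open>unit0\<close> on a basis is congruent to
  \<open>unit0\<close> modulo J_0. Since \<open>unit0\<close> commutes with \<phi>, h does so modulo
  J_0; and h is bijective because it carries a basis to a basis. So \<open>phi_iso_lift\<close>
  applies to h.\<close>

lemma phi_iso_near_unit0:
  fixes D :: "('s, 'd) frob_module"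
  assumes "phi_module S D"
  obtains f where "f \<in> phi_iso S D (MD D)"
    "\<And>d. d \<in> carrier D \<Longrightarrow> f d \<ominus>\<^bsub>MD D\<^esub> unit0 D d \<in> jspan (MD D) (J 0)"
proof -
  interpret D: semilinear_module S D by (rule i.B.phi_module_semilinear[OF assms])
  note s = D.semilinear_module_axioms
  have mp: "phi_module S (MD D)" by (rule i.BC_phi_module[OF l.BC_phi_module[OF assms]])
  interpret MD: semilinear_module S "MD D" by (rule i.B.phi_module_semilinear[OF mp])
  note u = unit0_hom[OF s] unit0_frob[OF s] unit0_smult[OF s]
  interpret u: abelian_group_hom D "MD D" "unit0 D" by (rule u)
  obtain I :: "'d set" and e where e: "indexed_basis S D I e" and "indexed_basis S D I (\<lambda>i. mfrob D (e i))"
    by (rule i.B.phi_module_bases[OF assms])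
  interpret D1: based_module S D I e by unfold_locales (rule e)
  have uP: "(\<lambda>i. unit0 D (e i)) \<in> I \<rightarrow> carrier (MD D)"
    by (rule funcsetI) (rule u.hom_closed, simp)
  define h where "h = D1.lin_ext (MD D) (\<lambda>i. unit0 D (e i))"
  have h: "h \<in> linear_maps S D (MD D)"
    unfolding h_def by (rule D1.lin_ext_linear[OF MD.left_module_axioms uP])
  interpret h: linear_map S D "MD D" h by unfold_locales (rule h)
  have he: "h (e i) = unit0 D (e i)" if "i \<in> I" for i
    unfolding h_def by (rule D1.lin_ext_basis[OF MD.left_module_axioms uP that])
  have hu: "h d \<ominus>\<^bsub>MD D\<^esub> unit0 D d \<in> jspan (MD D) (J 0)" if d: "d \<in> carrier D" for d
  proof -
    have c: "D1.co d i \<in> carrier S" if "i \<in> I" for i using d that by simp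
    have "unit0 D (lincomb D I (D1.co d) e) = finsum (MD D) (\<lambda>i. unit0 D (D1.co d i \<odot>\<^bsub>D\<^esub> e i)) I"
      unfolding lincomb_def using c by (intro u.hom_finsum_additive) (auto simp: D.smult_closed)
    then have 1: "unit0 D d = finsum (MD D) (\<lambda>i. unit0 D (D1.co d i \<odot>\<^bsub>D\<^esub> e i)) I"
      by (simp only: D1.lincomb_coord[OF d])
    have 2: "h d = finsum (MD D) (\<lambda>i. D1.co d i \<odot>\<^bsub>MD D\<^esub> unit0 D (e i)) I"
      using d by (simp add: h_def D1.lin_ext_def lincomb_def)
    have "unit0 D d \<ominus>\<^bsub>MD D\<^esub> h d \<in> jspan (MD D) (J 0)"
      unfolding 1 2
    proof (rule MD.jspan_finsum_diff[OF J_ideal])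
      show "(\<lambda>i. unit0 D (D1.co d i \<odot>\<^bsub>D\<^esub> e i)) \<in> I \<rightarrow> carrier (MD D)"
        by (rule funcsetI) (rule u.hom_closed, simp add: c D.smult_closed)
      show "(\<lambda>i. D1.co d i \<odot>\<^bsub>MD D\<^esub> unit0 D (e i)) \<in> I \<rightarrow> carrier (MD D)"
        by (rule funcsetI) (rule MD.smult_closed, simp add: c, rule u.hom_closed, simp)
    qed (rule u(3)[OF c D1.e_closed])
    from MD.jspan_sym[OF J_ideal u.hom_closed[OF d] h.hom_closed[OF d] this] show ?thesis .
  qed
  have "indexed_basis S (MD D) I (\<lambda>i. h (e i))"
    by (rule MD.indexed_basis_cong[OF _ unit0_basis[OF s e]]) (simp add: he)
  then have b: "bij_betw h (carrier D) (carrier (MD D))"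
    by (simp only: D1.bij_iff_basis[OF MD.left_module_axioms h])
  have hf: "h (mfrob D d) \<ominus>\<^bsub>MD D\<^esub> mfrob (MD D) (h d) \<in> jspan (MD D) (J 0)" if d: "d \<in> carrier D" for d
  proof -
    have c: "h d \<in> carrier (MD D)" "unit0 D d \<in> carrier (MD D)" "h (mfrob D d) \<in> carrier (MD D)"
      by (rule h.hom_closed[OF d], rule u.hom_closed[OF d], rule h.hom_closed[OF D.mfrob.hom_closed[OF d]])
    have 1: "mfrob (MD D) (unit0 D d) \<ominus>\<^bsub>MD D\<^esub> mfrob (MD D) (h d) \<in> jspan (MD D) (J 0)"
      by (rule MD.jspan_mono[OF jspan_mfrob_diff[OF MD.semilinear_module_axioms c(2,1)
              MD.jspan_sym[OF J_ideal c(1,2) hu[OF d]]] J_Suc])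
    have 2: "h (mfrob D d) \<ominus>\<^bsub>MD D\<^esub> mfrob (MD D) (unit0 D d) \<in> jspan (MD D) (J 0)"
      using hu[OF D.mfrob.hom_closed[OF d]] by (simp only: u(2)[OF d])
    show ?thesis
      by (rule MD.jspan_trans[OF J_ideal c(3) MD.mfrob.hom_closed[OF c(2)] MD.mfrob.hom_closed[OF c(1)] 2 1])
  qed
  obtain f where f: "f \<in> phi_iso S D (MD D)"
    "\<And>d. d \<in> carrier D \<Longrightarrow> f d \<ominus>\<^bsub>MD D\<^esub> h d \<in> jspan (MD D) (J 0)"
    using phi_iso_lift[OF assms mp h b hf] by blast
  have "f d \<ominus>\<^bsub>MD D\<^esub> unit0 D d \<in> jspan (MD D) (J 0)" if d: "d \<in> carrier D" for d
  proof (rule MD.jspan_trans[OF J_ideal _ h.hom_closed[OF d] u.hom_closed[OF d] f(2)[OF d] hu[OF d]])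
    show "f d \<in> carrier (MD D)"
      using f(1) d unfolding phi_iso_def phi_hom_def linear_maps_def by blast
  qed
  then show thesis using that f by blast
qed

text \<open>For a \<phi>-module D the choice is forced: by \<open>phi_hom_unique\<close> at most one
  morphism is congruent to \<open>unit0\<close> modulo J_0.\<close>

definition unit where
  "unit D = (SOME f. f \<in> phi_iso S D (MD D) \<and>
     (\<forall>d\<in>carrier D. f d \<ominus>\<^bsub>MD D\<^esub> unit0 D d \<in> jspan (MD D) (J 0)))"

lemma unit_props:
  fixes D :: "('s, 'd) frob_module"
  assumes "phi_module S D"
  shows unit_iso: "unit D \<in> phi_iso S D (MD D)"
    and unit_near: "d \<in> carrier D \<Longrightarrow> unit D d \<ominus>\<^bsub>MD D\<^esub> unit0 D d \<in> jspan (MD D) (J 0)"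
proof -
  have "\<exists>f. f \<in> phi_iso S D (MD D) \<and> (\<forall>d\<in>carrier D. f d \<ominus>\<^bsub>MD D\<^esub> unit0 D d \<in> jspan (MD D) (J 0))"
    using phi_iso_near_unit0[OF assms] by metis
  then have "unit D \<in> phi_iso S D (MD D) \<and>
      (\<forall>d\<in>carrier D. unit D d \<ominus>\<^bsub>MD D\<^esub> unit0 D d \<in> jspan (MD D) (J 0))"
    unfolding unit_def by (rule someI_ex)
  then show "unit D \<in> phi_iso S D (MD D)"
    and "d \<in> carrier D \<Longrightarrow> unit D d \<ominus>\<^bsub>MD D\<^esub> unit0 D d \<in> jspan (MD D) (J 0)" by auto
qed

text \<open>\<open>unit0\<close> is natural without any error term, so both ways around the square
  are morphisms congruent to \<open>unit0 E\<close> after g modulo J_0, and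
  \<open>phi_hom_unique\<close> makes them equal.\<close>

lemma unit_natural_iso:
  "phi_natural_iso S S (\<lambda>D :: ('s, 'd) frob_module. D) (\<lambda>D E g. g) MD MD_map unit"
  unfolding phi_natural_iso_def
proof (intro conjI allI impI)
  fix D :: "('s, 'd) frob_module" assume "phi_module S D"
  then show "unit D \<in> phi_iso S D (MD D)" by (rule unit_iso)
next
  fix D E :: "('s, 'd) frob_module" and g
  assume *: "phi_module S D \<and> phi_module S E \<and> g \<in> phi_hom S D E"
  then have D: "phi_module S D" and E: "phi_module S E" and g: "g \<in> phi_hom S D E" by auto
  interpret D: semilinear_module S D by (rule i.B.phi_module_semilinear[OF D])
  interpret E: semilinear_module S E by (rule i.B.phi_module_semilinear[OF E])
  note sD = D.semilinear_module_axioms and sE = E.semilinear_module_axioms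
  have g_lin: "g \<in> linear_maps S D E" using g by (simp add: phi_hom_def)
  interpret g: linear_map S D E g by unfold_locales (rule g_lin)
  have ME: "phi_module S (MD E)" by (rule i.BC_phi_module[OF l.BC_phi_module[OF E]])
  interpret ME: semilinear_module S "MD E" by (rule i.B.phi_module_semilinear[OF ME])
  have MD: "phi_module S (MD D)" by (rule i.BC_phi_module[OF l.BC_phi_module[OF D]])
  interpret MD: semilinear_module S "MD D" by (rule i.B.phi_module_semilinear[OF MD])
  note sLD = l.BC_semilinear[OF sD] and sLE = l.BC_semilinear[OF sE]
  let ?l = "base_change_map S R \<rho> D E g"
  let ?G = "MD_map D E g"
  have l: "?l \<in> phi_hom R (l.BC D) (l.BC E)" by (rule l.base_change_map_phi_hom[OF sD sE g])
  have l_lin: "?l \<in> linear_maps R (l.BC D) (l.BC E)" using l by (simp add: phi_hom_def)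
  have G: "?G \<in> phi_hom S (MD D) (MD E)" by (rule i.base_change_map_phi_hom[OF sLD sLE l])
  have G_lin: "?G \<in> linear_maps S (MD D) (MD E)" using G by (simp add: phi_hom_def)
  interpret G: linear_map S "MD D" "MD E" ?G by unfold_locales (rule G_lin)
  have G_unit0: "?G (unit0 D d) = unit0 E (g d)" if d: "d \<in> carrier D" for d
  proof -
    have t: "tens S R \<rho> D \<one>\<^bsub>R\<^esub> d \<in> carrier (l.BC D)"
      using tensor_setting.tens_closed[OF l.setting[OF D.left_module_axioms] _ d] by simp
    have "?G (unit0 D d) = tens R S \<iota> (l.BC E) \<one>\<^bsub>S\<^esub> (?l (tens S R \<rho> D \<one>\<^bsub>R\<^esub> d))"
      unfolding unit0_def
      by (rule i.base_change_map_tens[OF semilinear_module.axioms(1)[OF sLD] semilinear_module.axioms(1)[OF sLE] l_lin _ t])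
        simp
    also have "?l (tens S R \<rho> D \<one>\<^bsub>R\<^esub> d) = tens S R \<rho> E \<one>\<^bsub>R\<^esub> (g d)"
      by (rule l.base_change_map_tens[OF D.left_module_axioms E.left_module_axioms g_lin _ d]) simp
    finally show ?thesis by (simp add: unit0_def)
  qed
  have uD: "unit D \<in> phi_hom S D (MD D)" and uE: "unit E \<in> phi_hom S E (MD E)"
    using unit_iso[OF D] unit_iso[OF E] by (auto simp: phi_iso_def)
  have uDc: "unit D d \<in> carrier (MD D)" if "d \<in> carrier D" for d
    using uD that unfolding phi_hom_def linear_maps_def by blast
  have uEc: "unit E d \<in> carrier (MD E)" if "d \<in> carrier E" for d
    using uE that unfolding phi_hom_def linear_maps_def by blast
  have mf: "mfrob D \<in> carrier D \<rightarrow> carrier D" by auto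
  note u0D = abelian_group_hom.hom_closed[OF unit0_hom[OF sD]]
  note u0E = abelian_group_hom.hom_closed[OF unit0_hom[OF sE]]
  show "compose (carrier D) (unit E) g = compose (carrier D) ?G (unit D)"
  proof (rule phi_hom_unique[OF D ME])
    show "compose (carrier D) (unit E) g \<in> phi_hom S D (MD E)"
      by (rule phi_hom_compose[OF D.left_module_axioms mf g uE])
    show "compose (carrier D) ?G (unit D) \<in> phi_hom S D (MD E)"
      by (rule phi_hom_compose[OF D.left_module_axioms mf uD G])
    fix d assume d: "d \<in> carrier D"
    note gd = g.hom_closed[OF d]
    have 1: "unit E (g d) \<ominus>\<^bsub>MD E\<^esub> unit0 E (g d) \<in> jspan (MD E) (J 0)" by (rule unit_near[OF E gd])
    have 2: "unit0 E (g d) \<ominus>\<^bsub>MD E\<^esub> ?G (unit D d) \<in> jspan (MD E) (J 0)"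
      unfolding G_unit0[OF d, symmetric]
      by (rule G.jspan_image_diff[OF J_ideal u0D[OF d] uDc[OF d]
            MD.jspan_sym[OF J_ideal uDc[OF d] u0D[OF d] unit_near[OF D d]]])
    have "unit E (g d) \<ominus>\<^bsub>MD E\<^esub> ?G (unit D d) \<in> jspan (MD E) (J 0)"
      by (rule ME.jspan_trans[OF J_ideal uEc[OF gd] u0E[OF gd] G.hom_closed[OF uDc[OF d]] 1 2])
    then show "compose (carrier D) (unit E) g d \<ominus>\<^bsub>MD E\<^esub> compose (carrier D) ?G (unit D) d \<in> jspan (MD E) (J 0)"
      using d by (simp only: compose_eq)
  qed
qed

theorem phi_equivalence:
  "phi_functor S R (l.BC :: ('s, 'd) frob_module \<Rightarrow> _) (base_change_map S R \<rho>) \<and>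
   phi_functor R S (i.BC :: ('r, 'e) frob_module \<Rightarrow> _) (base_change_map R S \<iota>) \<and>
   (\<exists>\<eta>. phi_natural_iso S S (\<lambda>D :: ('s, 'd) frob_module. D) (\<lambda>D E g. g) MD MD_map \<eta>) \<and>
   (\<exists>\<epsilon>. phi_natural_iso R R (\<lambda>E :: ('r, 'e) frob_module. l.BC (i.BC E))
     (\<lambda>D E g. base_change_map S R \<rho> (i.BC D) (i.BC E) (base_change_map R S \<iota> D E g))
     (\<lambda>E. E) (\<lambda>D E g. g) \<epsilon>)"
  using l.base_change_functor i.base_change_functor unit_natural_iso counit_natural_iso by blast

end

section \<open>The \<open>p\<close>-adic integers and \<open>\<phi>\<close>-rings\<close>

lemma Zp_simps [simp]:
  "x \<oplus>\<^bsub>Zp p\<^esub> y = (\<lambda>n. (x n + y n) mod int p ^ n)"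
  "x \<otimes>\<^bsub>Zp p\<^esub> y = (\<lambda>n. (x n * y n) mod int p ^ n)"
  "\<zero>\<^bsub>Zp p\<^esub> = (\<lambda>n. 0)"
  by (simp_all add: Zp_def)

lemma mod_power_Suc_mod: "(a :: int) mod int p ^ Suc n mod int p ^ n = a mod int p ^ n"
  by (rule mod_mod_cancel) simp

lemma Zp_carrier_iff:
  "x \<in> carrier (Zp p) \<longleftrightarrow> (\<forall>n. 0 \<le> x n \<and> x n < int p ^ n \<and> x (Suc n) mod int p ^ n = x n)"
  by (auto simp: Zp_def)

lemma Zp_carrierI:
  assumes "p > 0" "\<And>n. x n = a n mod int p ^ n" "\<And>n. a (Suc n) mod int p ^ n = a n mod int p ^ n"
  shows "x \<in> carrier (Zp p)"
  unfolding Zp_carrier_iff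
proof (intro allI conjI)
  fix n
  show "x (Suc n) mod int p ^ n = x n"
    unfolding assms(2) mod_power_Suc_mod by (rule assms(3))
qed (use assms(1) in \<open>simp_all add: assms(2)\<close>)

lemma Zp_abelian_group:
  assumes "p > 0" shows "abelian_group (Zp p)"
proof (rule abelian_groupI)
  fix x y assume x: "x \<in> carrier (Zp p)" and y: "y \<in> carrier (Zp p)"
  have m: "z (Suc n) mod int p ^ n = z n mod int p ^ n" if "z \<in> carrier (Zp p)" for z n
    using that by (metis Zp_carrier_iff mod_mod_trivial)
  show "x \<oplus>\<^bsub>Zp p\<^esub> y \<in> carrier (Zp p)"
    by (rule Zp_carrierI[OF assms, of _ "\<lambda>n. x n + y n"]) (simp_all add: mod_add_cong[OF m[OF x] m[OF y]])
  show "\<exists>y\<in>carrier (Zp p). y \<oplus>\<^bsub>Zp p\<^esub> x = \<zero>\<^bsub>Zp p\<^esub>"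
  proof (intro bexI[of _ "\<lambda>n. (- x n) mod int p ^ n"])
    show "(\<lambda>n. - x n mod int p ^ n) \<in> carrier (Zp p)"
      by (rule Zp_carrierI[OF assms, of _ "\<lambda>n. - x n"]) (simp_all add: mod_minus_cong[OF m[OF x]])
  qed (simp add: mod_add_left_eq)
next
  fix x y z :: "nat \<Rightarrow> int"
  show "x \<oplus>\<^bsub>Zp p\<^esub> y \<oplus>\<^bsub>Zp p\<^esub> z = x \<oplus>\<^bsub>Zp p\<^esub> (y \<oplus>\<^bsub>Zp p\<^esub> z)"
    by (simp add: mod_add_left_eq mod_add_right_eq add.assoc)
  show "x \<oplus>\<^bsub>Zp p\<^esub> y = y \<oplus>\<^bsub>Zp p\<^esub> x" by (simp add: add.commute)
  assume "x \<in> carrier (Zp p)"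
  then show "\<zero>\<^bsub>Zp p\<^esub> \<oplus>\<^bsub>Zp p\<^esub> x = x" by (auto simp: Zp_carrier_iff fun_eq_iff)
qed (use assms in \<open>simp add: Zp_carrier_iff\<close>)

lemma Zp_of_int_carrier: "p > 0 \<Longrightarrow> Zp_of_int p a \<in> carrier (Zp p)"
  by (rule Zp_carrierI[of _ _ "\<lambda>n. a"]) (auto simp: Zp_of_int_def)

lemma Zp_of_int_add: "Zp_of_int p a \<oplus>\<^bsub>Zp p\<^esub> Zp_of_int p b = Zp_of_int p (a + b)"
  by (simp add: Zp_of_int_def mod_add_eq)

lemma Zp_of_int_mult: "Zp_of_int p a \<otimes>\<^bsub>Zp p\<^esub> Zp_of_int p b = Zp_of_int p (a * b)"
  by (simp add: Zp_of_int_def mod_mult_eq)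

section \<open>Sums over indices split into digits\<close>

context abelian_monoid
begin

lemma finsum_lessThan_add:
  "f \<in> {..<m + n} \<rightarrow> carrier G \<Longrightarrow>
    finsum G f {..<m + n} = finsum G f {..<m} \<oplus> finsum G (\<lambda>j. f (m + j)) {..<n :: nat}"
proof (induction n)
  case (Suc n)
  then have c: "f \<in> {..<m + n} \<rightarrow> carrier G" "f (m + n) \<in> carrier G" "(\<lambda>j. f (m + j)) \<in> {..<n} \<rightarrow> carrier G"
    "f \<in> {..<m} \<rightarrow> carrier G"
    by (auto simp: Pi_iff)
  show ?case using Suc.IH[OF c(1)] c by (simp add: lessThan_Suc a_ac)
qed (simp add: Pi_iff)

text \<open>An index below m n is written j + m k with low digit j. With m = p this splits the
  decomposition of R of depth c + 1 into one of depth 1 and one of depth c.\<close>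

lemma finsum_lessThan_mult:
  "f \<in> {..<m * n} \<rightarrow> carrier G \<Longrightarrow>
    finsum G f {..<m * n} = finsum G (\<lambda>j. finsum G (\<lambda>k. f (j + m * k)) {..<n}) {..<m :: nat}"
proof (induction n)
  case (Suc n)
  have b: "j + m * k < m * Suc n" if "j < m" "k < Suc n" for j k
  proof -
    have "j + m * k < m * Suc k" using that by simp
    also have "\<dots> \<le> m * Suc n" using that by (intro mult_le_mono2) simp
    finally show ?thesis .
  qed
  have c: "f (j + m * k) \<in> carrier G" if "j < m" "k < Suc n" for j k
    using Suc.prems b[OF that] by (auto simp: Pi_iff)
  have c1: "f \<in> {..<m * n} \<rightarrow> carrier G" using Suc.prems by (auto simp: Pi_iff)
  have "finsum G f {..<m * Suc n} = finsum G f {..<m * n} \<oplus> finsum G (\<lambda>j. f (j + m * n)) {..<m}"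
    using finsum_lessThan_add[of f "m * n" m] Suc.prems by (simp add: add.commute)
  also have "\<dots> = finsum G (\<lambda>j. finsum G (\<lambda>k. f (j + m * k)) {..<n} \<oplus> f (j + m * n)) {..<m}"
    unfolding Suc.IH[OF c1] using c by (subst finsum_addf) auto
  also have "\<dots> = finsum G (\<lambda>j. finsum G (\<lambda>k. f (j + m * k)) {..<Suc n}) {..<m}"
    using c by (intro finsum_cong') (auto simp: lessThan_Suc a_comm)
  finally show ?case .
qed simp

end

section \<open>The decomposition of a \<phi>-ring into the summands \<chi>(i) \<phi>^c(R)\<close>

locale prime_phi_ring = phi_ring p R for p :: nat and R :: "('r, 'm) phi_ring_scheme" (structure) +
  assumes prime: "prime p"
begin

lemma p_pos: "p > 0" and p_gt_1: "p > 1"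
  using prime prime_gt_0_nat prime_gt_1_nat by auto

definition ch where "ch i = chi R (Zp_of_int p (int i))"

lemma chi_Units: "x \<in> carrier (Zp p) \<Longrightarrow> chi R x \<in> Units R"
  using chi_hom by (auto simp: hom_def units_of_carrier)

lemma ch_Units: "ch i \<in> Units R"
  unfolding ch_def by (rule chi_Units[OF Zp_of_int_carrier[OF p_pos]])

lemma ch_closed [simp]: "ch i \<in> carrier R"
  using ch_Units by (rule Units_closed)

lemma ch_add: "ch (i + j) = ch i \<otimes> ch j"
proof -
  have "chi R (Zp_of_int p (int i) \<oplus>\<^bsub>Zp p\<^esub> Zp_of_int p (int j)) = ch i \<otimes> ch j"
    using chi_hom Zp_of_int_carrier[OF p_pos] by (auto simp: hom_def units_of_mult ch_def simp del: Zp_simps)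
  then show ?thesis by (simp only: Zp_of_int_add of_nat_add ch_def)
qed

lemma ch_0 [simp]: "ch 0 = \<one>"
proof -
  have "ch 0 \<otimes> ch 0 = ch 0 \<otimes> \<one>" using ch_add[of 0 0, symmetric] by simp
  then show ?thesis using Units_l_cancel[OF ch_Units ch_closed one_closed, of 0 0] by simp
qed

text \<open>In the zero ring \<chi>(0) = \<chi>(1), while 0 and 1 differ modulo p and \<chi> is
  injective.\<close>

lemma nontrivial: "\<one> \<noteq> \<zero>"
proof
  assume 10: "\<one> = \<zero>"
  have "ch 0 = ch 1" using one_zeroD[OF 10] ch_closed by (metis singletonD)
  then have "Zp_of_int p (int 0) = Zp_of_int p (int 1)"
    using chi_inj Zp_of_int_carrier[OF p_pos] by (auto simp: inj_on_def ch_def)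
  then have "Zp_of_int p (int 0) 1 = Zp_of_int p (int 1) 1" by simp
  then show False using p_gt_1 by (simp add: Zp_of_int_def)
qed

abbreviation fr where "fr c \<equiv> frob R ^^ c"

lemma fr_hom: "fr c \<in> ring_hom R R"
proof (induction c)
  case 0 show ?case by (simp add: id_ring_hom id_def[symmetric])
next
  case (Suc c) then show ?case using ring_hom_trans[OF Suc frob_hom] by (simp add: comp_def)
qed

lemma fr_closed [simp]: "r \<in> carrier R \<Longrightarrow> fr c r \<in> carrier R"
  using fr_hom by (rule ring_hom_closed)

lemma frob_closed [simp]: "r \<in> carrier R \<Longrightarrow> frob R r \<in> carrier R"
  using frob_hom by (rule ring_hom_closed)

lemma frob_additive: "abelian_group_hom R R (frob R)"
  by (rule abelian_group_hom_addI) (auto simp: ring_hom_add[OF frob_hom] abelian_group_axioms)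

lemma frob_ch: "frob R (ch i) = ch (p * i)"
  using frob_chi[OF Zp_of_int_carrier[OF p_pos]] by (simp only: Zp_of_int_mult of_nat_mult ch_def)

lemma fr_ch: "fr c (ch i) = ch (p ^ c * i)"
  by (induction c) (simp_all add: frob_ch mult.assoc)

definition chsum where "chsum c s = (\<Oplus>i\<in>{..<p ^ c}. ch i \<otimes> fr c (s i))"

lemma chsum_closed [simp]: "s \<in> {..<p ^ c} \<rightarrow> carrier R \<Longrightarrow> chsum c s \<in> carrier R"
  unfolding chsum_def by (intro finsum_closed) (auto simp: Pi_iff)

lemma chsum_cong:
  assumes "s \<in> {..<p ^ c} \<rightarrow> carrier R" "\<And>i. i < p ^ c \<Longrightarrow> s i = s' i"
  shows "chsum c s = chsum c s'"
proof -
  have "s' \<in> {..<p ^ c} \<rightarrow> carrier R" using assms by (metis Pi_cong lessThan_iff)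
  then show ?thesis unfolding chsum_def using assms by (intro finsum_cong') (auto simp: Pi_iff)
qed

lemma digit_less: "j < p \<Longrightarrow> k < p ^ c \<Longrightarrow> j + p * k < p ^ Suc c"
proof -
  assume "j < p" "k < p ^ c"
  then have "j + p * k < p * Suc k" by simp
  also have "\<dots> \<le> p * p ^ c" using \<open>k < p ^ c\<close> by (intro mult_le_mono2) simp
  finally show ?thesis by simp
qed

text \<open>Since \<phi>(\<chi>(k)) = \<chi>(p k), one has \<chi>(j + p k) \<phi>^{c+1}(s) =
  \<chi>(j) \<phi>(\<chi>(k) \<phi>^c(s)); summing over the high part k of the index gives the inner
  sum.\<close>

lemma chsum_Suc:
  assumes "s \<in> {..<p ^ Suc c} \<rightarrow> carrier R"
  shows "chsum (Suc c) s = (\<Oplus>j\<in>{..<p}. ch j \<otimes> frob R (chsum c (\<lambda>k. s (j + p * k))))"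
proof -
  have sc: "s (j + p * k) \<in> carrier R" if "j < p" "k < p ^ c" for j k
    using assms digit_less[OF that] by (auto simp: Pi_iff)
  have "chsum (Suc c) s = (\<Oplus>j\<in>{..<p}. \<Oplus>k\<in>{..<p ^ c}. ch (j + p * k) \<otimes> fr (Suc c) (s (j + p * k)))"
    unfolding chsum_def power_Suc using assms
    by (intro finsum_lessThan_mult) (auto simp: Pi_iff)
  also have "\<dots> = (\<Oplus>j\<in>{..<p}. ch j \<otimes> frob R (chsum c (\<lambda>k. s (j + p * k))))"
  proof (intro finsum_cong' refl)
    fix j assume j: "j \<in> {..<p}"
    have "frob R (chsum c (\<lambda>k. s (j + p * k))) =
        (\<Oplus>k\<in>{..<p ^ c}. frob R (ch k \<otimes> fr c (s (j + p * k))))"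
      unfolding chsum_def using j sc
      by (intro abelian_group_hom.hom_finsum_additive[OF frob_additive]) auto
    also have "\<dots> = (\<Oplus>k\<in>{..<p ^ c}. ch (p * k) \<otimes> fr (Suc c) (s (j + p * k)))"
      using j sc by (intro finsum_cong') (auto simp: ring_hom_mult[OF frob_hom] frob_ch)
    finally have "ch j \<otimes> frob R (chsum c (\<lambda>k. s (j + p * k))) =
        (\<Oplus>k\<in>{..<p ^ c}. ch j \<otimes> (ch (p * k) \<otimes> fr (Suc c) (s (j + p * k))))"
      using j sc by (simp add: finsum_rdistr Pi_iff)
    also have "\<dots> = (\<Oplus>k\<in>{..<p ^ c}. ch (j + p * k) \<otimes> fr (Suc c) (s (j + p * k)))"
      using j sc by (intro finsum_cong') (auto simp: ch_add m_assoc)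
    finally show "(\<Oplus>k\<in>{..<p ^ c}. ch (j + p * k) \<otimes> fr (Suc c) (s (j + p * k))) =
        ch j \<otimes> frob R (chsum c (\<lambda>k. s (j + p * k)))" by simp
  qed (use sc in \<open>auto intro!: m_closed chsum_closed frob_closed\<close>)
  finally show ?thesis .
qed

lemmas direct_sum_ch = direct_sum[folded ch_def]

lemma decomposition_level_1:
  assumes "r \<in> carrier R"
  obtains t where "t \<in> {..<p} \<rightarrow> carrier R" "r = (\<Oplus>i\<in>{..<p}. ch i \<otimes> frob R (t i))"
proof -
  obtain x where x: "x \<in> (\<Pi>\<^sub>E i\<in>{..<p}. (\<lambda>s. ch i \<otimes> frob R s) ` carrier R)" "r = (\<Oplus>i\<in>{..<p}. x i)"
    using direct_sum_ch[OF assms] by blast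
  then have "\<forall>i\<in>{..<p}. \<exists>s\<in>carrier R. x i = ch i \<otimes> frob R s" by (auto simp: PiE_iff)
  then obtain t where t: "\<And>i. i \<in> {..<p} \<Longrightarrow> t i \<in> carrier R" "\<And>i. i \<in> {..<p} \<Longrightarrow> x i = ch i \<otimes> frob R (t i)"
    by metis
  have "r = (\<Oplus>i\<in>{..<p}. ch i \<otimes> frob R (t i))"
    unfolding x(2) using t by (intro finsum_cong') auto
  then show thesis using t that by auto
qed

text \<open>The direct sum determines the summands; cancelling the unit \<chi>(i) and using
  injectivity of \<phi> recovers the coefficients.\<close>

lemma decomposition_level_1_unique:
  assumes t: "t \<in> {..<p} \<rightarrow> carrier R" and u: "u \<in> {..<p} \<rightarrow> carrier R"
    and eq: "(\<Oplus>i\<in>{..<p}. ch i \<otimes> frob R (t i)) = (\<Oplus>i\<in>{..<p}. ch i \<otimes> frob R (u i))" and i: "i < p"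
  shows "t i = u i"
proof -
  let ?x = "\<lambda>t. \<lambda>i\<in>{..<p}. ch i \<otimes> frob R (t i)"
  let ?r = "\<Oplus>i\<in>{..<p}. ch i \<otimes> frob R (t i)"
  have 1: "?x v \<in> (\<Pi>\<^sub>E i\<in>{..<p}. (\<lambda>s. ch i \<otimes> frob R s) ` carrier R) \<and> ?r = (\<Oplus>i\<in>{..<p}. ?x v i)"
    if "v = t \<or> v = u" for v
  proof -
    have v: "v \<in> {..<p} \<rightarrow> carrier R" using that t u by auto
    have "(\<Oplus>i\<in>{..<p}. ?x v i) = (\<Oplus>i\<in>{..<p}. ch i \<otimes> frob R (v i))"
      using v by (intro finsum_cong') (auto simp: Pi_iff)
    then have "?r = (\<Oplus>i\<in>{..<p}. ?x v i)" using that eq by auto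
    then show ?thesis using v by (auto simp: Pi_iff)
  qed
  have "?r \<in> carrier R" using t by (intro finsum_closed) (auto simp: Pi_iff)
  from direct_sum_ch[OF this] have "?x t = ?x u" using 1[of t] 1[of u] by blast
  then have "?x t i = ?x u i" by simp
  then have "ch i \<otimes> frob R (t i) = ch i \<otimes> frob R (u i)" using i by simp
  then have "frob R (t i) = frob R (u i)"
    using t u i Units_l_cancel[OF ch_Units, of "frob R (t i)" "frob R (u i)"] by (auto simp: Pi_iff)
  then show ?thesis using t u i frob_inj by (auto simp: inj_on_def Pi_iff)
qed

lemma decomposition:
  "r \<in> carrier R \<Longrightarrow> \<exists>s\<in>{..<p ^ c} \<rightarrow> carrier R. r = chsum c s"
proof (induction c arbitrary: r)
  case 0
  then show ?case by (intro bexI[of _ "\<lambda>_. r"]) (auto simp: chsum_def lessThan_Suc)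
next
  case (Suc c)
  obtain t where t: "t \<in> {..<p} \<rightarrow> carrier R" "r = (\<Oplus>i\<in>{..<p}. ch i \<otimes> frob R (t i))"
    by (rule decomposition_level_1[OF Suc.prems])
  have "\<exists>s\<in>{..<p ^ c} \<rightarrow> carrier R. t j = chsum c s" if "j \<in> {..<p}" for j
    using t that by (intro Suc.IH) auto
  then obtain u where u: "\<And>j. j \<in> {..<p} \<Longrightarrow> u j \<in> {..<p ^ c} \<rightarrow> carrier R"
    "\<And>j. j \<in> {..<p} \<Longrightarrow> t j = chsum c (u j)" by metis
  \<comment> \<open>The low digit of the index selects a summand of depth 1, the remaining digits a
    coefficient inside it.\<close>
  define s where "s i = u (i mod p) (i div p)" for i
  have s: "s \<in> {..<p ^ Suc c} \<rightarrow> carrier R"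
  proof (rule Pi_I)
    fix i assume "i \<in> {..<p ^ Suc c}"
    then have "i mod p \<in> {..<p}" "i div p \<in> {..<p ^ c}"
      using p_pos by (auto simp: less_mult_imp_div_less mult.commute)
    then show "s i \<in> carrier R" using u(1)[of "i mod p"] by (auto simp: s_def)
  qed
  have "chsum (Suc c) s = (\<Oplus>j\<in>{..<p}. ch j \<otimes> frob R (chsum c (u j)))"
    unfolding chsum_Suc[OF s]
  proof (intro finsum_cong' refl)
    fix j assume j: "j \<in> {..<p}"
    have "(\<lambda>k. s (j + p * k)) = u j" using j by (auto simp: s_def fun_eq_iff)
    then show "ch j \<otimes> frob R (chsum c (\<lambda>k. s (j + p * k))) = ch j \<otimes> frob R (chsum c (u j))" by simp
  qed (use u in auto)
  also have "\<dots> = r"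
    unfolding t(2) using u t by (intro finsum_cong') (auto simp: Pi_iff)
  finally show ?case using s by blast
qed

lemma decomposition_unique:
  "s \<in> {..<p ^ c} \<rightarrow> carrier R \<Longrightarrow> s' \<in> {..<p ^ c} \<rightarrow> carrier R \<Longrightarrow> chsum c s = chsum c s' \<Longrightarrow>
    i < p ^ c \<Longrightarrow> s i = s' i"
proof (induction c arbitrary: s s' i)
  case 0
  then show ?case by (auto simp: chsum_def lessThan_Suc)
next
  case (Suc c)
  have c: "(\<lambda>k. v (j + p * k)) \<in> {..<p ^ c} \<rightarrow> carrier R" if "v = s \<or> v = s'" "j < p" for v j
    using that Suc.prems(1,2) digit_less[OF that(2)] by (auto simp: Pi_iff)
  have im: "i mod p < p" "i div p < p ^ c"
    using p_pos Suc.prems(4) by (auto simp: less_mult_imp_div_less mult.commute)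
  have "chsum c (\<lambda>k. s (i mod p + p * k)) = chsum c (\<lambda>k. s' (i mod p + p * k))"
    by (rule decomposition_level_1_unique[of "\<lambda>j. chsum c (\<lambda>k. s (j + p * k))" "\<lambda>j. chsum c (\<lambda>k. s' (j + p * k))"])
      (use Suc.prems im c in \<open>auto simp: chsum_Suc[symmetric]\<close>)
  then have "s (i mod p + p * (i div p)) = s' (i mod p + p * (i div p))"
    using Suc.IH[OF c c] im by blast
  then show ?case by simp
qed

lemma
  assumes "r \<in> carrier R"
  shows coords_PiE: "coords p R c r \<in> {..<p ^ c} \<rightarrow>\<^sub>E carrier R"
    and chsum_coords: "chsum c (coords p R c r) = r"
proof -
  let ?P = "\<lambda>s. s \<in> {..<p ^ c} \<rightarrow>\<^sub>E carrier R \<and> r = chsum c s"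
  obtain s where s: "s \<in> {..<p ^ c} \<rightarrow> carrier R" "r = chsum c s" using decomposition[OF assms] by blast
  have "\<exists>!s. ?P s"
  proof (rule ex1I[of _ "restrict s {..<p ^ c}"])
    show "?P (restrict s {..<p ^ c})" using s by (auto intro!: chsum_cong)
    fix u assume u: "?P u"
    have "u i = s i" if "i < p ^ c" for i
      using u s that by (intro decomposition_unique[of u c s]) auto
    then show "u = restrict s {..<p ^ c}" using u by (auto simp: PiE_def extensional_def fun_eq_iff)
  qed
  from theI'[OF this] have "?P (coords p R c r)" unfolding coords_def chsum_def ch_def .
  then show "coords p R c r \<in> {..<p ^ c} \<rightarrow>\<^sub>E carrier R" "chsum c (coords p R c r) = r" by auto
qed

lemma coords_closed [simp]: "r \<in> carrier R \<Longrightarrow> i < p ^ c \<Longrightarrow> coords p R c r i \<in> carrier R"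
  using coords_PiE[of r c] by auto

lemma coords_eqI:
  assumes "s \<in> {..<p ^ c} \<rightarrow> carrier R" "r = chsum c s" "i < p ^ c"
  shows "coords p R c r i = s i"
proof -
  have r: "r \<in> carrier R" using assms by simp
  show ?thesis
    using coords_PiE[OF r, of c] chsum_coords[OF r, of c] assms
    by (intro decomposition_unique[of "coords p R c r" c s]) auto
qed

text \<open>The component of r in the summand \<chi>(i) \<phi>^c(R). The skew product involves the
  coefficients \<open>coords\<close> only through it, and unlike them it is insensitive to the depth
  on homogeneous elements.\<close>

definition gpart where "gpart c r i = ch i \<otimes> fr c (coords p R c r i)"

lemma gpart_closed [simp]: "r \<in> carrier R \<Longrightarrow> i < p ^ c \<Longrightarrow> gpart c r i \<in> carrier R"
  by (simp add: gpart_def)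

lemma finsum_gpart: "r \<in> carrier R \<Longrightarrow> (\<Oplus>i\<in>{..<p ^ c}. gpart c r i) = r"
  using chsum_coords[of r c] by (simp add: chsum_def gpart_def)

lemma gpart_add:
  assumes "r \<in> carrier R" "s \<in> carrier R" "i < p ^ c"
  shows "gpart c (r \<oplus> s) i = gpart c r i \<oplus> gpart c s i"
proof -
  have "coords p R c (r \<oplus> s) i = coords p R c r i \<oplus> coords p R c s i"
  proof (rule coords_eqI[OF _ _ assms(3)])
    show "(\<lambda>i. coords p R c r i \<oplus> coords p R c s i) \<in> {..<p ^ c} \<rightarrow> carrier R" using assms by auto
    have "chsum c (\<lambda>i. coords p R c r i \<oplus> coords p R c s i) =
        (\<Oplus>i\<in>{..<p ^ c}. ch i \<otimes> fr c (coords p R c r i) \<oplus> ch i \<otimes> fr c (coords p R c s i))"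
      unfolding chsum_def using assms
      by (intro finsum_cong') (auto simp: ring_hom_add[OF fr_hom] r_distr)
    also have "\<dots> = chsum c (coords p R c r) \<oplus> chsum c (coords p R c s)"
      unfolding chsum_def using assms by (intro finsum_addf) auto
    finally show "r \<oplus> s = chsum c (\<lambda>i. coords p R c r i \<oplus> coords p R c s i)"
      using assms by (simp add: chsum_coords)
  qed
  then show ?thesis using assms by (simp add: gpart_def ring_hom_add[OF fr_hom] r_distr)
qed

lemma gpart_hom: "i < p ^ c \<Longrightarrow> abelian_group_hom R R (\<lambda>r. gpart c r i)"
  by (rule abelian_group_hom_addI) (auto simp: gpart_add abelian_group_axioms)

lemma gpart_zero [simp]: "i < p ^ c \<Longrightarrow> gpart c \<zero> i = \<zero>"
  by (rule abelian_group_hom.hom_zero[OF gpart_hom])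

text \<open>Divide j by p^c with quotient a and remainder b: then \<chi>(j) \<phi>^d(t) = \<chi>(b)
  \<phi>^c(\<chi>(a) \<phi>^{d-c}(t)) lies in a single summand of depth c.\<close>

lemma gpart_homogeneous:
  assumes t: "t \<in> carrier R" and d: "d \<ge> c" and i: "i < p ^ c"
  shows "gpart c (ch j \<otimes> fr d t) i = (if i = j mod p ^ c then ch j \<otimes> fr d t else \<zero>)"
proof -
  let ?u = "ch (j div p ^ c) \<otimes> fr (d - c) t"
  let ?s = "\<lambda>i. if i = j mod p ^ c then ?u else \<zero>"
  have eq: "ch (j mod p ^ c) \<otimes> fr c ?u = ch j \<otimes> fr d t"
  proof -
    have "fr c ?u = ch (p ^ c * (j div p ^ c)) \<otimes> fr c (fr (d - c) t)"
      using t by (simp add: ring_hom_mult[OF fr_hom] fr_ch)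
    also have "fr c (fr (d - c) t) = fr d t"
      using d funpow_add[of c "d - c" "frob R"] by simp
    finally have "ch (j mod p ^ c) \<otimes> fr c ?u = ch (j mod p ^ c + p ^ c * (j div p ^ c)) \<otimes> fr d t"
      using t by (simp only: ch_add m_assoc ch_closed fr_closed)
    then show ?thesis by simp
  qed
  have fz: "fr c \<zero> = \<zero>" using ring_hom_zero[OF fr_hom ring_axioms ring_axioms] .
  have m: "j mod p ^ c < p ^ c" using p_pos by simp
  have "coords p R c (ch j \<otimes> fr d t) i = ?s i"
  proof (rule coords_eqI[OF _ _ i])
    have "chsum c ?s = (\<Oplus>i\<in>{..<p ^ c}. if j mod p ^ c = i then ch i \<otimes> fr c ?u else \<zero>)"
      unfolding chsum_def using t by (intro finsum_cong') (auto simp: fz)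
    also have "\<dots> = ch (j mod p ^ c) \<otimes> fr c ?u"
      using m t by (intro finsum_singleton) auto
    finally show "ch j \<otimes> fr d t = chsum c ?s" by (simp only: eq)
  qed (use t in auto)
  then show ?thesis using eq by (simp add: gpart_def fz)
qed

end

section \<open>Twisted group rings\<close>

context prime_phi_ring
begin

text \<open>Elements of depth d and degree j. The degree is not reduced modulo p^d, so that degrees
  simply add in products and are multiplied by p under \<phi>.\<close>

definition homog where "homog d j r \<longleftrightarrow> (\<exists>t\<in>carrier R. r = ch j \<otimes> fr d t)"

lemma homog_closed: "homog d j r \<Longrightarrow> r \<in> carrier R"
  by (auto simp: homog_def)

lemma homog_mult:
  assumes "homog d i r" "homog d j s"
  shows "homog d (i + j) (r \<otimes> s)"
proof -
  obtain t u where "t \<in> carrier R" "r = ch i \<otimes> fr d t" "u \<in> carrier R" "s = ch j \<otimes> fr d u"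
    using assms by (auto simp: homog_def)
  then have "r \<otimes> s = ch (i + j) \<otimes> fr d (t \<otimes> u)"
    by (simp add: ch_add ring_hom_mult[OF fr_hom] m_ac)
  then show ?thesis using \<open>t \<in> carrier R\<close> \<open>u \<in> carrier R\<close> unfolding homog_def by blast
qed

lemma homog_one: "homog d 0 \<one>"
  unfolding homog_def by (intro bexI[of _ \<one>]) (auto simp: ring_hom_one[OF fr_hom])

lemma homog_frob: "homog d j r \<Longrightarrow> homog (Suc d) (p * j) (frob R r)"
  by (auto simp: homog_def ring_hom_mult[OF frob_hom] frob_ch)

lemma homog_gpart: "r \<in> carrier R \<Longrightarrow> i < p ^ d \<Longrightarrow> homog d i (gpart d r i)"
  by (auto simp: homog_def gpart_def)

lemma gpart_homog:
  "homog d j r \<Longrightarrow> c \<le> d \<Longrightarrow> i < p ^ c \<Longrightarrow> gpart c r i = (if i = j mod p ^ c then r else \<zero>)"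
  by (auto simp: homog_def gpart_homogeneous)

text \<open>The depth d is free, so it can be taken large enough for several exponents at
  once.\<close>

lemma homog_induct:
  assumes r: "r \<in> carrier R" and 0: "P \<zero>"
    and h: "\<And>j r. homog d j r \<Longrightarrow> P r"
    and a: "\<And>r s. r \<in> carrier R \<Longrightarrow> s \<in> carrier R \<Longrightarrow> P r \<Longrightarrow> P s \<Longrightarrow> P (r \<oplus> s)"
  shows "P r"
proof -
  have "P (finsum R (gpart d r) I)" if "finite I" "I \<subseteq> {..<p ^ d}" for I
    using that
  proof (induction I)
    case (insert i I)
    then have c: "gpart d r \<in> I \<rightarrow> carrier R" "i < p ^ d" using r by auto
    then show ?case using insert r by (simp add: a h[OF homog_gpart] finsum_closed)
  qed (simp add: 0)
  from this[of "{..<p ^ d}"] show ?thesis using finsum_gpart[OF r] by simp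
qed

end

text \<open>The skew group ring of an abstract group, with \<alpha> i in the role of conjugation by
  \<iota>(i). The Frobenius is a parameter \<open>F\<close>, so that \<open>skew_group_ring\<close>
  is literally an instance.\<close>

definition twisted_ring ::
    "nat \<Rightarrow> ('r, 'm) phi_ring_scheme \<Rightarrow> ('q, 'k) monoid_scheme \<Rightarrow> (nat \<Rightarrow> 'q \<Rightarrow> 'q) \<Rightarrow> nat \<Rightarrow>
     (('q \<Rightarrow> 'r) \<Rightarrow> ('q \<Rightarrow> 'r)) \<Rightarrow> ('q \<Rightarrow> 'r) frob_ring" where
  "twisted_ring p R Q \<alpha> c F =
      \<lparr>carrier = {f \<in> carrier Q \<rightarrow>\<^sub>E carrier R. finite (coeff_supp R (carrier Q) f)},
       mult = (\<lambda>f g. \<lambda>q\<in>carrier Q.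
         finsum R
           (\<lambda>(h, h', i). f h \<otimes>\<^bsub>R\<^esub> chi R (Zp_of_int p (int i)) \<otimes>\<^bsub>R\<^esub>
                        (frob R ^^ c) (coords p R c (g h') i))
           {(h, h', i). h \<in> coeff_supp R (carrier Q) f \<and> h' \<in> coeff_supp R (carrier Q) g \<and> i < p ^ c \<and>
                        \<alpha> i h \<otimes>\<^bsub>Q\<^esub> h' = q}),
       one = (\<lambda>q\<in>carrier Q. if q = \<one>\<^bsub>Q\<^esub> then \<one>\<^bsub>R\<^esub> else \<zero>\<^bsub>R\<^esub>),
       zero = (\<lambda>q\<in>carrier Q. \<zero>\<^bsub>R\<^esub>),
       add = (\<lambda>f g. \<lambda>q\<in>carrier Q. f q \<oplus>\<^bsub>R\<^esub> g q),
       frob = F\<rparr>"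

definition monomial :: "('r, 'm) ring_scheme \<Rightarrow> ('q, 'k) monoid_scheme \<Rightarrow> 'r \<Rightarrow> 'q \<Rightarrow> 'q \<Rightarrow> 'r" where
  "monomial R Q r q = (\<lambda>q'\<in>carrier Q. if q' = q then r else \<zero>\<^bsub>R\<^esub>)"

locale twisted_group = prime_phi_ring p R + Q: group Q
  for p and R :: "('r, 'm) phi_ring_scheme" (structure) and Q :: "('q, 'k) monoid_scheme" +
  fixes \<alpha> :: "nat \<Rightarrow> 'q \<Rightarrow> 'q" and c :: nat and F :: "('q \<Rightarrow> 'r) \<Rightarrow> ('q \<Rightarrow> 'r)"
  assumes \<alpha>_hom: "\<alpha> i \<in> hom Q Q"
    and \<alpha>_add: "q \<in> carrier Q \<Longrightarrow> \<alpha> j (\<alpha> i q) = \<alpha> (i + j) q"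
    and \<alpha>_period: "q \<in> carrier Q \<Longrightarrow> \<alpha> (p ^ c * m) q = q"
begin

abbreviation "T \<equiv> twisted_ring p R Q \<alpha> c F"
abbreviation supp where "supp \<equiv> coeff_supp R (carrier Q)"
abbreviation mnl where "mnl \<equiv> monomial R Q"

lemma \<alpha>_closed [simp]: "q \<in> carrier Q \<Longrightarrow> \<alpha> i q \<in> carrier Q"
  using \<alpha>_hom by (auto simp: hom_def)

lemma \<alpha>_mult: "q \<in> carrier Q \<Longrightarrow> q' \<in> carrier Q \<Longrightarrow> \<alpha> i (q \<otimes>\<^bsub>Q\<^esub> q') = \<alpha> i q \<otimes>\<^bsub>Q\<^esub> \<alpha> i q'"
  using \<alpha>_hom by (auto simp: hom_def)

lemma \<alpha>_one: "\<alpha> i \<one>\<^bsub>Q\<^esub> = \<one>\<^bsub>Q\<^esub>"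
  using hom_one[OF \<alpha>_hom Q.is_group Q.is_group] .

lemma \<alpha>_0: "q \<in> carrier Q \<Longrightarrow> \<alpha> 0 q = q"
  using \<alpha>_period[of q 0] by simp

lemma \<alpha>_mod: "q \<in> carrier Q \<Longrightarrow> \<alpha> (j mod p ^ c) q = \<alpha> j q"
  using \<alpha>_add[of q "j mod p ^ c" "p ^ c * (j div p ^ c)"] \<alpha>_period[of q "j div p ^ c"]
    \<alpha>_add[of q "p ^ c * (j div p ^ c)" "j mod p ^ c"]
  by simp

lemma T_simps:
  "carrier T = {f \<in> carrier Q \<rightarrow>\<^sub>E carrier R. finite (supp f)}"
  "\<zero>\<^bsub>T\<^esub> = (\<lambda>q\<in>carrier Q. \<zero>)"
  "f \<oplus>\<^bsub>T\<^esub> g = (\<lambda>q\<in>carrier Q. f q \<oplus> g q)"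
  "\<one>\<^bsub>T\<^esub> = mnl \<one> \<one>\<^bsub>Q\<^esub>"
  by (simp_all add: twisted_ring_def monomial_def)

lemma val_closed: "f \<in> carrier T \<Longrightarrow> q \<in> carrier Q \<Longrightarrow> f q \<in> carrier R"
  by (auto simp: T_simps)

lemma finite_supp: "f \<in> carrier T \<Longrightarrow> finite (supp f)"
  by (auto simp: T_simps)

lemma supp_subset: "supp f \<subseteq> carrier Q"
  by (auto simp: coeff_supp_def)

lemma notin_supp: "q \<in> carrier Q \<Longrightarrow> q \<notin> supp f \<Longrightarrow> f q = \<zero>"
  by (auto simp: coeff_supp_def)

lemma T_memI:
  assumes "\<And>q. q \<in> carrier Q \<Longrightarrow> f q \<in> carrier R" "f \<in> extensional (carrier Q)"
    and "finite K" "\<And>q. q \<in> carrier Q \<Longrightarrow> q \<notin> K \<Longrightarrow> f q = \<zero>"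
  shows "f \<in> carrier T"
proof -
  have "supp f \<subseteq> K" using assms(4) by (auto simp: coeff_supp_def)
  then have "finite (supp f)" using assms(3) by (rule finite_subset)
  then show ?thesis using assms(1,2) by (simp add: T_simps PiE_iff)
qed

lemma T_eqI:
  assumes "f \<in> extensional (carrier Q)" "g \<in> extensional (carrier Q)" "\<And>q. q \<in> carrier Q \<Longrightarrow> f q = g q"
  shows "f = g"
  using assms by (rule extensionalityI)

lemma T_extensional: "f \<in> carrier T \<Longrightarrow> f \<in> extensional (carrier Q)"
  by (auto simp: T_simps PiE_def)

lemma T_add_val: "q \<in> carrier Q \<Longrightarrow> (f \<oplus>\<^bsub>T\<^esub> g) q = f q \<oplus> g q"
  by (simp add: T_simps)

lemma T_zero_val: "q \<in> carrier Q \<Longrightarrow> \<zero>\<^bsub>T\<^esub> q = \<zero>"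
  by (simp add: T_simps)

lemma T_op_extensional:
  "f \<oplus>\<^bsub>T\<^esub> g \<in> extensional (carrier Q)" "\<zero>\<^bsub>T\<^esub> \<in> extensional (carrier Q)"
  by (simp_all add: T_simps)

lemma T_abelian_group: "abelian_group T"
proof (rule abelian_groupI)
  show "\<zero>\<^bsub>T\<^esub> \<in> carrier T"
    by (rule T_memI[OF _ T_op_extensional(2), where K = "{}"]) (simp_all add: T_zero_val)
  fix f assume f: "f \<in> carrier T"
  show "\<zero>\<^bsub>T\<^esub> \<oplus>\<^bsub>T\<^esub> f = f"
    by (rule T_eqI[OF T_op_extensional(1) T_extensional[OF f]]) (simp add: T_add_val T_zero_val val_closed[OF f])
  have "(\<lambda>q\<in>carrier Q. \<ominus> f q) \<in> carrier T"
    by (rule T_memI[OF _ _ finite_supp[OF f]]) (simp_all add: notin_supp a_inv_zero val_closed[OF f])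
  moreover have "(\<lambda>q\<in>carrier Q. \<ominus> f q) \<oplus>\<^bsub>T\<^esub> f = \<zero>\<^bsub>T\<^esub>"
    by (rule T_eqI[OF T_op_extensional]) (simp add: T_add_val T_zero_val l_neg val_closed[OF f])
  ultimately show "\<exists>g\<in>carrier T. g \<oplus>\<^bsub>T\<^esub> f = \<zero>\<^bsub>T\<^esub>" by blast
  fix g assume g: "g \<in> carrier T"
  have fin: "finite (supp f \<union> supp g)" using finite_supp f g by blast
  show "f \<oplus>\<^bsub>T\<^esub> g \<in> carrier T"
    by (rule T_memI[OF _ T_op_extensional(1) fin]) (simp_all add: T_add_val notin_supp val_closed[OF f] val_closed[OF g])
  show "f \<oplus>\<^bsub>T\<^esub> g = g \<oplus>\<^bsub>T\<^esub> f"
    by (rule T_eqI[OF T_op_extensional(1) T_op_extensional(1)]) (simp add: T_add_val a_comm val_closed[OF f] val_closed[OF g])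
  fix h assume h: "h \<in> carrier T"
  show "f \<oplus>\<^bsub>T\<^esub> g \<oplus>\<^bsub>T\<^esub> h = f \<oplus>\<^bsub>T\<^esub> (g \<oplus>\<^bsub>T\<^esub> h)"
    by (rule T_eqI[OF T_op_extensional(1) T_op_extensional(1)]) (simp add: T_add_val a_assoc val_closed[OF f] val_closed[OF g] val_closed[OF h])
qed

sublocale T: abelian_group T by (rule T_abelian_group)

lemma mnl_extensional: "mnl r q \<in> extensional (carrier Q)"
  by (simp add: monomial_def)

lemma mnl_val: "q' \<in> carrier Q \<Longrightarrow> mnl r q q' = (if q' = q then r else \<zero>)"
  by (simp add: monomial_def)

lemma mnl_closed [simp]: "r \<in> carrier R \<Longrightarrow> mnl r q \<in> carrier T"
  by (rule T_memI[OF _ mnl_extensional, where K = "{q}"]) (simp_all add: mnl_val)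

lemma mnl_add: "r \<in> carrier R \<Longrightarrow> s \<in> carrier R \<Longrightarrow> mnl (r \<oplus> s) q = mnl r q \<oplus>\<^bsub>T\<^esub> mnl s q"
  by (rule T_eqI[OF mnl_extensional T_op_extensional(1)]) (simp add: mnl_val T_add_val)

lemma mnl_zero: "mnl \<zero> q = \<zero>\<^bsub>T\<^esub>"
  by (rule T_eqI[OF mnl_extensional T_op_extensional(2)]) (simp add: mnl_val T_zero_val)

lemma mnl_hom: "abelian_group_hom R T (\<lambda>r. mnl r q)"
  by (rule abelian_group_hom_addI) (auto simp: mnl_add abelian_group_axioms T_abelian_group)

lemma T_induct:
  assumes f: "f \<in> carrier T" and 0: "P \<zero>\<^bsub>T\<^esub>"
    and m: "\<And>j r q. homog d j r \<Longrightarrow> q \<in> carrier Q \<Longrightarrow> P (mnl r q)"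
    and a: "\<And>f g. f \<in> carrier T \<Longrightarrow> g \<in> carrier T \<Longrightarrow> P f \<Longrightarrow> P g \<Longrightarrow> P (f \<oplus>\<^bsub>T\<^esub> g)"
  shows "P f"
proof -
  have mm: "P (mnl r q)" if "r \<in> carrier R" "q \<in> carrier Q" for r q
    using that(1)
    by (rule homog_induct[where d = d]) (use 0 m that a in \<open>auto simp: mnl_zero mnl_add\<close>)
  \<comment> \<open>The induction is on a set containing the support rather than on the support, so
    that the coefficient split off may be zero.\<close>
  have "\<forall>f\<in>carrier T. supp f \<subseteq> K \<longrightarrow> P f" if "finite K" "K \<subseteq> carrier Q" for K
    using that
  proof (induction K)
    case empty
    show ?case
    proof (intro ballI impI)
      fix f assume f: "f \<in> carrier T" "supp f \<subseteq> {}"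
      have "f = \<zero>\<^bsub>T\<^esub>"
        by (rule T_eqI[OF T_extensional[OF f(1)] T_op_extensional(2)])
          (use f(2) notin_supp in \<open>simp add: T_zero_val\<close>)
      then show "P f" using 0 by simp
    qed
  next
    case (insert q K)
    show ?case
    proof (intro ballI impI)
      fix f assume f: "f \<in> carrier T" "supp f \<subseteq> insert q K"
      have q: "q \<in> carrier Q" using insert by simp
      let ?g = "f(q := \<zero>)"
      have ge: "?g \<in> extensional (carrier Q)"
        using T_extensional[OF f(1)] q by (auto simp: extensional_def)
      have g: "?g \<in> carrier T"
        by (rule T_memI[OF _ ge finite_supp[OF f(1)]]) (simp_all add: notin_supp val_closed[OF f(1)])
      moreover have "supp ?g \<subseteq> K" using f by (auto simp: coeff_supp_def)
      ultimately have "P ?g" using insert by auto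
      moreover have "f = ?g \<oplus>\<^bsub>T\<^esub> mnl (f q) q"
        by (rule T_eqI[OF T_extensional[OF f(1)] T_op_extensional(1)])
          (simp add: T_add_val mnl_val val_closed[OF f(1)] q)
      ultimately show "P f" using a[OF g _ _ mm] f q by (metis mnl_closed val_closed)
    qed
  qed
  from this[OF finite_supp[OF f] supp_subset] show ?thesis using f by blast
qed

text \<open>Additive maps are compared on monomials with homogeneous coefficients, where
  \<open>mnl_mult\<close> gives the product in closed form.\<close>

lemma hom_eq_on_mon:
  assumes "abelian_group_hom T N g" "abelian_group_hom T N h"
    and "\<And>j r q. homog d j r \<Longrightarrow> q \<in> carrier Q \<Longrightarrow> g (mnl r q) = h (mnl r q)"
    and "f \<in> carrier T"
  shows "g f = h f"
proof -
  interpret g: abelian_group_hom T N g by fact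
  interpret h: abelian_group_hom T N h by fact
  show ?thesis by (rule T_induct[OF assms(4), where d = d]) (auto simp: assms(3))
qed

abbreviation idx where
  "idx K K' q \<equiv> {(h, h', i). h \<in> K \<and> h' \<in> K' \<and> i < p ^ c \<and> \<alpha> i h \<otimes>\<^bsub>Q\<^esub> h' = q}"

abbreviation term_fun where "term_fun f g \<equiv> (\<lambda>(h, h', i). f h \<otimes> gpart c (g h') i)"

lemma finite_idx: "finite K \<Longrightarrow> finite K' \<Longrightarrow> finite (idx K K' q)"
  by (rule finite_subset[of _ "K \<times> K' \<times> {..<p ^ c}"]) auto

lemma term_fun_closed:
  "f \<in> carrier T \<Longrightarrow> g \<in> carrier T \<Longrightarrow> K \<subseteq> carrier Q \<Longrightarrow> K' \<subseteq> carrier Q \<Longrightarrow> term_fun f g \<in> idx K K' q \<rightarrow> carrier R"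
  by (auto simp: subset_iff val_closed[of f] val_closed[of g])

text \<open>The product is defined as a sum over the exact supports, which change under addition.
  Enlarging them allows two products to be summed over the same index set, as distributivity
  requires.\<close>

lemma mult_val:
  assumes f: "f \<in> carrier T" and g: "g \<in> carrier T" and q: "q \<in> carrier Q"
    and K: "finite K" "K \<subseteq> carrier Q" "supp f \<subseteq> K" and K': "finite K'" "K' \<subseteq> carrier Q" "supp g \<subseteq> K'"
  shows "(f \<otimes>\<^bsub>T\<^esub> g) q = finsum R (term_fun f g) (idx K K' q)"
proof -
  have "(f \<otimes>\<^bsub>T\<^esub> g) q = finsum R (\<lambda>(h, h', i). f h \<otimes> ch i \<otimes> fr c (coords p R c (g h') i)) (idx (supp f) (supp g) q)"
    using q by (simp add: twisted_ring_def ch_def)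
  also have "\<dots> = finsum R (term_fun f g) (idx (supp f) (supp g) q)"
  proof (rule finsum_cong'[OF refl term_fun_closed[OF f g supp_subset supp_subset]])
    fix x assume "x \<in> idx (supp f) (supp g) q"
    then obtain h h' i where "x = (h, h', i)" "h \<in> carrier Q" "h' \<in> carrier Q" "i < p ^ c"
      using supp_subset by fastforce
    then show "(case x of (h, h', i) \<Rightarrow> f h \<otimes> ch i \<otimes> fr c (coords p R c (g h') i)) = term_fun f g x"
      by (simp add: gpart_def m_assoc val_closed[OF f] val_closed[OF g])
  qed
  also have "\<dots> = finsum R (term_fun f g) (idx K K' q)"
  proof (rule add.finprod_mono_neutral_cong_left[OF finite_idx[OF K(1) K'(1)]])
    show "idx (supp f) (supp g) q \<subseteq> idx K K' q" using K K' by auto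
    show "term_fun f g \<in> idx K K' q \<rightarrow> carrier R" by (rule term_fun_closed[OF f g K(2) K'(2)])
    fix x assume "x \<in> idx K K' q - idx (supp f) (supp g) q"
    then have x': "x \<in> idx K K' q" "x \<notin> idx (supp f) (supp g) q" by blast+
    from x'(1) obtain h h' i where x0: "x = (h, h', i)" "h \<in> K" "h' \<in> K'" "i < p ^ c" "\<alpha> i h \<otimes>\<^bsub>Q\<^esub> h' = q"
      by auto
    with x'(2) have "h \<notin> supp f \<or> h' \<notin> supp g" by simp
    note x = x0(1,4) subsetD[OF K(2) x0(2)] subsetD[OF K'(2) x0(3)] this
    then show "term_fun f g x = \<zero>"
      using x by (auto simp: notin_supp val_closed[OF f] val_closed[OF g])
  qed simp
  finally show ?thesis .
qed

lemma mult_extensional: "f \<otimes>\<^bsub>T\<^esub> g \<in> extensional (carrier Q)"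
  by (simp add: twisted_ring_def)

lemma mult_closed:
  assumes f: "f \<in> carrier T" and g: "g \<in> carrier T"
  shows "f \<otimes>\<^bsub>T\<^esub> g \<in> carrier T"
proof (rule T_memI[OF _ mult_extensional])
  note v = mult_val[OF f g _ finite_supp[OF f] supp_subset subset_refl finite_supp[OF g] supp_subset subset_refl]
  show "(f \<otimes>\<^bsub>T\<^esub> g) q \<in> carrier R" if "q \<in> carrier Q" for q
    unfolding v[OF that] by (intro finsum_closed term_fun_closed f g supp_subset)
  let ?K = "(\<lambda>(h, h', i). \<alpha> i h \<otimes>\<^bsub>Q\<^esub> h') ` (supp f \<times> supp g \<times> {..<p ^ c})"
  show "finite ?K" using finite_supp f g by blast
  show "(f \<otimes>\<^bsub>T\<^esub> g) q = \<zero>" if q: "q \<in> carrier Q" "q \<notin> ?K" for q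
  proof -
    have "idx (supp f) (supp g) q = {}" using q(2) by force
    then show ?thesis unfolding v[OF q(1)] by (simp only: finsum_empty)
  qed
qed

lemma mult_l_distr:
  assumes f: "f \<in> carrier T" and f': "f' \<in> carrier T" and g: "g \<in> carrier T"
  shows "(f \<oplus>\<^bsub>T\<^esub> f') \<otimes>\<^bsub>T\<^esub> g = f \<otimes>\<^bsub>T\<^esub> g \<oplus>\<^bsub>T\<^esub> f' \<otimes>\<^bsub>T\<^esub> g"
proof (rule T_eqI[OF mult_extensional])
  let ?K = "supp f \<union> supp f'" and ?K' = "supp g"
  have K: "finite ?K" "?K \<subseteq> carrier Q" using finite_supp f f' supp_subset by auto
  note v = mult_val[OF _ g _ K _ finite_supp[OF g] supp_subset subset_refl]
  have ff': "f \<oplus>\<^bsub>T\<^esub> f' \<in> carrier T" using f f' by simp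
  have s: "supp (f \<oplus>\<^bsub>T\<^esub> f') \<subseteq> ?K" by (auto simp: coeff_supp_def T_add_val)
  fix q assume q: "q \<in> carrier Q"
  have "((f \<oplus>\<^bsub>T\<^esub> f') \<otimes>\<^bsub>T\<^esub> g) q = finsum R (term_fun (f \<oplus>\<^bsub>T\<^esub> f') g) (idx ?K ?K' q)"
    by (rule v[OF ff' q s])
  also have "\<dots> = finsum R (\<lambda>x. term_fun f g x \<oplus> term_fun f' g x) (idx ?K ?K' q)"
  proof (rule finsum_cong'[OF refl])
    show "(\<lambda>x. term_fun f g x \<oplus> term_fun f' g x) \<in> idx ?K ?K' q \<rightarrow> carrier R"
      using term_fun_closed[OF f g K(2) supp_subset] term_fun_closed[OF f' g K(2) supp_subset] by (auto simp: Pi_iff)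
    fix x assume "x \<in> idx ?K ?K' q"
    then obtain h h' i where "x = (h, h', i)" "h \<in> carrier Q" "h' \<in> carrier Q" "i < p ^ c"
      using K(2) supp_subset by fastforce
    then show "term_fun (f \<oplus>\<^bsub>T\<^esub> f') g x = term_fun f g x \<oplus> term_fun f' g x"
      by (simp add: T_add_val l_distr val_closed[OF f] val_closed[OF f'] val_closed[OF g])
  qed
  also have "\<dots> = finsum R (term_fun f g) (idx ?K ?K' q) \<oplus> finsum R (term_fun f' g) (idx ?K ?K' q)"
    by (intro finsum_addf term_fun_closed f f' g K(2) supp_subset)
  also have "\<dots> = (f \<otimes>\<^bsub>T\<^esub> g \<oplus>\<^bsub>T\<^esub> f' \<otimes>\<^bsub>T\<^esub> g) q"
    using v[OF f q] v[OF f' q] q by (simp add: T_add_val)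
  finally show "((f \<oplus>\<^bsub>T\<^esub> f') \<otimes>\<^bsub>T\<^esub> g) q = (f \<otimes>\<^bsub>T\<^esub> g \<oplus>\<^bsub>T\<^esub> f' \<otimes>\<^bsub>T\<^esub> g) q" .
qed (rule T_op_extensional)

lemma mult_r_distr:
  assumes f: "f \<in> carrier T" and g: "g \<in> carrier T" and g': "g' \<in> carrier T"
  shows "f \<otimes>\<^bsub>T\<^esub> (g \<oplus>\<^bsub>T\<^esub> g') = f \<otimes>\<^bsub>T\<^esub> g \<oplus>\<^bsub>T\<^esub> f \<otimes>\<^bsub>T\<^esub> g'"
proof (rule T_eqI[OF mult_extensional])
  let ?K = "supp f" and ?K' = "supp g \<union> supp g'"
  have K: "finite ?K'" "?K' \<subseteq> carrier Q" using finite_supp g g' supp_subset by auto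
  note v = mult_val[OF f _ _ finite_supp[OF f] supp_subset subset_refl K]
  have gg': "g \<oplus>\<^bsub>T\<^esub> g' \<in> carrier T" using g g' by simp
  have s: "supp (g \<oplus>\<^bsub>T\<^esub> g') \<subseteq> ?K'" by (auto simp: coeff_supp_def T_add_val)
  fix q assume q: "q \<in> carrier Q"
  have "(f \<otimes>\<^bsub>T\<^esub> (g \<oplus>\<^bsub>T\<^esub> g')) q = finsum R (term_fun f (g \<oplus>\<^bsub>T\<^esub> g')) (idx ?K ?K' q)"
    by (rule v[OF gg' q s])
  also have "\<dots> = finsum R (\<lambda>x. term_fun f g x \<oplus> term_fun f g' x) (idx ?K ?K' q)"
  proof (rule finsum_cong'[OF refl])
    show "(\<lambda>x. term_fun f g x \<oplus> term_fun f g' x) \<in> idx ?K ?K' q \<rightarrow> carrier R"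
      using term_fun_closed[OF f g supp_subset K(2)] term_fun_closed[OF f g' supp_subset K(2)] by (auto simp: Pi_iff)
    fix x assume "x \<in> idx ?K ?K' q"
    then obtain h h' i where "x = (h, h', i)" "h \<in> carrier Q" "h' \<in> carrier Q" "i < p ^ c"
      using K(2) supp_subset by fastforce
    then show "term_fun f (g \<oplus>\<^bsub>T\<^esub> g') x = term_fun f g x \<oplus> term_fun f g' x"
      by (simp add: T_add_val gpart_add r_distr val_closed[OF f] val_closed[OF g] val_closed[OF g'])
  qed
  also have "\<dots> = finsum R (term_fun f g) (idx ?K ?K' q) \<oplus> finsum R (term_fun f g') (idx ?K ?K' q)"
    by (intro finsum_addf term_fun_closed f g g' K(2) supp_subset)
  also have "\<dots> = (f \<otimes>\<^bsub>T\<^esub> g \<oplus>\<^bsub>T\<^esub> f \<otimes>\<^bsub>T\<^esub> g') q"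
    using v[OF g q] v[OF g' q] q by (simp add: T_add_val)
  finally show "(f \<otimes>\<^bsub>T\<^esub> (g \<oplus>\<^bsub>T\<^esub> g')) q = (f \<otimes>\<^bsub>T\<^esub> g \<oplus>\<^bsub>T\<^esub> f \<otimes>\<^bsub>T\<^esub> g') q" .
qed (rule T_op_extensional)

text \<open>A right coefficient of degree j and depth at least c has a single component of depth c,
  with index j mod p^c; and \<alpha> depends on its index only modulo p^c. Hence the reduction
  disappears from the result.\<close>

lemma mnl_mult:
  assumes r: "r \<in> carrier R" and s: "homog d j s" "c \<le> d" and q: "q \<in> carrier Q" "q' \<in> carrier Q"
  shows "mnl r q \<otimes>\<^bsub>T\<^esub> mnl s q' = mnl (r \<otimes> s) (\<alpha> j q \<otimes>\<^bsub>Q\<^esub> q')"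
proof (rule T_eqI[OF mult_extensional])
  fix x assume x: "x \<in> carrier Q"
  have sc: "s \<in> carrier R" using s(1) by (rule homog_closed)
  let ?j = "j mod p ^ c"
  have j: "?j < p ^ c" using p_pos by simp
  let ?I = "idx {q} {q'} x"
  have v: "(mnl r q \<otimes>\<^bsub>T\<^esub> mnl s q') x = finsum R (term_fun (mnl r q) (mnl s q')) ?I"
    by (rule mult_val) (use r sc q x in \<open>auto simp: coeff_supp_def mnl_val split: if_splits\<close>)
  have t: "term_fun (mnl r q) (mnl s q') y = (if y = (q, q', ?j) then r \<otimes> s else \<zero>)" if "y \<in> ?I" for y
    using that r sc q gpart_homog[OF s] by (auto simp: mnl_val split: if_splits)
  show "(mnl r q \<otimes>\<^bsub>T\<^esub> mnl s q') x = mnl (r \<otimes> s) (\<alpha> j q \<otimes>\<^bsub>Q\<^esub> q') x"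
  proof (cases "x = \<alpha> j q \<otimes>\<^bsub>Q\<^esub> q'")
    case True
    then have "(q, q', ?j) \<in> ?I" using j q by (simp add: \<alpha>_mod)
    then have "finsum R (\<lambda>y. if (q, q', ?j) = y then r \<otimes> s else \<zero>) ?I = r \<otimes> s"
      using r sc by (intro finsum_singleton finite_idx) auto
    moreover have "finsum R (term_fun (mnl r q) (mnl s q')) ?I =
        finsum R (\<lambda>y. if (q, q', ?j) = y then r \<otimes> s else \<zero>) ?I"
      using r sc t by (intro finsum_cong') auto
    ultimately show ?thesis using v x True by (simp add: monomial_def)
  next
    case False
    then have "(q, q', ?j) \<notin> ?I" using q by (auto simp: \<alpha>_mod)
    then have "term_fun (mnl r q) (mnl s q') y = \<zero>" if "y \<in> ?I" for y
    proof -
      have "y \<noteq> (q, q', ?j)" using that \<open>(q, q', ?j) \<notin> ?I\<close> by blast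
      then show ?thesis using t[OF that] by simp
    qed
    then have "finsum R (term_fun (mnl r q) (mnl s q')) ?I = \<zero>"
      by (rule add.finprod_one_eqI)
    then show ?thesis using v x False by (simp add: monomial_def)
  qed
qed (simp add: monomial_def)

lemma mult_l_hom: "f \<in> carrier T \<Longrightarrow> abelian_group_hom T T (\<lambda>x. f \<otimes>\<^bsub>T\<^esub> x)"
  by (rule abelian_group_hom_addI) (auto simp: mult_r_distr mult_closed T_abelian_group)

lemma mult_r_hom: "g \<in> carrier T \<Longrightarrow> abelian_group_hom T T (\<lambda>x. x \<otimes>\<^bsub>T\<^esub> g)"
  by (rule abelian_group_hom_addI) (auto simp: mult_l_distr mult_closed T_abelian_group)

text \<open>Both sides are additive in each argument, so three homogeneous monomials suffice. There
  the identity is \<alpha>_k(\<alpha>_j(w) v) u = \<alpha>_{j+k}(w) (\<alpha>_k(v) u), as the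
  degrees j and k of the two right factors add up.\<close>

lemma mult_assoc_T:
  assumes x: "x \<in> carrier T" and y: "y \<in> carrier T" and z: "z \<in> carrier T"
  shows "x \<otimes>\<^bsub>T\<^esub> y \<otimes>\<^bsub>T\<^esub> z = x \<otimes>\<^bsub>T\<^esub> (y \<otimes>\<^bsub>T\<^esub> z)"
proof (rule hom_eq_on_mon[OF mult_l_hom[OF mult_closed[OF x y]]
      abelian_group_hom_comp[OF mult_l_hom[OF y] mult_l_hom[OF x]] _ z])
  fix k t u assume t: "homog c k t" and u: "u \<in> carrier Q"
  note tc = mnl_closed[OF homog_closed[OF t]]
  show "x \<otimes>\<^bsub>T\<^esub> y \<otimes>\<^bsub>T\<^esub> mnl t u = x \<otimes>\<^bsub>T\<^esub> (y \<otimes>\<^bsub>T\<^esub> mnl t u)"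
  proof (rule hom_eq_on_mon[OF abelian_group_hom_comp[OF mult_l_hom[OF x] mult_r_hom[OF tc]]
        abelian_group_hom_comp[OF mult_r_hom[OF tc] mult_l_hom[OF x]] _ y])
    fix j s v assume s: "homog c j s" and v: "v \<in> carrier Q"
    note sc = mnl_closed[OF homog_closed[OF s]]
    show "x \<otimes>\<^bsub>T\<^esub> mnl s v \<otimes>\<^bsub>T\<^esub> mnl t u = x \<otimes>\<^bsub>T\<^esub> (mnl s v \<otimes>\<^bsub>T\<^esub> mnl t u)"
    proof (rule hom_eq_on_mon[OF abelian_group_hom_comp[OF mult_r_hom[OF sc] mult_r_hom[OF tc]]
          mult_r_hom[OF mult_closed[OF sc tc]] _ x])
      fix i r w assume r: "homog c i r" and w: "w \<in> carrier Q"
      have st: "homog c (j + k) (s \<otimes> t)" using s t by (rule homog_mult)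
      note cl = homog_closed[OF r] homog_closed[OF s] homog_closed[OF t]
      show "mnl r w \<otimes>\<^bsub>T\<^esub> mnl s v \<otimes>\<^bsub>T\<^esub> mnl t u = mnl r w \<otimes>\<^bsub>T\<^esub> (mnl s v \<otimes>\<^bsub>T\<^esub> mnl t u)"
        using cl u v w
        by (simp add: mnl_mult[OF _ s] mnl_mult[OF _ t] mnl_mult[OF _ st] \<alpha>_mult \<alpha>_add m_assoc Q.m_assoc)
    qed
  qed
qed

lemma T_ring: "ring T"
proof (rule ringI[OF T_abelian_group])
  show "Group.monoid T"
  proof (rule Group.monoidI)
    fix x assume x: "x \<in> carrier T"
    have one: "homog c 0 \<one>" by (rule homog_one)
    have oc: "\<one>\<^bsub>T\<^esub> \<in> carrier T" by (simp add: T_simps(4))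
    show "\<one>\<^bsub>T\<^esub> \<otimes>\<^bsub>T\<^esub> x = x"
    proof (rule hom_eq_on_mon[OF mult_l_hom[OF oc] abelian_group_hom_id[OF T_abelian_group] _ x])
      fix j r q assume "homog c j r" "q \<in> carrier Q"
      then show "\<one>\<^bsub>T\<^esub> \<otimes>\<^bsub>T\<^esub> mnl r q = mnl r q"
        by (simp add: T_simps(4) mnl_mult[of _ c j] \<alpha>_one homog_closed)
    qed
    show "x \<otimes>\<^bsub>T\<^esub> \<one>\<^bsub>T\<^esub> = x"
    proof (rule hom_eq_on_mon[OF mult_r_hom[OF oc] abelian_group_hom_id[OF T_abelian_group] _ x])
      fix j r q assume "homog c j r" "q \<in> carrier Q"
      then show "mnl r q \<otimes>\<^bsub>T\<^esub> \<one>\<^bsub>T\<^esub> = mnl r q"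
        by (simp add: T_simps(4) mnl_mult[OF _ one] \<alpha>_0 homog_closed)
    qed
  qed (auto simp: mult_closed mult_assoc_T, simp add: T_simps(4))
qed (auto simp: mult_l_distr mult_r_distr)

lemma mnl_one_hom: "(\<lambda>r. mnl r \<one>\<^bsub>Q\<^esub>) \<in> ring_hom R T"
proof (rule ring_hom_memI)
  fix r s assume r: "r \<in> carrier R" and s: "s \<in> carrier R"
  interpret m: abelian_group_hom R T "\<lambda>r. mnl r \<one>\<^bsub>Q\<^esub>" by (rule mnl_hom)
  show "mnl (r \<otimes> s) \<one>\<^bsub>Q\<^esub> = mnl r \<one>\<^bsub>Q\<^esub> \<otimes>\<^bsub>T\<^esub> mnl s \<one>\<^bsub>Q\<^esub>"
    by (rule homog_induct[OF s, where d = c])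
      (use r in \<open>auto simp: mnl_mult \<alpha>_one homog_closed r_distr mnl_add mult_r_distr mnl_zero
        abelian_group_hom.hom_zero[OF mult_l_hom] simp del: m.hom_add m.hom_zero\<close>)
qed (auto simp: mnl_add T_simps(4))

end

text \<open>The two rings keep their own exponents c and c'. Three instances follow: the projection
  between consecutive levels, the Frobenius of a level, and its lift to the next level.\<close>

locale twisted_additive = T1: twisted_group p R Q \<alpha> c F + T2: twisted_group p R Q' \<alpha>' c' F'
  for p and R :: "('r, 'm) phi_ring_scheme" (structure) and Q :: "('q, 'k) monoid_scheme" and \<alpha> c F
    and Q' :: "('q, 'k) monoid_scheme" and \<alpha>' c' F' +
  fixes \<sigma> :: "'r \<Rightarrow> 'r" and \<theta> :: "'q \<Rightarrow> 'q"
  assumes \<sigma>_hom: "\<sigma> \<in> ring_hom R R" and \<theta>_hom: "\<theta> \<in> hom Q Q'"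
begin

abbreviation "cm \<equiv> coeff_map R (carrier Q) (carrier Q') \<sigma> \<theta>"

lemma \<sigma>_closed [simp]: "r \<in> carrier R \<Longrightarrow> \<sigma> r \<in> carrier R"
  using \<sigma>_hom by (rule ring_hom_closed)

lemma \<sigma>_zero [simp]: "\<sigma> \<zero> = \<zero>"
  by (rule ring_hom_zero[OF \<sigma>_hom T1.ring_axioms T1.ring_axioms])

lemma \<theta>_closed [simp]: "q \<in> carrier Q \<Longrightarrow> \<theta> q \<in> carrier Q'"
  using \<theta>_hom by (auto simp: hom_def)

lemma cm_val:
  assumes f: "f \<in> carrier T1.T" and q: "q' \<in> carrier Q'" and K: "finite K" "K \<subseteq> carrier Q" "T1.supp f \<subseteq> K"
  shows "cm f q' = finsum R (\<lambda>q. \<sigma> (f q)) {q \<in> K. \<theta> q = q'}"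
proof -
  have "finsum R (\<lambda>q. \<sigma> (f q)) {q \<in> T1.supp f. \<theta> q = q'} = finsum R (\<lambda>q. \<sigma> (f q)) {q \<in> K. \<theta> q = q'}"
  proof (rule T1.add.finprod_mono_neutral_cong_left)
    show "(\<lambda>q. \<sigma> (f q)) \<in> {q \<in> K. \<theta> q = q'} \<rightarrow> carrier R" using K(2) by (auto simp: T1.val_closed[OF f])
    fix q assume "q \<in> {q \<in> K. \<theta> q = q'} - {q \<in> T1.supp f. \<theta> q = q'}"
    then show "\<sigma> (f q) = \<zero>" using K(2) T1.notin_supp[of q f] by auto
  qed (use K in auto)
  then show ?thesis using q by (simp add: coeff_map_def)
qed

lemma cm_hom: "abelian_group_hom T1.T T2.T cm"
proof (rule abelian_group_hom_addI[OF T1.T_abelian_group T2.T_abelian_group])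
  fix f assume f: "f \<in> carrier T1.T"
  note v = cm_val[OF f _ T1.finite_supp[OF f] T1.supp_subset subset_refl]
  show "cm f \<in> carrier T2.T"
  proof (rule T2.T_memI[of _ "\<theta> ` T1.supp f"])
    show "cm f q' \<in> carrier R" if "q' \<in> carrier Q'" for q'
      unfolding v[OF that] using T1.supp_subset[of f] by (intro T1.finsum_closed) (auto simp: T1.val_closed[OF f])
    show "cm f q' = \<zero>" if "q' \<in> carrier Q'" "q' \<notin> \<theta> ` T1.supp f" for q'
    proof -
      have "{q \<in> T1.supp f. \<theta> q = q'} = {}" using that by auto
      then show ?thesis unfolding v[OF that(1)] by (simp only: T1.finsum_empty)
    qed
  qed (use T1.finite_supp[OF f] in \<open>auto simp: coeff_map_def\<close>)
  fix g assume g: "g \<in> carrier T1.T"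
  let ?K = "T1.supp f \<union> T1.supp g"
  have K: "finite ?K" "?K \<subseteq> carrier Q" using T1.finite_supp f g T1.supp_subset by auto
  have fg: "f \<oplus>\<^bsub>T1.T\<^esub> g \<in> carrier T1.T" using f g by simp
  have s: "T1.supp (f \<oplus>\<^bsub>T1.T\<^esub> g) \<subseteq> ?K" by (auto simp: coeff_supp_def T1.T_add_val)
  show "cm (f \<oplus>\<^bsub>T1.T\<^esub> g) = cm f \<oplus>\<^bsub>T2.T\<^esub> cm g"
  proof (rule T2.T_eqI)
    fix q' assume q': "q' \<in> carrier Q'"
    let ?I = "{q \<in> ?K. \<theta> q = q'}"
    have "cm (f \<oplus>\<^bsub>T1.T\<^esub> g) q' = finsum R (\<lambda>q. \<sigma> ((f \<oplus>\<^bsub>T1.T\<^esub> g) q)) ?I" by (rule cm_val[OF fg q' K s])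
    also have "\<dots> = finsum R (\<lambda>q. \<sigma> (f q) \<oplus> \<sigma> (g q)) ?I"
      using K(2) by (intro T1.finsum_cong')
        (auto simp: T1.T_add_val ring_hom_add[OF \<sigma>_hom] T1.val_closed[OF f] T1.val_closed[OF g])
    also have "\<dots> = finsum R (\<lambda>q. \<sigma> (f q)) ?I \<oplus> finsum R (\<lambda>q. \<sigma> (g q)) ?I"
      using K(2) by (intro T1.finsum_addf) (auto simp: T1.val_closed[OF f] T1.val_closed[OF g])
    also have "\<dots> = cm f q' \<oplus> cm g q'"
      using cm_val[OF f q' K] cm_val[OF g q' K] by simp
    finally show "cm (f \<oplus>\<^bsub>T1.T\<^esub> g) q' = (cm f \<oplus>\<^bsub>T2.T\<^esub> cm g) q'" using q' by (simp add: T2.T_add_val)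
  qed (auto simp: coeff_map_def T2.T_simps)
qed

lemma cm_mon:
  assumes r: "r \<in> carrier R" and q: "q \<in> carrier Q"
  shows "cm (T1.mnl r q) = T2.mnl (\<sigma> r) (\<theta> q)"
proof (rule T2.T_eqI)
  fix q' assume q': "q' \<in> carrier Q'"
  have "cm (T1.mnl r q) q' = finsum R (\<lambda>x. \<sigma> (T1.mnl r q x)) {x \<in> {q}. \<theta> x = q'}"
    using q by (intro cm_val T1.mnl_closed r q') (auto simp: coeff_supp_def monomial_def)
  also have "\<dots> = (if \<theta> q = q' then \<sigma> r else \<zero>)"
  proof (cases "\<theta> q = q'")
    case True
    then have "{x \<in> {q}. \<theta> x = q'} = {q}" by auto
    then show ?thesis using True q r by (simp add: monomial_def)
  next
    case False
    then have "{x \<in> {q}. \<theta> x = q'} = {}" by auto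
    then show ?thesis using False by (simp only: T1.finsum_empty if_False)
  qed
  finally show "cm (T1.mnl r q) q' = T2.mnl (\<sigma> r) (\<theta> q) q'" using q' by (auto simp: monomial_def)
qed (auto simp: coeff_map_def monomial_def)

text \<open>The bounds on d and d' make \<open>mnl_mult\<close> available on both sides, and m is
  the factor by which degrees change: 1 for the projections and p for Frobenius. The twist by
  \<alpha> j is then carried to the twist by \<alpha>' (m * j), which is the degree of the image
  coefficient.\<close>

lemma cm_ring_hom:
  assumes d: "c \<le> d" "c' \<le> d'"
    and h: "\<And>j r. T1.homog d j r \<Longrightarrow> T1.homog d' (m * j) (\<sigma> r)"
    and \<theta>\<alpha>: "\<And>j q. q \<in> carrier Q \<Longrightarrow> \<theta> (\<alpha> j q) = \<alpha>' (m * j) (\<theta> q)"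
  shows "cm \<in> ring_hom T1.T T2.T"
proof (rule ring_hom_memI)
  interpret cm: abelian_group_hom T1.T T2.T cm by (rule cm_hom)
  show "cm f \<in> carrier T2.T" if "f \<in> carrier T1.T" for f using that by simp
  show "cm (f \<oplus>\<^bsub>T1.T\<^esub> g) = cm f \<oplus>\<^bsub>T2.T\<^esub> cm g" if "f \<in> carrier T1.T" "g \<in> carrier T1.T" for f g
    using that by simp
  have "\<theta> \<one>\<^bsub>Q\<^esub> = \<one>\<^bsub>Q'\<^esub>" using hom_one[OF \<theta>_hom T1.Q.is_group T2.Q.is_group] .
  then show "cm \<one>\<^bsub>T1.T\<^esub> = \<one>\<^bsub>T2.T\<^esub>"
    by (simp add: T1.T_simps(4) T2.T_simps(4) cm_mon ring_hom_one[OF \<sigma>_hom])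
  fix f g assume f: "f \<in> carrier T1.T" and g: "g \<in> carrier T1.T"
  show "cm (f \<otimes>\<^bsub>T1.T\<^esub> g) = cm f \<otimes>\<^bsub>T2.T\<^esub> cm g"
  proof (rule T1.hom_eq_on_mon[OF abelian_group_hom_comp[OF T1.mult_l_hom[OF f] cm_hom]
        abelian_group_hom_comp[OF cm_hom T2.mult_l_hom[OF cm.hom_closed[OF f]]] _ g])
    fix j s v assume s: "T1.homog d j s" and v: "v \<in> carrier Q"
    note sc = T1.mnl_closed[OF T1.homog_closed[OF s], of v]
    show "cm (f \<otimes>\<^bsub>T1.T\<^esub> T1.mnl s v) = cm f \<otimes>\<^bsub>T2.T\<^esub> cm (T1.mnl s v)"
    proof (rule T1.hom_eq_on_mon[OF abelian_group_hom_comp[OF T1.mult_r_hom[OF sc] cm_hom]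
          abelian_group_hom_comp[OF cm_hom T2.mult_r_hom[OF cm.hom_closed[OF sc]]] _ f])
      fix i r w assume r: "T1.homog d i r" and w: "w \<in> carrier Q"
      note cl = T1.homog_closed[OF r] T1.homog_closed[OF s]
      have tm: "\<theta> (\<alpha> j w \<otimes>\<^bsub>Q\<^esub> v) = \<alpha>' (m * j) (\<theta> w) \<otimes>\<^bsub>Q'\<^esub> \<theta> v"
        using \<theta>_hom v w \<theta>\<alpha>[OF w] by (auto simp: hom_def)
      show "cm (T1.mnl r w \<otimes>\<^bsub>T1.T\<^esub> T1.mnl s v) = cm (T1.mnl r w) \<otimes>\<^bsub>T2.T\<^esub> cm (T1.mnl s v)"
        using cl v w
        by (simp add: T1.mnl_mult[OF _ s d(1)] cm_mon T2.mnl_mult[OF _ h[OF s] d(2)] tm ring_hom_mult[OF \<sigma>_hom])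
    qed
  qed
qed

end

section \<open>Limits of towers of rings\<close>

definition tower_limit ::
    "(nat \<Rightarrow> ('t, 'a) frob_ring_scheme) \<Rightarrow> (nat \<Rightarrow> 't \<Rightarrow> 't) \<Rightarrow> (nat \<Rightarrow> 't) frob_ring" where
  "tower_limit S \<pi> =
      \<lparr>carrier = {x \<in> \<Pi>\<^sub>E k\<in>{1..}. carrier (S k). \<forall>k\<ge>1. \<pi> k (x (Suc k)) = x k},
       mult = (\<lambda>x y. \<lambda>k\<in>{1..}. x k \<otimes>\<^bsub>S k\<^esub> y k),
       one = (\<lambda>k\<in>{1..}. \<one>\<^bsub>S k\<^esub>),
       zero = (\<lambda>k\<in>{1..}. \<zero>\<^bsub>S k\<^esub>),
       add = (\<lambda>x y. \<lambda>k\<in>{1..}. x k \<oplus>\<^bsub>S k\<^esub> y k),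
       frob = (\<lambda>x. \<lambda>k\<in>{1..}. frob (S k) (x k))\<rparr>"

text \<open>\<open>frob_kernel\<close> records that Frobenius on level k + 1 depends only on the
  projection to level k. In the limit this becomes the contraction \<open>frob_J\<close>.\<close>

locale ring_tower =
  fixes S :: "nat \<Rightarrow> ('t, 'a) frob_ring_scheme" and \<pi> :: "nat \<Rightarrow> 't \<Rightarrow> 't"
  assumes ring_S: "k \<ge> 1 \<Longrightarrow> ring (S k)"
    and \<pi>_hom: "k \<ge> 1 \<Longrightarrow> \<pi> k \<in> ring_hom (S (Suc k)) (S k)"
    and frob_S: "k \<ge> 1 \<Longrightarrow> frob (S k) \<in> ring_hom (S k) (S k)"
    and \<pi>_frob: "k \<ge> 1 \<Longrightarrow> x \<in> carrier (S (Suc k)) \<Longrightarrow> \<pi> k (frob (S (Suc k)) x) = frob (S k) (\<pi> k x)"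
    and frob_kernel: "k \<ge> 1 \<Longrightarrow> x \<in> carrier (S (Suc k)) \<Longrightarrow> \<pi> k x = \<zero>\<^bsub>S k\<^esub> \<Longrightarrow>
      frob (S (Suc k)) x = \<zero>\<^bsub>S (Suc k)\<^esub>"
begin

abbreviation "L \<equiv> tower_limit S \<pi>"

lemma L_memI:
  assumes "x \<in> extensional {1..}" "\<And>k. k \<ge> 1 \<Longrightarrow> x k \<in> carrier (S k)"
    and "\<And>k. k \<ge> 1 \<Longrightarrow> \<pi> k (x (Suc k)) = x k"
  shows "x \<in> carrier L"
  using assms by (simp add: tower_limit_def PiE_iff)

lemma L_extensional: "x \<in> carrier L \<Longrightarrow> x \<in> extensional {1..}"
  and L_val: "x \<in> carrier L \<Longrightarrow> k \<ge> 1 \<Longrightarrow> x k \<in> carrier (S k)"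
  and L_compat: "x \<in> carrier L \<Longrightarrow> k \<ge> 1 \<Longrightarrow> \<pi> k (x (Suc k)) = x k"
  by (auto simp: tower_limit_def PiE_iff)

lemma L_eqI:
  assumes "x \<in> extensional {1..}" "y \<in> extensional {1..}" "\<And>k. k \<ge> 1 \<Longrightarrow> x k = y k"
  shows "x = y"
  using assms(1,2) by (rule extensionalityI) (simp add: assms(3))

lemma L_ops:
  assumes "k \<ge> 1"
  shows "(x \<otimes>\<^bsub>L\<^esub> y) k = x k \<otimes>\<^bsub>S k\<^esub> y k" "(x \<oplus>\<^bsub>L\<^esub> y) k = x k \<oplus>\<^bsub>S k\<^esub> y k"
    "\<one>\<^bsub>L\<^esub> k = \<one>\<^bsub>S k\<^esub>" "\<zero>\<^bsub>L\<^esub> k = \<zero>\<^bsub>S k\<^esub>" "frob L x k = frob (S k) (x k)"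
  using assms by (simp_all add: tower_limit_def)

lemma L_ops_extensional:
  "x \<otimes>\<^bsub>L\<^esub> y \<in> extensional {1..}" "x \<oplus>\<^bsub>L\<^esub> y \<in> extensional {1..}"
  "\<one>\<^bsub>L\<^esub> \<in> extensional {1..}" "\<zero>\<^bsub>L\<^esub> \<in> extensional {1..}" "frob L x \<in> extensional {1..}"
  by (simp_all add: tower_limit_def)

lemma \<pi>_additive: "k \<ge> 1 \<Longrightarrow> abelian_group_hom (S (Suc k)) (S k) (\<pi> k)"
  using ring_hom_additive[OF ring_S[of "Suc k"] ring_S \<pi>_hom] by simp

lemma L_closed:
  shows "x \<in> carrier L \<Longrightarrow> y \<in> carrier L \<Longrightarrow> x \<otimes>\<^bsub>L\<^esub> y \<in> carrier L"
    and "x \<in> carrier L \<Longrightarrow> y \<in> carrier L \<Longrightarrow> x \<oplus>\<^bsub>L\<^esub> y \<in> carrier L"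
    and "\<one>\<^bsub>L\<^esub> \<in> carrier L" and "\<zero>\<^bsub>L\<^esub> \<in> carrier L"
    and "x \<in> carrier L \<Longrightarrow> frob L x \<in> carrier L"
proof -
  show "x \<otimes>\<^bsub>L\<^esub> y \<in> carrier L" if x: "x \<in> carrier L" and y: "y \<in> carrier L"
  proof (rule L_memI[OF L_ops_extensional(1)])
    fix k :: nat assume k: "k \<ge> 1"
    interpret ring "S k" by (rule ring_S[OF k])
    show "(x \<otimes>\<^bsub>L\<^esub> y) k \<in> carrier (S k)" using L_val[OF x k] L_val[OF y k] k by (simp add: L_ops)
    show "\<pi> k ((x \<otimes>\<^bsub>L\<^esub> y) (Suc k)) = (x \<otimes>\<^bsub>L\<^esub> y) k"
      using k L_compat[OF x k] L_compat[OF y k] L_val[OF x, of "Suc k"] L_val[OF y, of "Suc k"]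
      by (simp add: L_ops ring_hom_mult[OF \<pi>_hom])
  qed
  show "x \<oplus>\<^bsub>L\<^esub> y \<in> carrier L" if x: "x \<in> carrier L" and y: "y \<in> carrier L"
  proof (rule L_memI[OF L_ops_extensional(2)])
    fix k :: nat assume k: "k \<ge> 1"
    interpret ring "S k" by (rule ring_S[OF k])
    show "(x \<oplus>\<^bsub>L\<^esub> y) k \<in> carrier (S k)" using L_val[OF x k] L_val[OF y k] k by (simp add: L_ops)
    show "\<pi> k ((x \<oplus>\<^bsub>L\<^esub> y) (Suc k)) = (x \<oplus>\<^bsub>L\<^esub> y) k"
      using k L_compat[OF x k] L_compat[OF y k] L_val[OF x, of "Suc k"] L_val[OF y, of "Suc k"]
      by (simp add: L_ops ring_hom_add[OF \<pi>_hom])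
  qed
  show "\<one>\<^bsub>L\<^esub> \<in> carrier L"
  proof (rule L_memI[OF L_ops_extensional(3)])
    fix k :: nat assume k: "k \<ge> 1"
    interpret ring "S k" by (rule ring_S[OF k])
    show "\<one>\<^bsub>L\<^esub> k \<in> carrier (S k)" using k by (simp add: L_ops)
    show "\<pi> k (\<one>\<^bsub>L\<^esub> (Suc k)) = \<one>\<^bsub>L\<^esub> k"
      using k by (simp add: L_ops ring_hom_one[OF \<pi>_hom])
  qed
  show "\<zero>\<^bsub>L\<^esub> \<in> carrier L"
  proof (rule L_memI[OF L_ops_extensional(4)])
    fix k :: nat assume k: "k \<ge> 1"
    interpret ring "S k" by (rule ring_S[OF k])
    show "\<zero>\<^bsub>L\<^esub> k \<in> carrier (S k)" using k by (simp add: L_ops)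
    show "\<pi> k (\<zero>\<^bsub>L\<^esub> (Suc k)) = \<zero>\<^bsub>L\<^esub> k"
      using k abelian_group_hom.hom_zero[OF \<pi>_additive[OF k]] by (simp add: L_ops)
  qed
  show "frob L x \<in> carrier L" if x: "x \<in> carrier L"
  proof (rule L_memI[OF L_ops_extensional(5)])
    fix k :: nat assume k: "k \<ge> 1"
    show "frob L x k \<in> carrier (S k)"
      using k L_val[OF x k] ring_hom_closed[OF frob_S[OF k]] by (simp add: L_ops)
    show "\<pi> k (frob L x (Suc k)) = frob L x k"
      using k L_compat[OF x k] L_val[OF x, of "Suc k"] by (simp add: L_ops \<pi>_frob)
  qed
qed

lemma L_ring: "ring L"
proof (rule ringI)
  show "abelian_group L"
  proof (rule abelian_groupI)
    fix x y z assume x: "x \<in> carrier L" and y: "y \<in> carrier L" and z: "z \<in> carrier L"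
    show "x \<oplus>\<^bsub>L\<^esub> y \<oplus>\<^bsub>L\<^esub> z = x \<oplus>\<^bsub>L\<^esub> (y \<oplus>\<^bsub>L\<^esub> z)"
      by (rule L_eqI[OF L_ops_extensional(2) L_ops_extensional(2)])
        (simp add: L_ops abelian_monoid.a_assoc[OF abelian_group.axioms(1)[OF ring.is_abelian_group[OF ring_S]]]
          L_val[OF x] L_val[OF y] L_val[OF z])
  next
    fix x y assume x: "x \<in> carrier L" and y: "y \<in> carrier L"
    show "x \<oplus>\<^bsub>L\<^esub> y = y \<oplus>\<^bsub>L\<^esub> x"
      by (rule L_eqI[OF L_ops_extensional(2) L_ops_extensional(2)])
        (simp add: L_ops abelian_monoid.a_comm[OF abelian_group.axioms(1)[OF ring.is_abelian_group[OF ring_S]]]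
          L_val[OF x] L_val[OF y])
  next
    fix x assume x: "x \<in> carrier L"
    show "\<zero>\<^bsub>L\<^esub> \<oplus>\<^bsub>L\<^esub> x = x"
      by (rule L_eqI[OF L_ops_extensional(2) L_extensional[OF x]])
        (simp add: L_ops abelian_monoid.l_zero[OF abelian_group.axioms(1)[OF ring.is_abelian_group[OF ring_S]]]
          L_val[OF x])
    let ?y = "\<lambda>k\<in>{1..}. \<ominus>\<^bsub>S k\<^esub> x k"
    have "?y \<in> carrier L"
    proof (rule L_memI)
      fix k :: nat assume k: "k \<ge> 1"
      interpret ring "S k" by (rule ring_S[OF k])
      show "?y k \<in> carrier (S k)" using k L_val[OF x k] by simp
      show "\<pi> k (?y (Suc k)) = ?y k"
        using k L_compat[OF x k] L_val[OF x, of "Suc k"] abelian_group_hom.hom_a_inv[OF \<pi>_additive[OF k]]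
        by simp
    qed simp
    moreover have "?y \<oplus>\<^bsub>L\<^esub> x = \<zero>\<^bsub>L\<^esub>"
      by (rule L_eqI[OF L_ops_extensional(2,4)])
        (simp add: L_ops abelian_group.l_neg[OF ring.is_abelian_group[OF ring_S]] L_val[OF x])
    ultimately show "\<exists>y\<in>carrier L. y \<oplus>\<^bsub>L\<^esub> x = \<zero>\<^bsub>L\<^esub>" by blast
  qed (rule L_closed; assumption)+
next
  show "Group.monoid L"
  proof (rule Group.monoidI)
    fix x y z assume x: "x \<in> carrier L" and y: "y \<in> carrier L" and z: "z \<in> carrier L"
    show "x \<otimes>\<^bsub>L\<^esub> y \<otimes>\<^bsub>L\<^esub> z = x \<otimes>\<^bsub>L\<^esub> (y \<otimes>\<^bsub>L\<^esub> z)"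
      by (rule L_eqI[OF L_ops_extensional(1) L_ops_extensional(1)])
        (simp add: L_ops Group.monoid.m_assoc[OF ring.is_monoid[OF ring_S]] L_val[OF x] L_val[OF y] L_val[OF z])
  next
    fix x assume x: "x \<in> carrier L"
    show "\<one>\<^bsub>L\<^esub> \<otimes>\<^bsub>L\<^esub> x = x"
      by (rule L_eqI[OF L_ops_extensional(1) L_extensional[OF x]])
        (simp add: L_ops Group.monoid.l_one[OF ring.is_monoid[OF ring_S]] L_val[OF x])
    show "x \<otimes>\<^bsub>L\<^esub> \<one>\<^bsub>L\<^esub> = x"
      by (rule L_eqI[OF L_ops_extensional(1) L_extensional[OF x]])
        (simp add: L_ops Group.monoid.r_one[OF ring.is_monoid[OF ring_S]] L_val[OF x])
  qed (rule L_closed; assumption)+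
next
  fix x y z assume x: "x \<in> carrier L" and y: "y \<in> carrier L" and z: "z \<in> carrier L"
  show "(x \<oplus>\<^bsub>L\<^esub> y) \<otimes>\<^bsub>L\<^esub> z = x \<otimes>\<^bsub>L\<^esub> z \<oplus>\<^bsub>L\<^esub> y \<otimes>\<^bsub>L\<^esub> z"
  proof (rule L_eqI[OF L_ops_extensional(1,2)])
    fix k :: nat assume k: "k \<ge> 1"
    interpret ring "S k" by (rule ring_S[OF k])
    show "((x \<oplus>\<^bsub>L\<^esub> y) \<otimes>\<^bsub>L\<^esub> z) k = (x \<otimes>\<^bsub>L\<^esub> z \<oplus>\<^bsub>L\<^esub> y \<otimes>\<^bsub>L\<^esub> z) k"
      using L_val[OF x k] L_val[OF y k] L_val[OF z k] by (simp add: L_ops[OF k] l_distr)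
  qed
  show "z \<otimes>\<^bsub>L\<^esub> (x \<oplus>\<^bsub>L\<^esub> y) = z \<otimes>\<^bsub>L\<^esub> x \<oplus>\<^bsub>L\<^esub> z \<otimes>\<^bsub>L\<^esub> y"
  proof (rule L_eqI[OF L_ops_extensional(1,2)])
    fix k :: nat assume k: "k \<ge> 1"
    interpret ring "S k" by (rule ring_S[OF k])
    show "(z \<otimes>\<^bsub>L\<^esub> (x \<oplus>\<^bsub>L\<^esub> y)) k = (z \<otimes>\<^bsub>L\<^esub> x \<oplus>\<^bsub>L\<^esub> z \<otimes>\<^bsub>L\<^esub> y) k"
      using L_val[OF x k] L_val[OF y k] L_val[OF z k] by (simp add: L_ops[OF k] r_distr)
  qed
qed

lemma eval_hom: "k \<ge> 1 \<Longrightarrow> (\<lambda>x. x k) \<in> ring_hom L (S k)"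
  by (rule ring_hom_memI) (auto simp: L_ops L_val)

lemma L_frob_ring: "frob_ring L"
proof (intro frob_ring.intro frob_ring_axioms.intro L_ring ring_hom_memI)
  fix x y assume x: "x \<in> carrier L" and y: "y \<in> carrier L"
  show "frob L (x \<otimes>\<^bsub>L\<^esub> y) = frob L x \<otimes>\<^bsub>L\<^esub> frob L y"
    by (rule L_eqI[OF L_ops_extensional(5,1)])
      (simp add: L_ops ring_hom_mult[OF frob_S] L_val[OF x] L_val[OF y])
  show "frob L (x \<oplus>\<^bsub>L\<^esub> y) = frob L x \<oplus>\<^bsub>L\<^esub> frob L y"
    by (rule L_eqI[OF L_ops_extensional(5,2)])
      (simp add: L_ops ring_hom_add[OF frob_S] L_val[OF x] L_val[OF y])
next
  show "frob L \<one>\<^bsub>L\<^esub> = \<one>\<^bsub>L\<^esub>"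
    by (rule L_eqI[OF L_ops_extensional(5,3)]) (simp add: L_ops ring_hom_one[OF frob_S])
qed (rule L_closed)

text \<open>Levels are counted from 1 and the filtration from 0; with this shift the ideal of index
  0 is the kernel of the projection to level 1, that is of \<ell>_R.\<close>

definition L_ideal where "L_ideal n = {x \<in> carrier L. x (Suc n) = \<zero>\<^bsub>S (Suc n)\<^esub>}"

lemma L_filtered: "filtered_frob_ring L L_ideal"
proof -
  interpret L: frob_ring L by (rule L_frob_ring)
  have ev: "abelian_group_hom L (S k) (\<lambda>x. x k)" if "k \<ge> 1" for k
    by (rule ring_hom_additive[OF L_ring ring_S[OF that] eval_hom[OF that]])
  have minus: "(x \<ominus>\<^bsub>L\<^esub> y) k = x k \<ominus>\<^bsub>S k\<^esub> y k" if "k \<ge> 1" "x \<in> carrier L" "y \<in> carrier L" for k x y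
    using abelian_group_hom.hom_a_inv[OF ev[OF that(1)] that(3)] that by (simp add: a_minus_def L_ops)
  have eq: "u = v \<longleftrightarrow> u \<ominus>\<^bsub>S k\<^esub> v = \<zero>\<^bsub>S k\<^esub>" if "k \<ge> 1" "u \<in> carrier (S k)" "v \<in> carrier (S k)" for k u v
  proof -
    interpret ring "S k" by (rule ring_S[OF that(1)])
    show ?thesis
    proof
      assume "u \<ominus>\<^bsub>S k\<^esub> v = \<zero>\<^bsub>S k\<^esub>"
      then have "u = \<ominus>\<^bsub>S k\<^esub> (\<ominus>\<^bsub>S k\<^esub> v)"
        using that by (intro minus_equality[symmetric]) (auto simp: a_minus_def)
      then show "u = v" using that by simp
    qed (use that in \<open>simp add: a_minus_def r_neg\<close>)
  qed
  show ?thesis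
  proof (intro filtered_frob_ring.intro filtered_frob_ring_axioms.intro L_frob_ring)
    fix n
    have "ring_hom_ring L (S (Suc n)) (\<lambda>x. x (Suc n))"
      by (intro ring_hom_ringI2 L_ring ring_S eval_hom) auto
    from ring_hom_ring.kernel_is_ideal[OF this] show "ideal (L_ideal n) L"
      by (simp add: a_kernel_def' L_ideal_def)
    show "L_ideal (Suc n) \<subseteq> L_ideal n"
    proof
      fix x assume "x \<in> L_ideal (Suc n)"
      then have x: "x \<in> carrier L" "x (Suc (Suc n)) = \<zero>\<^bsub>S (Suc (Suc n))\<^esub>" by (auto simp: L_ideal_def)
      have "x (Suc n) = \<pi> (Suc n) (x (Suc (Suc n)))" using L_compat[OF x(1), of "Suc n"] by simp
      also have "\<dots> = \<zero>\<^bsub>S (Suc n)\<^esub>"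
        unfolding x(2) by (rule abelian_group_hom.hom_zero[OF \<pi>_additive]) simp
      finally show "x \<in> L_ideal n" using x by (simp add: L_ideal_def)
    qed
    show "frob L x \<in> L_ideal (Suc n)" if "x \<in> L_ideal n" for x
    proof -
      have x: "x \<in> carrier L" "x (Suc n) = \<zero>\<^bsub>S (Suc n)\<^esub>" using that by (auto simp: L_ideal_def)
      have "frob (S (Suc (Suc n))) (x (Suc (Suc n))) = \<zero>\<^bsub>S (Suc (Suc n))\<^esub>"
        using L_compat[OF x(1), of "Suc n"] L_val[OF x(1), of "Suc (Suc n)"] x(2)
        by (intro frob_kernel) auto
      then show ?thesis using x L_closed(5) by (simp add: L_ideal_def L_ops)
    qed
  next
    fix x assume x: "\<And>n. x \<in> L_ideal n"
    then have "x k = \<zero>\<^bsub>S k\<^esub>" if "k \<ge> 1" for k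
      using that x[of "k - 1"] by (simp add: L_ideal_def)
    then show "x = \<zero>\<^bsub>L\<^esub>"
      using x[of 0] by (intro L_eqI[OF L_extensional L_ops_extensional(4)]) (auto simp: L_ideal_def L_ops)
  next
    fix y assume y: "\<And>n :: nat. y n \<in> carrier L" and d: "\<And>n. y (Suc n) \<ominus>\<^bsub>L\<^esub> y n \<in> L_ideal n"
    have step: "y (Suc n) (Suc n) = y n (Suc n)" for n
    proof -
      have "y (Suc n) (Suc n) \<ominus>\<^bsub>S (Suc n)\<^esub> y n (Suc n) = \<zero>\<^bsub>S (Suc n)\<^esub>"
        using d[of n] by (simp add: L_ideal_def minus y)
      then show ?thesis using eq[of "Suc n" "y (Suc n) (Suc n)" "y n (Suc n)"] L_val[OF y, of "Suc n"] by simp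
    qed
    \<comment> \<open>Agreement modulo \<open>L_ideal n\<close> means agreement at level n + 1, so
      at level k the sequence is constant from index k - 1 on.\<close>
    define l where "l = (\<lambda>k\<in>{1..}. y (k - 1) k)"
    have l: "l \<in> carrier L"
    proof (rule L_memI)
      fix k :: nat assume k: "k \<ge> 1"
      show "l k \<in> carrier (S k)" using k L_val[OF y k] by (simp add: l_def)
      have "\<pi> k (l (Suc k)) = y k k" using k L_compat[OF y k] by (simp add: l_def)
      also have "\<dots> = l k" using k step[of "k - 1"] by (simp add: l_def)
      finally show "\<pi> k (l (Suc k)) = l k" .
    qed (simp add: l_def)
    have "l \<ominus>\<^bsub>L\<^esub> y n \<in> L_ideal n" for n
    proof -
      have "l (Suc n) = y n (Suc n)" by (simp add: l_def)
      then have "(l \<ominus>\<^bsub>L\<^esub> y n) (Suc n) = \<zero>\<^bsub>S (Suc n)\<^esub>"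
        using L_val[OF y, of "Suc n" n] eq[of "Suc n" "y n (Suc n)" "y n (Suc n)"] by (simp add: minus l y)
      then show ?thesis using l y by (simp add: L_ideal_def)
    qed
    then show "\<exists>l\<in>carrier L. \<forall>n. l \<ominus>\<^bsub>L\<^esub> y n \<in> L_ideal n" using l by blast
  qed
qed

end

section \<open>The quotients \<open>H\<^sub>1/H\<^sub>k\<close>\<close>

locale prime_phi_group = phi_group p H for p :: nat and H :: "('h, 'm) phi_group_scheme" (structure) +
  assumes prime: "prime p"
begin

lemma p_pos: "p > 0" using prime prime_gt_0_nat by auto

lemma ell_group_hom: "group_hom H (add_monoid (Zp p)) (ell H)"
  by (intro group_hom.intro group_hom_axioms.intro is_group ell_hom
      abelian_group.a_group Zp_abelian_group p_pos)

lemma H1_normal: "H1 p H \<lhd> H"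
  unfolding H1_def by (rule group_hom.normal_kernel[OF ell_group_hom])

lemma H1_subset: "H1 p H \<subseteq> carrier H"
  by (auto simp: H1_def kernel_def)

sublocale gfrob: group_hom H H "gfrob H"
  by (intro group_hom.intro group_hom_axioms.intro is_group gfrob_hom)

lemma gfrob_H1: "h \<in> H1 p H \<Longrightarrow> gfrob H h \<in> H1 p H"
  using ell_gfrob by (auto simp: H1_def kernel_def)

lemma gfrob_pow_H1: "h \<in> H1 p H \<Longrightarrow> (gfrob H ^^ n) h \<in> H1 p H"
  by (induction n) (auto simp: gfrob_H1)

abbreviation "K \<equiv> Hk p H"

lemma K_generators: "(gfrob H ^^ (k - 1)) ` H1 p H \<subseteq> K k"
  by (auto simp: Hk_def normal_closure_def)

lemma K_least: "N \<lhd> H \<Longrightarrow> (gfrob H ^^ (k - 1)) ` H1 p H \<subseteq> N \<Longrightarrow> K k \<subseteq> N"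
  by (auto simp: Hk_def normal_closure_def)

lemma K_subset_H1: "K k \<subseteq> H1 p H"
  by (rule K_least[OF H1_normal]) (auto simp: gfrob_pow_H1)

lemma K_normal: "K k \<lhd> H"
  unfolding normal_inv_iff
proof (intro conjI ballI)
  let ?A = "{N. N \<lhd> H \<and> (gfrob H ^^ (k - 1)) ` H1 p H \<subseteq> N}"
  have K: "K k = \<Inter> ?A" by (simp add: Hk_def normal_closure_def)
  \<comment> \<open>The family of normal subgroups is nonempty, so that its intersection is a
    subgroup of H_0.\<close>
  have "H1 p H \<in> ?A" using H1_normal gfrob_pow_H1 by auto
  then show "subgroup (K k) H"
    unfolding K by (intro subgroups_Inter) (auto simp: normal_inv_iff)
  fix x h assume "x \<in> carrier H" "h \<in> K k"
  then show "x \<otimes> h \<otimes> inv x \<in> K k" unfolding K by (auto simp: normal_inv_iff)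
qed

text \<open>The preimage \<open>?N\<close> of H_{k+1} is normal in H_0 whatever the image of \<phi>
  is: conjugating by x before applying \<phi> amounts to conjugating by \<phi>(x)
  afterwards.\<close>

lemma gfrob_K: "k \<ge> 1 \<Longrightarrow> h \<in> K k \<Longrightarrow> gfrob H h \<in> K (Suc k)"
proof -
  assume k: "k \<ge> 1" and h: "h \<in> K k"
  have n: "subgroup (K (Suc k)) H" "\<And>x h. x \<in> carrier H \<Longrightarrow> h \<in> K (Suc k) \<Longrightarrow> x \<otimes> h \<otimes> inv x \<in> K (Suc k)"
    using K_normal[of "Suc k"] by (auto simp: normal_inv_iff)
  let ?N = "{h \<in> carrier H. gfrob H h \<in> K (Suc k)}"
  have "?N \<lhd> H"
    unfolding normal_inv_iff
  proof (intro conjI ballI)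
    show "subgroup ?N H"
      by (rule subgroupI)
        (auto simp: subgroup.m_inv_closed[OF n(1)] subgroup.m_closed[OF n(1)] subgroup.one_closed[OF n(1)]
          intro!: exI[of _ \<one>])
    show "x \<otimes> h \<otimes> inv x \<in> ?N" if "x \<in> carrier H" "h \<in> ?N" for x h
      using that n(2) by auto
  qed
  moreover have "(gfrob H ^^ (k - 1)) ` H1 p H \<subseteq> ?N"
  proof
    fix x assume "x \<in> (gfrob H ^^ (k - 1)) ` H1 p H"
    then obtain y where y: "y \<in> H1 p H" "x = (gfrob H ^^ (k - 1)) y" by auto
    have "gfrob H x = (gfrob H ^^ Suc (k - 1)) y" using y by simp
    then have "gfrob H x \<in> K (Suc k)" using K_generators[of "Suc k"] y(1) k by auto
    then show "x \<in> ?N" using y gfrob_pow_H1 H1_subset by auto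
  qed
  ultimately show "gfrob H h \<in> K (Suc k)" using K_least h by blast
qed

text \<open>As \<phi>(H_1) \<subseteq> H_1, the generators \<phi>^k(H_1) of H_{k+1} lie among those
  of H_k.\<close>

lemma K_Suc: "k \<ge> 1 \<Longrightarrow> K (Suc k) \<subseteq> K k"
proof (rule K_least[OF K_normal])
  assume k: "k \<ge> 1"
  show "(gfrob H ^^ (Suc k - 1)) ` H1 p H \<subseteq> K k"
  proof
    fix x assume "x \<in> (gfrob H ^^ (Suc k - 1)) ` H1 p H"
    then obtain y where y: "y \<in> H1 p H" "x = (gfrob H ^^ Suc (k - 1)) y" using k by auto
    then have "x = (gfrob H ^^ (k - 1)) (gfrob H y)" by (simp add: funpow_swap1)
    then show "x \<in> K k" using K_generators[of k] gfrob_H1[OF y(1)] by auto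
  qed
qed

abbreviation "qc k h \<equiv> K k #> h"

lemma Q_normal: "K k \<lhd> (H\<lparr>carrier := H1 p H\<rparr>)"
  by (rule normal_restrict_supergroup[OF _ K_normal K_subset_H1])
    (use H1_normal in \<open>simp add: normal_inv_iff\<close>)

lemma Q_group: "group (Qk p H k)"
  unfolding Qk_def by (rule normal.factorgroup_is_group[OF Q_normal])

lemma Q_carrier: "carrier (Qk p H k) = qc k ` H1 p H"
  by (auto simp: Qk_def FactGroup_def RCOSETS_def r_coset_def)

lemma Q_memE:
  assumes "q \<in> carrier (Qk p H k)"
  obtains h where "h \<in> H1 p H" "h \<in> carrier H" "q = qc k h"
  using assms H1_subset by (auto simp: Q_carrier)

lemma Q_one: "\<one>\<^bsub>Qk p H k\<^esub> = K k"
  by (simp add: Qk_def FactGroup_def)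

lemma Q_mult: "h \<in> carrier H \<Longrightarrow> h' \<in> carrier H \<Longrightarrow> qc k h \<otimes>\<^bsub>Qk p H k\<^esub> qc k h' = qc k (h \<otimes> h')"
  using normal.rcos_sum[OF K_normal, of h h' k]
  by (simp add: Qk_def FactGroup_def set_mult_def)

lemma K_subgroup: "subgroup (K k) H"
  using K_normal by (simp add: normal_inv_iff)

lemma H1_subgroup: "subgroup (H1 p H) H"
  using H1_normal by (simp add: normal_inv_iff)

abbreviation io where "io x \<equiv> iota H x"

lemma io_closed [simp]: "x \<in> carrier (Zp p) \<Longrightarrow> io x \<in> carrier H"
  using iota_hom by (auto simp: hom_def)

lemma iota_conj_qc:
  assumes x: "x \<in> carrier (Zp p)" and h: "h \<in> carrier H"
  shows "iota_conj H x (qc k h) = qc k (inv io x \<otimes> h \<otimes> io x)"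
proof -
  have ic: "inv io x \<in> carrier H" using x by simp
  have "inv io x <# (qc k h) = inv io x <# (h <# K k)"
    using normal.coset_eq[OF K_normal] h by simp
  also have "\<dots> = (inv io x \<otimes> h) <# K k"
    using ic h by (intro lcos_m_assoc subgroup.subset[OF K_subgroup]) 
  also have "\<dots> = qc k (inv io x \<otimes> h)"
    using normal.coset_eq[OF K_normal] ic h by simp
  finally show ?thesis
    unfolding iota_conj_def
    using coset_mult_assoc[OF subgroup.subset[OF K_subgroup], of "inv io x \<otimes> h" "io x"] x h by simp
qed

lemma conj_H1: "x \<in> carrier H \<Longrightarrow> h \<in> H1 p H \<Longrightarrow> inv x \<otimes> h \<otimes> x \<in> H1 p H"
  by (rule normal.inv_op_closed1[OF H1_normal])

abbreviation al where "al i q \<equiv> iota_conj H (Zp_of_int p (int i)) q"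

definition ioi where "ioi i = io (Zp_of_int p (int i))"

lemma ioi_closed [simp]: "ioi i \<in> carrier H"
  unfolding ioi_def by (rule io_closed[OF Zp_of_int_carrier[OF p_pos]])

lemma ioi_add: "ioi (i + j) = ioi i \<otimes> ioi j"
proof -
  have "io (Zp_of_int p (int i) \<oplus>\<^bsub>Zp p\<^esub> Zp_of_int p (int j)) = ioi i \<otimes> ioi j"
    using iota_hom Zp_of_int_carrier[OF p_pos] by (auto simp: hom_def ioi_def simp del: Zp_simps)
  then show ?thesis by (simp only: Zp_of_int_add of_nat_add ioi_def)
qed

lemma gfrob_ioi: "gfrob H (ioi i) = ioi (p * i)"
  using iota_frob[OF Zp_of_int_carrier[OF p_pos]] by (simp only: Zp_of_int_mult of_nat_mult ioi_def)

lemma al_qc: "h \<in> carrier H \<Longrightarrow> al i (qc k h) = qc k (inv ioi i \<otimes> h \<otimes> ioi i)"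
  unfolding ioi_def by (rule iota_conj_qc[OF Zp_of_int_carrier[OF p_pos]])

lemma qc_closed: "h \<in> H1 p H \<Longrightarrow> qc k h \<in> carrier (Qk p H k)"
  by (auto simp: Q_carrier)

lemma al_hom: "al i \<in> hom (Qk p H k) (Qk p H k)"
proof (rule homI)
  fix q q' assume "q \<in> carrier (Qk p H k)" "q' \<in> carrier (Qk p H k)"
  then obtain h h' where h: "h \<in> H1 p H" "h \<in> carrier H" "q = qc k h" and h': "h' \<in> carrier H" "q' = qc k h'"
    by (metis Q_memE)
  show "al i q \<in> carrier (Qk p H k)"
    unfolding h(3) al_qc[OF h(2)] by (rule qc_closed[OF conj_H1[OF ioi_closed h(1)]])
  have "inv ioi i \<otimes> h \<otimes> ioi i \<otimes> (inv ioi i \<otimes> h' \<otimes> ioi i) = inv ioi i \<otimes> (h \<otimes> h') \<otimes> ioi i"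
  proof -
    have "ioi i \<otimes> (inv ioi i \<otimes> x) = x" if "x \<in> carrier H" for x
      using that by (simp add: m_assoc[symmetric])
    then show ?thesis using h h' by (simp add: m_assoc)
  qed
  then show "al i (q \<otimes>\<^bsub>Qk p H k\<^esub> q') = al i q \<otimes>\<^bsub>Qk p H k\<^esub> al i q'"
    using h h' by (simp add: Q_mult al_qc)
qed

lemma al_add:
  assumes "q \<in> carrier (Qk p H k)" shows "al j (al i q) = al (i + j) q"
proof -
  obtain h where h: "h \<in> H1 p H" "h \<in> carrier H" "q = qc k h" using assms by (rule Q_memE)
  then show ?thesis by (simp add: al_qc ioi_add inv_mult_group m_assoc del: of_nat_add)
qed

section \<open>Projections and Frobenius maps between the quotients\<close>

definition proj where "proj k q = K k <#> q"

text \<open>The index is the target level only. The same formula serves for the Frobenius of H_1/H_k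
  and, because \<phi>(H_k) \<subseteq> H_{k+1}, for its lift H_1/H_k \<rightarrow>
  H_1/H_{k+1}.\<close>

definition qfrob where "qfrob k q = K k <#> (gfrob H ` q)"

lemma proj_qc:
  assumes "k \<ge> 1" "h \<in> carrier H" shows "proj k (qc (Suc k) h) = qc k h"
proof -
  have "K k <#> K (Suc k) = K k"
  proof
    show "K k <#> K (Suc k) \<subseteq> K k"
      using K_Suc[OF assms(1)] subgroup.m_closed[OF K_subgroup] by (auto simp: set_mult_def)
    show "K k \<subseteq> K k <#> K (Suc k)"
      using subgroup.one_closed[OF K_subgroup, of "Suc k"] subgroup.subset[OF K_subgroup, of k]
      by (force simp: set_mult_def)
  qed
  then show ?thesis
    unfolding proj_def using setmult_rcos_assoc[of "K k" "K (Suc k)" h] subgroup.subset[OF K_subgroup] assms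
    by simp
qed

lemma qfrob_qc:
  assumes "\<And>x. x \<in> K k \<Longrightarrow> gfrob H x \<in> K j" "h \<in> carrier H"
  shows "qfrob j (qc k h) = qc j (gfrob H h)"
proof
  have sub: "x \<in> K k \<Longrightarrow> x \<in> carrier H" for x k using subgroup.subset[OF K_subgroup] by auto
  show "qfrob j (qc k h) \<subseteq> qc j (gfrob H h)"
  proof
    fix y assume "y \<in> qfrob j (qc k h)"
    then obtain x z where x: "x \<in> K j" "z \<in> K k" "y = x \<otimes> gfrob H (z \<otimes> h)"
      by (auto simp: qfrob_def set_mult_def r_coset_def)
    then have "y = (x \<otimes> gfrob H z) \<otimes> gfrob H h" using assms sub by (simp add: m_assoc)
    then show "y \<in> qc j (gfrob H h)"
      using subgroup.m_closed[OF K_subgroup x(1) assms(1)[OF x(2)]] by (auto simp: r_coset_def)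
  qed
  show "qc j (gfrob H h) \<subseteq> qfrob j (qc k h)"
  proof
    fix y assume "y \<in> qc j (gfrob H h)"
    then obtain x where x: "x \<in> K j" "y = x \<otimes> gfrob H h" by (auto simp: r_coset_def)
    have "h \<in> qc k h" using rcos_self[OF assms(2) K_subgroup] .
    then show "y \<in> qfrob j (qc k h)" using x by (auto simp: qfrob_def set_mult_def)
  qed
qed

lemma proj_hom: "k \<ge> 1 \<Longrightarrow> proj k \<in> hom (Qk p H (Suc k)) (Qk p H k)"
proof (rule homI)
  assume k: "k \<ge> 1"
  fix q q' assume "q \<in> carrier (Qk p H (Suc k))" "q' \<in> carrier (Qk p H (Suc k))"
  then obtain h h' where h: "h \<in> H1 p H" "h \<in> carrier H" "q = qc (Suc k) h"
    and h': "h' \<in> carrier H" "q' = qc (Suc k) h'"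
    by (metis Q_memE)
  show "proj k q \<in> carrier (Qk p H k)" using h k by (simp add: proj_qc qc_closed)
  show "proj k (q \<otimes>\<^bsub>Qk p H (Suc k)\<^esub> q') = proj k q \<otimes>\<^bsub>Qk p H k\<^esub> proj k q'"
    using h h' k by (simp add: Q_mult proj_qc)
qed

lemma qfrob_hom:
  assumes "\<And>x. x \<in> K k \<Longrightarrow> gfrob H x \<in> K j"
  shows "qfrob j \<in> hom (Qk p H k) (Qk p H j)"
proof (rule homI)
  fix q q' assume "q \<in> carrier (Qk p H k)" "q' \<in> carrier (Qk p H k)"
  then obtain h h' where h: "h \<in> H1 p H" "h \<in> carrier H" "q = qc k h"
    and h': "h' \<in> carrier H" "q' = qc k h'"
    by (metis Q_memE)
  show "qfrob j q \<in> carrier (Qk p H j)" using h by (simp add: qfrob_qc[OF assms] qc_closed gfrob_H1)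
  show "qfrob j (q \<otimes>\<^bsub>Qk p H k\<^esub> q') = qfrob j q \<otimes>\<^bsub>Qk p H j\<^esub> qfrob j q'"
    using h h' by (simp add: Q_mult qfrob_qc[OF assms])
qed

lemma proj_al:
  assumes "k \<ge> 1" "q \<in> carrier (Qk p H (Suc k))"
  shows "proj k (al j q) = al j (proj k q)"
proof -
  obtain h where h: "h \<in> H1 p H" "h \<in> carrier H" "q = qc (Suc k) h" using assms(2) by (rule Q_memE)
  then show ?thesis using assms(1) by (simp add: al_qc proj_qc)
qed

text \<open>Conjugation by \<iota>(j) becomes conjugation by \<phi>(\<iota>(j)) = \<iota>(p j),
  matching the effect of \<phi> on degrees of coefficients.\<close>

lemma qfrob_al:
  assumes "\<And>x. x \<in> K k \<Longrightarrow> gfrob H x \<in> K i" "q \<in> carrier (Qk p H k)"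
  shows "qfrob i (al j q) = al (p * j) (qfrob i q)"
proof -
  obtain h where h: "h \<in> H1 p H" "h \<in> carrier H" "q = qc k h" using assms(2) by (rule Q_memE)
  then show ?thesis by (simp add: al_qc qfrob_qc[OF assms(1)] gfrob_ioi del: of_nat_mult)
qed

lemma gfrob_K_same: "k \<ge> 1 \<Longrightarrow> x \<in> K k \<Longrightarrow> gfrob H x \<in> K k"
  using gfrob_K K_Suc by blast

text \<open>The second equation is the source of the contraction: it factors the Frobenius of
  H_1/H_{k+1} through H_1/H_k.\<close>

lemma proj_qfrob:
  assumes "k \<ge> 1" "q \<in> carrier (Qk p H (Suc k))"
  shows "proj k (qfrob (Suc k) q) = qfrob k (proj k q)"
    and "qfrob (Suc k) (proj k q) = qfrob (Suc k) q"
proof -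
  obtain h where h: "h \<in> H1 p H" "h \<in> carrier H" "q = qc (Suc k) h" using assms(2) by (rule Q_memE)
  note fr = qfrob_qc[OF gfrob_K_same] qfrob_qc[OF gfrob_K]
  show "proj k (qfrob (Suc k) q) = qfrob k (proj k q)"
    using h assms(1) by (simp add: proj_qc fr)
  show "qfrob (Suc k) (proj k q) = qfrob (Suc k) q"
    using h assms(1) by (simp add: proj_qc fr)
qed

text \<open>For k = 1 the generating set is H_1 itself, the power of \<phi> being the identity. So
  level 1 of the tower is a copy of R.\<close>

lemma Q_1: "carrier (Qk p H 1) = {\<one>\<^bsub>Qk p H 1\<^esub>}"
proof -
  have "K 1 = H1 p H" using K_subset_H1[of 1] K_generators[of 1] by auto
  moreover have "H1 p H #> h = H1 p H" if "h \<in> H1 p H" for h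
    using that H1_subset by (intro coset_join2 H1_subgroup) auto
  moreover have "\<one> \<in> H1 p H" by (rule subgroup.one_closed[OF H1_subgroup])
  ultimately show ?thesis unfolding Q_carrier Q_one by force
qed

end

section \<open>The completed skew group ring\<close>

locale skew_setting = R: prime_phi_ring p R + H: prime_phi_group p H
  for p :: nat and R :: "('r, 'm) phi_ring_scheme" and H :: "('h, 'n) phi_group_scheme" +
  fixes c :: "nat \<Rightarrow> nat"
  assumes exponents: "conj_exponents p H c"
begin

abbreviation "Q \<equiv> Qk p H"
abbreviation "act \<equiv> \<lambda>i. iota_conj H (Zp_of_int p (int i))"
abbreviation "S \<equiv> \<lambda>k. skew_group_ring p R H k (c k)"
abbreviation "Fr \<equiv> \<lambda>k. coeff_map R (carrier (Q k)) (carrier (Q k)) (frob R) (H.qfrob k)"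
abbreviation "\<pi> \<equiv> \<lambda>k. coeff_map R (carrier (Q (Suc k))) (carrier (Q k)) (\<lambda>r. r) (H.proj k)"

lemma act_period:
  assumes "k \<ge> 1" "q \<in> carrier (Q k)"
  shows "act (p ^ c k * m) q = q"
proof -
  have "Zp_of_int p (int (p ^ c k * m)) = Zp_of_int p (int p ^ c k) \<otimes>\<^bsub>Zp p\<^esub> Zp_of_int p (int m)"
    by (simp only: Zp_of_int_mult of_nat_mult of_nat_power)
  then show ?thesis
    using exponents assms Zp_of_int_carrier[OF H.p_pos] unfolding conj_exponents_def by metis
qed

lemma twisted: "k \<ge> 1 \<Longrightarrow> twisted_group p R (Q k) act (c k)"
  by (intro twisted_group.intro twisted_group_axioms.intro R.prime_phi_ring_axioms H.Q_group
      H.al_hom H.al_add act_period)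

lemma S_eq: "S k = twisted_ring p R (Q k) act (c k) (Fr k)"
  unfolding skew_group_ring_def twisted_ring_def Let_def H.qfrob_def[abs_def] by simp

lemma frob_S_eq: "frob (S k) = Fr k"
  by (simp add: S_eq twisted_ring_def)

lemma id_mem_ring_hom: "(\<lambda>r. r) \<in> ring_hom R R"
  by (rule ring_hom_memI) auto

lemma additive_\<pi>:
  "k \<ge> 1 \<Longrightarrow> twisted_additive p R (Q (Suc k)) act (c (Suc k)) (Q k) act (c k) (\<lambda>r. r) (H.proj k)"
  by (intro twisted_additive.intro twisted_additive_axioms.intro twisted id_mem_ring_hom H.proj_hom) auto

lemma additive_frob:
  "k \<ge> 1 \<Longrightarrow> twisted_additive p R (Q k) act (c k) (Q k) act (c k) (frob R) (H.qfrob k)"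
  by (intro twisted_additive.intro twisted_additive_axioms.intro twisted R.frob_hom
      H.qfrob_hom H.gfrob_K_same)

lemma additive_frob_lift:
  "k \<ge> 1 \<Longrightarrow> twisted_additive p R (Q k) act (c k) (Q (Suc k)) act (c (Suc k)) (frob R) (H.qfrob (Suc k))"
  by (intro twisted_additive.intro twisted_additive_axioms.intro twisted R.frob_hom
      H.qfrob_hom H.gfrob_K) auto

lemma S_ring: "k \<ge> 1 \<Longrightarrow> ring (S k)"
  unfolding S_eq by (rule twisted_group.T_ring[OF twisted])

text \<open>The exponents of two consecutive levels may be in either order; the maximum is a depth
  that works for both.\<close>

lemma \<pi>_ring_hom: "k \<ge> 1 \<Longrightarrow> \<pi> k \<in> ring_hom (S (Suc k)) (S k)"
  unfolding S_eq
  by (rule twisted_additive.cm_ring_hom[OF additive_\<pi>, where d = "max (c k) (c (Suc k))"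
        and d' = "max (c k) (c (Suc k))" and m = 1])
     (auto simp: H.proj_al)

text \<open>Frobenius raises the depth by one, whence the target depth \<open>Suc (c k)\<close>, and
  multiplies degrees by p.\<close>

lemma frob_ring_hom: "k \<ge> 1 \<Longrightarrow> frob (S k) \<in> ring_hom (S k) (S k)"
  unfolding frob_S_eq unfolding S_eq
  by (rule twisted_additive.cm_ring_hom[OF additive_frob, where d = "c k" and d' = "Suc (c k)" and m = p])
     (auto simp: H.qfrob_al[OF H.gfrob_K_same] R.homog_frob simp del: of_nat_mult)

lemma S_additive:
  assumes "k \<ge> 1"
  shows "abelian_group_hom (S (Suc k)) (S k) (\<pi> k)"
    and "abelian_group_hom (S k) (S k) (Fr k)"
    and "abelian_group_hom (S k) (S (Suc k)) (coeff_map R (carrier (Q k)) (carrier (Q (Suc k))) (frob R) (H.qfrob (Suc k)))"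
  unfolding S_eq
  using twisted_additive.cm_hom[OF additive_\<pi>[OF assms]] twisted_additive.cm_hom[OF additive_frob[OF assms]]
    twisted_additive.cm_hom[OF additive_frob_lift[OF assms]]
  by blast+

lemma hom_eq_on_monomial:
  assumes k: "k \<ge> 1" and g: "abelian_group_hom (S k) N g" and h: "abelian_group_hom (S k) N h"
    and eq: "\<And>r q. r \<in> carrier R \<Longrightarrow> q \<in> carrier (Q k) \<Longrightarrow> g (monomial R (Q k) r q) = h (monomial R (Q k) r q)"
    and f: "f \<in> carrier (S k)"
  shows "g f = h f"
  by (rule twisted_group.hom_eq_on_mon[OF twisted[OF k] g[unfolded S_eq] h[unfolded S_eq] _ f[unfolded S_eq]])
    (rule eq[OF R.homog_closed])

lemma tower: "ring_tower S \<pi>"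
proof (intro ring_tower.intro S_ring \<pi>_ring_hom frob_ring_hom)
  fix k x assume k: "(1 :: nat) \<le> k" and x: "x \<in> carrier (S (Suc k))"
  have k': "1 \<le> Suc k" by simp
  \<comment> \<open>The lift of Frobenius from level k to level k + 1. Frobenius on level k + 1 is
    this map after the projection, so it vanishes wherever the projection does.\<close>
  let ?\<psi> = "coeff_map R (carrier (Q k)) (carrier (Q (Suc k))) (frob R) (H.qfrob (Suc k))"
  note mon = twisted_additive.cm_mon[OF additive_\<pi>[OF k]] twisted_additive.cm_mon[OF additive_frob[OF k]]
    twisted_additive.cm_mon[OF additive_frob[OF k']] twisted_additive.cm_mon[OF additive_frob_lift[OF k]]
  have pc: "q \<in> carrier (Q (Suc k)) \<Longrightarrow> H.proj k q \<in> carrier (Q k)" for q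
    using H.proj_hom[OF k] by (auto simp: hom_def)
  have qfc: "q \<in> carrier (Q (Suc k)) \<Longrightarrow> H.qfrob (Suc k) q \<in> carrier (Q (Suc k))" for q
    using H.qfrob_hom[OF H.gfrob_K_same[OF k']] by (auto simp: hom_def)
  have "\<pi> k (Fr (Suc k) x) = Fr k (\<pi> k x)"
    by (rule hom_eq_on_monomial[OF k' abelian_group_hom_comp[OF S_additive(2)[OF k'] S_additive(1)[OF k]]
          abelian_group_hom_comp[OF S_additive(1)[OF k] S_additive(2)[OF k]] _ x])
      (simp add: mon pc qfc H.proj_qfrob[OF k])
  then show "\<pi> k (frob (S (Suc k)) x) = frob (S k) (\<pi> k x)" by (simp only: frob_S_eq)
  have 1: "Fr (Suc k) x = ?\<psi> (\<pi> k x)"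
    by (rule hom_eq_on_monomial[OF k' S_additive(2)[OF k']
          abelian_group_hom_comp[OF S_additive(1)[OF k] S_additive(3)[OF k]] _ x])
      (simp add: mon pc qfc H.proj_qfrob[OF k])
  assume "\<pi> k x = \<zero>\<^bsub>S k\<^esub>"
  then show "frob (S (Suc k)) x = \<zero>\<^bsub>S (Suc k)\<^esub>"
    using abelian_group_hom.hom_zero[OF S_additive(3)[OF k]] by (simp only: frob_S_eq 1)
qed auto

sublocale tower: ring_tower S \<pi> by (rule tower)

lemma completed_eq: "completed_skew_group_ring p R H c = tower.L"
  unfolding completed_skew_group_ring_def tower_limit_def Let_def H.proj_def[abs_def] ..

section \<open>The maps \<iota>_R and \<ell>_R\<close>

abbreviation "\<iota> \<equiv> iota_ring p R H"
abbreviation "\<rho> \<equiv> ell_ring p R H"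

lemma \<iota>_val: "k \<ge> 1 \<Longrightarrow> \<iota> r k = monomial R (Q k) r \<one>\<^bsub>Q k\<^esub>"
  by (simp add: iota_ring_def monomial_def)

lemma \<iota>_extensional: "\<iota> r \<in> extensional {1..}"
  by (simp add: iota_ring_def)

lemma Q_one_closed [simp]: "\<one>\<^bsub>Q k\<^esub> \<in> carrier (Q k)"
  using H.Q_group by (simp add: group.is_monoid Group.monoid.one_closed)

lemma monomial_one_hom: "k \<ge> 1 \<Longrightarrow> (\<lambda>r. monomial R (Q k) r \<one>\<^bsub>Q k\<^esub>) \<in> ring_hom R (S k)"
  unfolding S_eq by (rule twisted_group.mnl_one_hom[OF twisted])

lemma \<iota>_closed: "r \<in> carrier R \<Longrightarrow> \<iota> r \<in> carrier tower.L"
proof (rule tower.L_memI[OF \<iota>_extensional])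
  fix k :: nat assume k: "k \<ge> 1" and r: "r \<in> carrier R"
  show "\<iota> r k \<in> carrier (S k)"
    using ring_hom_closed[OF monomial_one_hom[OF k] r] k by (simp add: \<iota>_val)
  have "H.proj k \<one>\<^bsub>Q (Suc k)\<^esub> = \<one>\<^bsub>Q k\<^esub>"
    by (rule hom_one[OF H.proj_hom[OF k] H.Q_group H.Q_group])
  then show "\<pi> k (\<iota> r (Suc k)) = \<iota> r k"
    using twisted_additive.cm_mon[OF additive_\<pi>[OF k] r Q_one_closed] k by (simp add: \<iota>_val)
qed

lemma \<iota>_hom: "\<iota> \<in> ring_hom R tower.L"
proof (rule ring_hom_memI)
  fix r s assume r: "r \<in> carrier R" and s: "s \<in> carrier R"
  show "\<iota> (r \<otimes>\<^bsub>R\<^esub> s) = \<iota> r \<otimes>\<^bsub>tower.L\<^esub> \<iota> s"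
    by (rule tower.L_eqI[OF \<iota>_extensional tower.L_ops_extensional(1)])
      (simp add: tower.L_ops \<iota>_val ring_hom_mult[OF monomial_one_hom] r s)
  show "\<iota> (r \<oplus>\<^bsub>R\<^esub> s) = \<iota> r \<oplus>\<^bsub>tower.L\<^esub> \<iota> s"
    by (rule tower.L_eqI[OF \<iota>_extensional tower.L_ops_extensional(2)])
      (simp add: tower.L_ops \<iota>_val ring_hom_add[OF monomial_one_hom] r s)
next
  show "\<iota> \<one>\<^bsub>R\<^esub> = \<one>\<^bsub>tower.L\<^esub>"
    by (rule tower.L_eqI[OF \<iota>_extensional tower.L_ops_extensional(3)])
      (simp add: tower.L_ops \<iota>_val ring_hom_one[OF monomial_one_hom])
qed (rule \<iota>_closed)

lemma Fr_monomial_one: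
  assumes "k \<ge> 1" "r \<in> carrier R"
  shows "Fr k (monomial R (Q k) r \<one>\<^bsub>Q k\<^esub>) = monomial R (Q k) (frob R r) \<one>\<^bsub>Q k\<^esub>"
  using twisted_additive.cm_mon[OF additive_frob[OF assms(1)] assms(2) Q_one_closed]
    hom_one[OF H.qfrob_hom[OF H.gfrob_K_same[OF assms(1)]] H.Q_group H.Q_group] by simp

lemma \<iota>_frob: "r \<in> carrier R \<Longrightarrow> \<iota> (frob R r) = frob tower.L (\<iota> r)"
  by (rule tower.L_eqI[OF \<iota>_extensional tower.L_ops_extensional(5)])
    (simp add: tower.L_ops \<iota>_val frob_S_eq Fr_monomial_one)

lemma S_1_eq_monomial:
  assumes "f \<in> carrier (S 1)"
  shows "f = monomial R (Q 1) (f \<one>\<^bsub>Q 1\<^esub>) \<one>\<^bsub>Q 1\<^esub>"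
proof (rule extensionalityI[of _ "carrier (Q 1)"])
  have "1 \<le> (1 :: nat)" by simp
  note tw = twisted[OF this]
  show "f \<in> extensional (carrier (Q 1))"
    by (rule twisted_group.T_extensional[OF tw assms[unfolded S_eq]])
qed (use H.Q_1 in \<open>auto simp: monomial_def\<close>)

lemma S_1_val: "f \<in> carrier (S 1) \<Longrightarrow> f \<one>\<^bsub>Q 1\<^esub> \<in> carrier R"
  using twisted_group.val_closed[OF twisted, of 1 f] by (simp add: S_eq)

lemma ell_ring_eq:
  assumes "x \<in> carrier tower.L"
  shows "\<rho> x = x 1 \<one>\<^bsub>Q 1\<^esub>"
proof -
  have x1: "x 1 \<one>\<^bsub>Q 1\<^esub> \<in> carrier R" using tower.L_val[OF assms, of 1] by (intro S_1_val) simp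
  \<comment> \<open>The sum in \<open>ell_ring\<close> has at most one term; it is empty exactly
    when the coefficient is zero.\<close>
  have "coeff_supp R (carrier (Q 1)) (x 1) = (if x 1 \<one>\<^bsub>Q 1\<^esub> = \<zero>\<^bsub>R\<^esub> then {} else {\<one>\<^bsub>Q 1\<^esub>})"
    using H.Q_1 by (auto simp: coeff_supp_def)
  then show ?thesis using x1 by (simp add: ell_ring_def)
qed

text \<open>Every element of level 1 is r times the trivial coset, so evaluation there inverts the
  ring homomorphism from \<open>monomial_one_hom\<close>.\<close>

lemma eval_1_hom: "(\<lambda>f. f \<one>\<^bsub>Q 1\<^esub>) \<in> ring_hom (S 1) R"
proof (rule ring_hom_memI)
  let ?m = "\<lambda>r. monomial R (Q 1) r \<one>\<^bsub>Q 1\<^esub>"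
  have m1: "?m r \<one>\<^bsub>Q 1\<^esub> = r" for r by (simp add: monomial_def)
  have k: "1 \<le> (1 :: nat)" by simp
  note h = monomial_one_hom[OF k]
  fix f g assume f: "f \<in> carrier (S 1)" and g: "g \<in> carrier (S 1)"
  note fc = S_1_val[OF f] and gc = S_1_val[OF g]
  have "f \<otimes>\<^bsub>S 1\<^esub> g = ?m (f \<one>\<^bsub>Q 1\<^esub>) \<otimes>\<^bsub>S 1\<^esub> ?m (g \<one>\<^bsub>Q 1\<^esub>)"
    using S_1_eq_monomial[OF f] S_1_eq_monomial[OF g] by simp
  also have "\<dots> = ?m (f \<one>\<^bsub>Q 1\<^esub> \<otimes>\<^bsub>R\<^esub> g \<one>\<^bsub>Q 1\<^esub>)" by (rule ring_hom_mult[OF h fc gc, symmetric])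
  finally show "(f \<otimes>\<^bsub>S 1\<^esub> g) \<one>\<^bsub>Q 1\<^esub> = f \<one>\<^bsub>Q 1\<^esub> \<otimes>\<^bsub>R\<^esub> g \<one>\<^bsub>Q 1\<^esub>" by (simp only: m1)
  have "f \<oplus>\<^bsub>S 1\<^esub> g = ?m (f \<one>\<^bsub>Q 1\<^esub>) \<oplus>\<^bsub>S 1\<^esub> ?m (g \<one>\<^bsub>Q 1\<^esub>)"
    using S_1_eq_monomial[OF f] S_1_eq_monomial[OF g] by simp
  also have "\<dots> = ?m (f \<one>\<^bsub>Q 1\<^esub> \<oplus>\<^bsub>R\<^esub> g \<one>\<^bsub>Q 1\<^esub>)" by (rule ring_hom_add[OF h fc gc, symmetric])
  finally show "(f \<oplus>\<^bsub>S 1\<^esub> g) \<one>\<^bsub>Q 1\<^esub> = f \<one>\<^bsub>Q 1\<^esub> \<oplus>\<^bsub>R\<^esub> g \<one>\<^bsub>Q 1\<^esub>" by (simp only: m1)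
next
  show "\<one>\<^bsub>S 1\<^esub> \<one>\<^bsub>Q 1\<^esub> = \<one>\<^bsub>R\<^esub>"
    using ring_hom_one[OF monomial_one_hom[of 1], symmetric] by (simp add: monomial_def)
qed (rule S_1_val)

lemma \<rho>_hom: "\<rho> \<in> ring_hom tower.L R"
proof -
  have "(\<lambda>x. x 1 \<one>\<^bsub>Q 1\<^esub>) \<in> ring_hom tower.L R"
    using ring_hom_trans[OF tower.eval_hom[of 1] eval_1_hom] by (simp add: comp_def)
  then show ?thesis
    using tower.L_closed by (auto simp: ring_hom_def ell_ring_eq Pi_iff)
qed

lemma \<rho>_frob:
  assumes x: "x \<in> carrier tower.L"
  shows "\<rho> (frob tower.L x) = frob R (\<rho> x)"
proof -
  have x1: "x 1 \<in> carrier (S 1)" using tower.L_val[OF x, of 1] by simp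
  have "frob tower.L x 1 = Fr 1 (x 1)" using tower.L_ops(5)[of 1 x] by (simp only: frob_S_eq)
  also have "\<dots> = Fr 1 (monomial R (Q 1) (x 1 \<one>\<^bsub>Q 1\<^esub>) \<one>\<^bsub>Q 1\<^esub>)"
    using S_1_eq_monomial[OF x1] by simp
  also have "\<dots> = monomial R (Q 1) (frob R (x 1 \<one>\<^bsub>Q 1\<^esub>)) \<one>\<^bsub>Q 1\<^esub>"
    by (rule Fr_monomial_one[OF _ S_1_val[OF x1]]) simp
  finally show ?thesis using x tower.L_closed(5)[OF x] by (simp add: ell_ring_eq monomial_def)
qed

lemma \<rho>_kernel: "tower.L_ideal 0 = {x \<in> carrier tower.L. \<rho> x = \<zero>\<^bsub>R\<^esub>}"
proof -
  have "x 1 = \<zero>\<^bsub>S 1\<^esub> \<longleftrightarrow> \<rho> x = \<zero>\<^bsub>R\<^esub>" if x: "x \<in> carrier tower.L" for x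
  proof -
    have x1: "x 1 \<in> carrier (S 1)" using tower.L_val[OF x, of 1] by simp
    have z: "monomial R (Q 1) \<zero>\<^bsub>R\<^esub> \<one>\<^bsub>Q 1\<^esub> = \<zero>\<^bsub>S 1\<^esub>"
      using ring_hom_zero[OF monomial_one_hom[of 1] R.ring_axioms S_ring[of 1]] by simp
    show ?thesis
      unfolding ell_ring_eq[OF x]
      using S_1_eq_monomial[OF x1] z ring_hom_zero[OF eval_1_hom S_ring[of 1] R.ring_axioms] by auto
  qed
  then show ?thesis by (auto simp: tower.L_ideal_def)
qed

lemma filtered_retraction: "filtered_retraction R tower.L \<iota> \<rho> tower.L_ideal"
proof -
  have R: "frob_ring R"
    by (intro frob_ring.intro frob_ring_axioms.intro R.ring_axioms R.frob_hom)
  have nontrivial: "\<one>\<^bsub>tower.L\<^esub> \<noteq> \<zero>\<^bsub>tower.L\<^esub>"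
    using ring_hom_one[OF \<rho>_hom] ring_hom_zero[OF \<rho>_hom tower.L_ring R.ring_axioms] R.nontrivial by auto
  have "\<rho> (\<iota> r) = r" if "r \<in> carrier R" for r
    using \<iota>_closed[OF that] by (simp add: ell_ring_eq \<iota>_val monomial_def)
  then show ?thesis
    by (intro filtered_retraction.intro filtered_retraction_axioms.intro frob_retraction.intro
        frob_retraction_axioms.intro frob_ring_hom.intro frob_ring_hom_axioms.intro R
        tower.L_frob_ring tower.L_filtered \<iota>_hom \<iota>_frob \<rho>_hom \<rho>_frob \<rho>_kernel nontrivial R.nontrivial)
qed

end

theorem proposition3p1:
  fixes p :: nat and R :: "'r phi_ring" and H :: "'h phi_group" and c :: "nat \<Rightarrow> nat"
  assumes "prime p"
    and "phi_ring p R"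
    and "phi_group p H"
    and "conj_exponents p H c"
  shows "let S = completed_skew_group_ring p R H c in
       phi_functor S R
         (DD p R H c :: (nat \<Rightarrow> 'h set \<Rightarrow> 'r, 'd) frob_module \<Rightarrow> _) (DD_map p R H c)
     \<and> phi_functor R S
         (MM p R H c :: ('r, 'e) frob_module \<Rightarrow> _) (MM_map p R H c)
     \<and> (\<exists>\<eta>. phi_natural_iso S S
         (\<lambda>D. D) (\<lambda>D E f. f)
         (\<lambda>D :: (nat \<Rightarrow> 'h set \<Rightarrow> 'r, 'd) frob_module. MM p R H c (DD p R H c D))
         (\<lambda>D E f. MM_map p R H c (DD p R H c D) (DD p R H c E) (DD_map p R H c D E f)) \<eta>)
     \<and> (\<exists>\<epsilon>. phi_natural_iso R R
         (\<lambda>E :: ('r, 'e) frob_module. DD p R H c (MM p R H c E))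
         (\<lambda>D E f. DD_map p R H c (MM p R H c D) (MM p R H c E) (MM_map p R H c D E f))
         (\<lambda>E. E) (\<lambda>D E f. f) \<epsilon>)"
proof -
  interpret skew_setting p R H c
    by (intro skew_setting.intro skew_setting_axioms.intro prime_phi_ring.intro prime_phi_ring_axioms.intro
        prime_phi_group.intro prime_phi_group_axioms.intro assms)
  show ?thesis
    unfolding Let_def DD_def DD_map_def MM_def MM_map_def completed_eq
    by (rule filtered_retraction.phi_equivalence[OF filtered_retraction])
qed

end
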